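(* Let $p=2$, $G=SL(3)$, let $w=s_\alpha s_\beta$, let $\lambda=(\lambda_1,\lambda_2)$ be a dominant weight, and let $M(\lambda)=H^0(s_\alpha s_\beta,\lambda)$. Then $$\mathcal{V}_{B_1}(M(\lambda))=\begin{cases}\mathfrak{u}_\alpha, & \text{if }\lambda=(2n-1,0)\ \ (n\ge1),\\ \mathfrak{u}_\alpha\cup\mathfrak{u}_\beta, & \text{if }\lambda=(2n,0)\ \ (n\ge0),\\ \mathfrak{u}_\alpha\cup\mathfrak{u}_\beta, & \text{if }\lambda_2\ne0.\end{cases}$$
   Context: Setting: $k$ is an algebraically closed field of characteristic $p=2$, $G=SL(3)$ over $k$ with maximal torus $T$, simple roots $\Delta=\{\alpha,\beta\}$, Weyl group $W$, and $B\supset T$ the Borel subgroup corresponding to the negative roots. A weight is written $\lambda=(\lambda_1,\lambda_2)$ with $\lambda_1=(\lambda,\alpha^\vee)$, $\lambda_2=(\lambda,\beta^\vee)$. $\mathfrak{u}$ is the Lie algebra of the unipotent radical of $B$. $P_\alpha\supset B$ is the minimal parabolic subgroup whose Levi factor containing $T$ has roots $\pm\alpha$, and $\mathfrak{u}_\alpha$ is the Lie algebra of its unipotent radical; similarly $P_\beta$, $\mathfrak{u}_\beta$. For $w\in W$, $X(w)$ is the closure of $B\dot wB/B$ in $G/B$; $\mathcal{L}(\lambda)$ is the line bundle on $G/B$ with $H^0(G/B,\mathcal{L}(\lambda))=\operatorname{ind}_B^G\lambda$; $H^0(w,\lambda)=H^0(X(w),\mathcal{L}(\lambda))$. One has $M(\lambda)\cong\operatorname{ind}_B^{P_\alpha}\operatorname{ind}_B^{P_\beta}\lambda$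 as $B$-modules. Support varieties over the first Frobenius kernel $B_1$: for a finite-dimensional $B_1$-module $M$, $\mathcal{V}_{B_1}(M)$ is the closed subvariety of $\mathrm{Maxspec}\,H^{\bullet}(B_1,k)$ defined by the annihilator of $\mathrm{Ext}^\bullet_{B_1}(M,M)$. It is identified with $\{x\in\mathcal{N}_1(\mathfrak{u}) : M\text{ is not projective over the restricted enveloping algebra } k[x]/(x^2)\text{ of }\langle x\rangle\}\cup\{0\}$, where $\mathcal{N}_1(\mathfrak{u})=\{x\in\mathfrak{u}:x^{[2]}=0\}=\mathfrak{u}_\alpha\cup\mathfrak{u}_\beta$. *)

theory Defs
  imports "HOL-Analysis.Analysis" "HOL-Library.Function_Algebras"
begin

type_synonym 'k mat3 = "'k^3^3"

section \<open>Regular functions and Zariski closure\<close>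

inductive_set subalg :: "('a \<Rightarrow> 'k::comm_ring_1) set \<Rightarrow> ('a \<Rightarrow> 'k) set"
  for X :: "('a \<Rightarrow> 'k) set" where
  const: "(\<lambda>_. c) \<in> subalg X"
| gen: "f \<in> X \<Longrightarrow> f \<in> subalg X"
| add: "f \<in> subalg X \<Longrightarrow> g \<in> subalg X \<Longrightarrow> (\<lambda>z. f z + g z) \<in> subalg X"
| mult: "f \<in> subalg X \<Longrightarrow> g \<in> subalg X \<Longrightarrow> (\<lambda>z. f z * g z) \<in> subalg X"

definition polys :: "('k::field mat3 \<Rightarrow> 'k) set" where
  "polys = subalg {\<lambda>g. g $ r $ s | r s. True}"

definition SL3 :: "'k::field mat3 set" where
  "SL3 = {g. det g = 1}"

definition zclosure :: "'k::field mat3 set \<Rightarrow> 'k mat3 set" where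
  "zclosure S = {g \<in> SL3. \<forall>F \<in> polys. (\<forall>h\<in>S. F h = 0) \<longrightarrow> F g = 0}"

section \<open>The group, its Lie algebra and the sections over a Schubert variety\<close>

text \<open>
  The torus \<open>T\<close> is the diagonal one, \<open>\<alpha> = \<epsilon>\<^sub>1 - \<epsilon>\<^sub>2\<close> and \<open>\<beta> = \<epsilon>\<^sub>2 - \<epsilon>\<^sub>3\<close>.
  The Borel subgroup of the negative roots then consists of the lower triangular matrices,
  and the root subspaces of \<open>-\<alpha>\<close>, \<open>-\<beta>\<close>, \<open>-\<alpha>-\<beta>\<close> are the matrix entries
  (2,1), (3,2), (3,1).
\<close>

definition borel3 :: "'k::field mat3 set" where
  "borel3 = {b \<in> SL3. b $ 1 $ 2 = 0 \<and> b $ 1 $ 3 = 0 \<and> b $ 2 $ 3 = 0}"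

definition lie_u :: "'k::field mat3 set" where
  "lie_u = {x. (\<forall>i. x $ i $ i = 0) \<and> x $ 1 $ 2 = 0 \<and> x $ 1 $ 3 = 0 \<and> x $ 2 $ 3 = 0}"

definition lie_u_alpha :: "'k::field mat3 set" where
  "lie_u_alpha = {x \<in> lie_u. x $ 2 $ 1 = 0}"

definition lie_u_beta :: "'k::field mat3 set" where
  "lie_u_beta = {x \<in> lie_u. x $ 3 $ 2 = 0}"

definition s_alpha :: "'k::field mat3" where
  "s_alpha = vector [vector [0, 1, 0], vector [- 1, 0, 0], vector [0, 0, 1]]"

definition s_beta :: "'k::field mat3" where
  "s_beta = vector [vector [1, 0, 0], vector [0, 0, 1], vector [0, - 1, 0]]"

text \<open>
  The character of \<open>B\<close> with \<open>(\<lambda>, \<alpha>\<^sup>\<or>) = l1\<close> and \<open>(\<lambda>, \<beta>\<^sup>\<or>) = l2\<close>, that is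
  \<open>\<lambda> = l1 \<epsilon>\<^sub>1 + l2 (\<epsilon>\<^sub>1 + \<epsilon>\<^sub>2)\<close>.
\<close>

definition weight :: "int \<Rightarrow> int \<Rightarrow> 'k::field mat3 \<Rightarrow> 'k" where
  "weight l1 l2 b = (b $ 1 $ 1) powi (l1 + l2) * (b $ 2 $ 2) powi l2"

text \<open>
  The preimage in \<open>G\<close> of the Schubert variety \<open>X(w)\<close>, for a representative of \<open>w\<close> in \<open>N(T)\<close>.
\<close>

definition schubert_preimage :: "'k::field mat3 \<Rightarrow> 'k mat3 set" where
  "schubert_preimage w = zclosure {b ** w ** b' | b b'. b \<in> borel3 \<and> b' \<in> borel3}"

text \<open>
  A rational module: underlying set, scalar multiplication and action of group elements.
  It is meant to be used with the addition of the surrounding type; the action is only relevant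
  for the elements of the group under consideration.
\<close>

record ('k, 'v) rmod =
  car :: "'v set"
  scl :: "'k \<Rightarrow> 'v \<Rightarrow> 'v"
  act :: "'k mat3 \<Rightarrow> 'v \<Rightarrow> 'v"

text \<open>
  \<open>H\<^sup>0(X(w), \<L>(\<lambda>))\<close>. A section over \<open>X(w)\<close> of the line bundle associated with \<open>\<lambda>\<close> is a regular
  function \<open>f\<close> on the preimage \<open>Y\<close> of \<open>X(w)\<close> with \<open>f (g b) = \<lambda>(b)\<^sup>-\<^sup>1 f g\<close>; for \<open>Y = G\<close> this is
  the induced module of \<open>\<lambda>\<close>. Functions on \<open>Y\<close> are extended by \<open>0\<close>. The
  preimage is closed in the affine variety of all matrices, so its regular functions are the
  restrictions of polynomials. The group \<open>B\<close> acts by left translation.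
\<close>

definition H0 :: "'k::field mat3 \<Rightarrow> int \<Rightarrow> int \<Rightarrow> ('k, 'k mat3 \<Rightarrow> 'k) rmod" where
  "H0 w l1 l2 =
    \<lparr> car = {f. (\<exists>F\<in>polys. \<forall>g\<in>schubert_preimage w. f g = F g)
             \<and> (\<forall>g. g \<notin> schubert_preimage w \<longrightarrow> f g = 0)
             \<and> (\<forall>g\<in>schubert_preimage w. \<forall>b\<in>borel3. f (g ** b) = inverse (weight l1 l2 b) * f g)},
      scl = (\<lambda>c f g. c * f g),
      act = (\<lambda>b f g. f (matrix_inv b ** g)) \<rparr>"

section \<open>Cohomology of first Frobenius kernels\<close>

text \<open>
  Let \<open>H\<close> be a closed subgroup of \<open>SL3\<close> and let \<open>H\<^sub>1\<close> be its first Frobenius kernel, the closed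
  subgroup scheme of \<open>H\<close> defined by \<open>g\<^sub>r\<^sub>s\<^sup>p = \<delta>\<^sub>r\<^sub>s\<close>. The cohomology of \<open>H\<^sub>1\<close> with coefficients in
  a rational \<open>H\<close>-module \<open>N\<close> is that of the Hochschild complex with terms \<open>k[H\<^sub>1\<^sup>n] \<otimes> N\<close>.
  Since \<open>k[H\<^sub>1\<^sup>n] = k[H\<^sup>n] / I\<^sub>n\<close> with \<open>I\<^sub>n\<close> generated by the functions \<open>(g\<^sub>i)\<^sub>r\<^sub>s\<^sup>p - \<delta>\<^sub>r\<^sub>s\<close>, cochains are
  represented by regular maps from \<open>H\<^sup>n\<close> to \<open>N\<close>, and all identities between them are understood
  modulo \<open>I\<^sub>n \<otimes> N\<close>. A point of \<open>H\<^sup>n\<close> is a sequence of which only the entries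
  with index below \<open>n\<close> matter.
\<close>

definition points :: "'k::field mat3 set \<Rightarrow> nat \<Rightarrow> (nat \<Rightarrow> 'k mat3) set" where
  "points H n = {g. \<forall>i<n. g i \<in> H}"

definition tuple_polys :: "nat \<Rightarrow> ((nat \<Rightarrow> 'k::field mat3) \<Rightarrow> 'k) set" where
  "tuple_polys n = subalg {\<lambda>g. g i $ r $ s | i r s. i < n}"

definition frob_ideal :: "nat \<Rightarrow> ((nat \<Rightarrow> 'k::field mat3) \<Rightarrow> 'k) set" where
  "frob_ideal n =
    {\<lambda>g. \<Sum>i<n. \<Sum>r\<in>UNIV. \<Sum>s\<in>UNIV. q i r s g * ((g i $ r $ s) ^ CHAR('k) - mat 1 $ r $ s)
      | q. \<forall>i r s. q i r s \<in> tuple_polys n}"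

inductive_set tensors ::
  "((nat \<Rightarrow> 'k mat3) \<Rightarrow> 'k) set \<Rightarrow> ('k, 'v::ab_group_add) rmod \<Rightarrow> ((nat \<Rightarrow> 'k mat3) \<Rightarrow> 'v) set"
  for A :: "((nat \<Rightarrow> 'k mat3) \<Rightarrow> 'k) set" and N :: "('k, 'v::ab_group_add) rmod" where
  zero: "(\<lambda>_. 0) \<in> tensors A N"
| add: "F \<in> tensors A N \<Longrightarrow> a \<in> A \<Longrightarrow> v \<in> car N \<Longrightarrow> (\<lambda>g. F g + scl N (a g) v) \<in> tensors A N"

definition cochains ::
  "'k::field mat3 set \<Rightarrow> nat \<Rightarrow> ('k, 'v::ab_group_add) rmod \<Rightarrow> ((nat \<Rightarrow> 'k mat3) \<Rightarrow> 'v) set" where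
  "cochains H n N = {f. \<exists>F \<in> tensors (tuple_polys n) N. \<forall>g \<in> points H n. f g = F g}"

text \<open>The regular maps on \<open>H\<^sup>n\<close> whose restriction to \<open>H\<^sub>1\<^sup>n\<close> is zero.\<close>

definition null_cochains ::
  "'k::field mat3 set \<Rightarrow> nat \<Rightarrow> ('k, 'v::ab_group_add) rmod \<Rightarrow> ((nat \<Rightarrow> 'k mat3) \<Rightarrow> 'v) set" where
  "null_cochains H n N = {f. \<exists>F \<in> tensors (frob_ideal n) N. \<forall>g \<in> points H n. f g = F g}"

definition cobound ::
  "('k::field, 'v::ab_group_add) rmod \<Rightarrow> nat \<Rightarrow> ((nat \<Rightarrow> 'k mat3) \<Rightarrow> 'v) \<Rightarrow> (nat \<Rightarrow> 'k mat3) \<Rightarrow> 'v" where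
  "cobound N n f g =
     act N (g 0) (f (\<lambda>i. g (Suc i)))
   + (\<Sum>j<n. scl N ((- 1) ^ Suc j)
        (f (\<lambda>i. if i < j then g i else if i = j then g j ** g (Suc j) else g (Suc i))))
   + scl N ((- 1) ^ Suc n) (f g)"

definition cocycles ::
  "'k::field mat3 set \<Rightarrow> nat \<Rightarrow> ('k, 'v::ab_group_add) rmod \<Rightarrow> ((nat \<Rightarrow> 'k mat3) \<Rightarrow> 'v) set" where
  "cocycles H n N = {f \<in> cochains H n N. cobound N n f \<in> null_cochains H (Suc n) N}"

definition coboundaries ::
  "'k::field mat3 set \<Rightarrow> nat \<Rightarrow> ('k, 'v::ab_group_add) rmod \<Rightarrow> ((nat \<Rightarrow> 'k mat3) \<Rightarrow> 'v) set" where
  "coboundaries H n N = (case n of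
      0 \<Rightarrow> null_cochains H 0 N
    | Suc m \<Rightarrow> {f. \<exists>e \<in> cochains H m N. (\<lambda>g. f g - cobound N m e g) \<in> null_cochains H (Suc m) N})"

definition triv_mod :: "('k::field, 'k) rmod" where
  "triv_mod = \<lparr> car = UNIV, scl = (*), act = (\<lambda>_ v. v) \<rparr>"

definition end_mod :: "('k::field, 'v::ab_group_add) rmod \<Rightarrow> ('k, 'v \<Rightarrow> 'v) rmod" where
  "end_mod M =
    \<lparr> car = {\<phi>. (\<forall>v\<in>car M. \<phi> v \<in> car M)
             \<and> (\<forall>v\<in>car M. \<forall>w\<in>car M. \<phi> (v + w) = \<phi> v + \<phi> w)
             \<and> (\<forall>c. \<forall>v\<in>car M. \<phi> (scl M c v) = scl M c (\<phi> v))
             \<and> (\<forall>v. v \<notin> car M \<longrightarrow> \<phi> v = 0)},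
      scl = (\<lambda>c \<phi> v. if v \<in> car M then scl M c (\<phi> v) else 0),
      act = (\<lambda>g \<phi> v. if v \<in> car M then act M g (\<phi> (act M (matrix_inv g) v)) else 0) \<rparr>"

primrec seq_prod :: "nat \<Rightarrow> (nat \<Rightarrow> 'k::field mat3) \<Rightarrow> 'k mat3" where
  "seq_prod 0 g = mat 1"
| "seq_prod (Suc n) g = seq_prod n g ** g n"

definition cup ::
  "('k::field, 'v::ab_group_add) rmod \<Rightarrow> nat \<Rightarrow> ((nat \<Rightarrow> 'k mat3) \<Rightarrow> 'k) \<Rightarrow> ((nat \<Rightarrow> 'k mat3) \<Rightarrow> 'v)
    \<Rightarrow> (nat \<Rightarrow> 'k mat3) \<Rightarrow> 'v" where
  "cup N n c d g = scl N (c g) (act N (seq_prod n g) (d (\<lambda>i. g (n + i))))"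

text \<open>
  For finite-dimensional \<open>M\<close> one has \<open>Ext\<^sup>m(M, M) = H\<^sup>m(H\<^sub>1, End(M))\<close>, on which the classes of
  \<open>H\<^sup>n(H\<^sub>1, k)\<close> act by the cup product. The following are the cocycles representing the
  degree \<open>n\<close> part of the annihilator of \<open>Ext\<^sup>\<bullet>(M, M)\<close> in \<open>H\<^sup>\<bullet>(H\<^sub>1, k)\<close>.
\<close>

definition ext_annihilator ::
  "'k::field mat3 set \<Rightarrow> nat \<Rightarrow> ('k, 'v::ab_group_add) rmod \<Rightarrow> ((nat \<Rightarrow> 'k mat3) \<Rightarrow> 'k) set" where
  "ext_annihilator H n M =
    {c \<in> cocycles H n triv_mod.
      \<forall>m. \<forall>d \<in> cocycles H m (end_mod M). cup (end_mod M) n c d \<in> coboundaries H (n + m) (end_mod M)}"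

section \<open>Support varieties\<close>

text \<open>The restricted structure on \<open>\<uu>\<close> is \<open>x\<^sup>[\<^sup>p\<^sup>] = x\<^sup>p\<close>; here \<open>p = 2\<close>.\<close>

definition N1_u :: "'k::field mat3 set" where
  "N1_u = {x \<in> lie_u. x ** x = 0}"

definition one_param :: "'k::field mat3 \<Rightarrow> 'k mat3 set" where
  "one_param x = {mat 1 + (\<chi> r s. t * x $ r $ s) | t. True}"

text \<open>
  For \<open>p = 2\<close> the maximal ideals of \<open>H\<^sup>\<bullet>(B\<^sub>1, k)\<close> are parametrised by \<open>x \<in> N\<^sub>1(\<uu>)\<close> as follows. The
  first Frobenius kernel \<open>\<langle>x\<rangle>\<^sub>1\<close> of the one-parameter group of the \<open>1 + t x\<close> is the subgroup
  scheme of \<open>B\<^sub>1\<close> with Lie algebra spanned by \<open>x\<close>. If \<open>x \<noteq> 0\<close>, then \<open>H\<^sup>\<bullet>(\<langle>x\<rangle>\<^sub>1, k) = k[\<xi>]\<close>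
  with \<open>\<xi>\<close> of degree 1 given by the coordinate \<open>t\<close>, and the ideal of \<open>x\<close> is the kernel of
  restriction to \<open>\<langle>x\<rangle>\<^sub>1\<close> followed by \<open>\<xi> = 1\<close>; the ideal of \<open>0\<close> is the augmentation ideal.
  A homogeneous class lies in the ideal of \<open>x\<close> iff its restriction to \<open>\<langle>x\<rangle>\<^sub>1\<close> vanishes,
  and the annihilator of \<open>Ext\<^sup>\<bullet>(M, M)\<close> is a homogeneous ideal. Hence the following is the
  closed subvariety of the maximal spectrum defined by that annihilator, as a subset of \<open>\<uu>\<close>.
\<close>

definition support_variety_B1 :: "('k::field, 'v::ab_group_add) rmod \<Rightarrow> 'k mat3 set" where
  "support_variety_B1 M =
    {x \<in> N1_u. \<forall>n. \<forall>c \<in> ext_annihilator borel3 n M. c \<in> coboundaries (one_param x) n triv_mod}"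

end

theory Submission
  imports Defs
begin

text \<open>
  A point \<open>x \<noteq> 0\<close> of \<open>\<N>\<^sub>1(\<uu>) = \<uu>\<^sub>\<alpha> \<union> \<uu>\<^sub>\<beta>\<close> belongs to the support variety if and only if the module is
  not projective over \<open>k[x]/(x\<^sup>2)\<close>. The module can be computed. Let \<open>(q\<^sub>1, q\<^sub>2, q\<^sub>3)\<close> be the first row of \<open>g\<^sup>-\<^sup>1\<close>
  and \<open>(r\<^sub>1, r\<^sub>2, r\<^sub>3)\<close> the last column of \<open>g\<close>. On the preimage of the Schubert variety \<open>q\<^sub>3 = 0\<close>, so that
  \<open>\<rho> = r\<^sub>1 / q\<^sub>2 = - r\<^sub>2 / q\<^sub>1\<close> is regular, and the sections of weight \<open>\<lambda>\<close> are the sums of the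
  \<open>\<rho>\<^sup>j r\<^sub>3\<^sup>i P(q\<^sub>1, q\<^sub>2)\<close> with \<open>i + j = \<lambda>\<^sub>2\<close> and \<open>P\<close> homogeneous of degree \<open>\<lambda>\<^sub>1 + j\<close>.

  An element \<open>x\<close> of \<open>\<uu>\<^sub>\<alpha>\<close> fixes \<open>q\<^sub>1\<close>, \<open>q\<^sub>2\<close> and \<open>\<rho>\<close> and sends \<open>r\<^sub>3\<close> to \<open>\<rho>\<close> times a linear form \<open>h\<close> in \<open>q\<^sub>1\<close> and \<open>q\<^sub>2\<close>.
  The sections with \<open>i = 0\<close> are killed, and they lie in the image only if \<open>h\<close> divides \<open>P\<close>; so \<open>x\<close> is
  always in the support variety. An element \<open>x\<close> of \<open>\<uu>\<^sub>\<beta>\<close> outside \<open>\<uu>\<^sub>\<alpha>\<close> fixes \<open>\<rho>\<close> and a suitable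
  combination of \<open>r\<^sub>3\<close> and \<open>r\<^sub>2\<close>, and acts on \<open>P\<close> as a multiple of \<open>q\<^sub>2 \<partial>/\<partial>q\<^sub>1\<close>. This is free on the polynomials
  of odd degree only, and an even degree \<open>\<lambda>\<^sub>1 + j\<close> with \<open>0 \<le> j \<le> \<lambda>\<^sub>2\<close> exists unless \<open>\<lambda>\<^sub>2 = 0\<close> and \<open>\<lambda>\<^sub>1\<close> is odd.

  The definition of the support variety by annihilators is reached in both directions by explicit
  cocycles. On the Frobenius kernel of a one-parameter group every cochain has a top coefficient, its
  value at \<open>x \<otimes> \<dots> \<otimes> x\<close>; it vanishes on coboundaries, and a cocycle on which it vanishes is a
  coboundary (\<open>cocycle_topcoeff_0_imp_coboundary\<close>). If a class \<open>c\<close> annihilates the identity of \<open>M\<close>, then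
  the top coefficient of \<open>c\<close> times the identity is a commutator of \<open>x\<close> with an endomorphism. It
  therefore vanishes as soon as some vector is killed by \<open>x\<close> and not contained in the image of \<open>x\<close>
  (\<open>support_variety_criterion\<close>). The vectors used are the sections found above, and a linear form
  given by evaluation at a point separates them from the image (\<open>lie_u_alpha_support\<close>,
  \<open>lie_u_beta_support\<close>).

  For \<open>\<lambda> = (m, 0)\<close> with \<open>m\<close> odd the module is the \<open>m\<close>-th symmetric power, and \<open>q\<^sub>1 \<partial>/\<partial>q\<^sub>2\<close> and \<open>q\<^sub>2 \<partial>/\<partial>q\<^sub>1\<close> have the
  commutator \<open>m = 1\<close>. Hence \<open>q\<^sub>1 \<partial>/\<partial>q\<^sub>2\<close>, a vector of weight \<open>\<alpha>\<close>, trivialises the class of the coordinate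
  \<open>x\<^sub>2\<^sub>1\<close> in the cohomology of the endomorphism ring. The square of this coordinate is a class with trivial
  coefficients which annihilates the Ext algebra and vanishes exactly on \<open>\<uu>\<^sub>\<alpha>\<close>
  (\<open>alpha_class_annihilates\<close>, \<open>topcoeff_alpha_class\<close>).
\<close>

section \<open>Polynomial functions over an infinite field of characteristic two\<close>

lemma char2_add_self:
  assumes "(2::'k::comm_ring_1) = 0" shows "x + x = (0::'k)"
  using assms by (metis mult_2 mult_zero_left)

lemma char2_minus:
  assumes "(2::'k::comm_ring_1) = 0" shows "- x = (x::'k)"
  using char2_add_self[OF assms, of x] by (simp add: minus_unique)

lemma char2_diff:
  assumes "(2::'k::comm_ring_1) = 0" shows "x - y = x + (y::'k)"
  using char2_minus[OF assms, of y] by (metis diff_conv_add_uminus)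

lemma char2_square_add:
  assumes "(2::'k::comm_ring_1) = 0" shows "(x + y)\<^sup>2 = x\<^sup>2 + (y::'k)\<^sup>2"
proof -
  have "(x + y)\<^sup>2 = x\<^sup>2 + y\<^sup>2 + 2 * (x * y)" by (simp add: power2_sum)
  thus ?thesis using assms by simp
qed

text \<open>
  If the field were finite, \<open>1 + \<Prod>\<^sub>a (X - a)\<close> would be a nonconstant polynomial without roots.
\<close>

lemma infinite_UNIV_alg_closed: "infinite (UNIV :: 'k::alg_closed_field set)"
proof
  assume fin: "finite (UNIV :: 'k set)"
  define q :: "'k poly" where "q = (\<Prod>a\<in>UNIV. [:-a, 1:])"
  have q0: "poly q a = 0" for a
    unfolding q_def poly_prod using fin by (intro prod_zero) auto
  have "degree q = (\<Sum>a\<in>(UNIV::'k set). degree [:-a, 1:])"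
    unfolding q_def by (rule degree_prod_eq_sum_degree) auto
  hence "degree q > 0" using fin by (simp add: card_gt_0_iff)
  hence "degree (q + 1) > 0" by (simp add: degree_add_eq_left)
  then obtain a where "poly (q + 1) a = 0" using alg_closed_imp_poly_has_root by blast
  thus False using q0[of a] by simp
qed

lemma poly_eqI_infinite:
  fixes p q :: "'k::alg_closed_field poly"
  assumes "\<And>t. t \<noteq> 0 \<Longrightarrow> poly p t = poly q t"
  shows "p = q"
proof (rule ccontr)
  assume "p \<noteq> q"
  hence "finite {t. poly (p - q) t = 0}" by (intro poly_roots_finite) simp
  moreover have "UNIV - {0} \<subseteq> {t. poly (p - q) t = 0}" using assms by auto
  ultimately have "finite (UNIV - {0::'k})" by (rule rev_finite_subset)
  thus False using infinite_remove[OF infinite_UNIV_alg_closed] by blast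
qed

text \<open>These are the sections of \<open>\<O>(m)\<close> on the projective line, described in its two affine charts.\<close>

lemma degree_le_of_inverse_chart:
  fixes p q :: "'k::alg_closed_field poly"
  assumes "\<And>t. t \<noteq> 0 \<Longrightarrow> poly p t = t ^ m * poly q (inverse t)"
  shows "degree p \<le> m"
proof -
  let ?d = "degree q"
  have "poly (monom 1 ?d * p) t = poly (monom 1 m * reflect_poly q) t" if "t \<noteq> 0" for t
    using assms[OF that] that by (simp add: poly_monom poly_reflect_poly_nz)
  hence eq: "monom 1 ?d * p = monom 1 m * reflect_poly q" by (rule poly_eqI_infinite)
  show ?thesis
  proof (cases "p = 0")
    case False
    hence "?d + degree p = degree (monom 1 ?d * p)"
      by (subst degree_mult_eq) (auto simp: degree_monom_eq)
    also have "\<dots> \<le> m + degree (reflect_poly q)"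
      unfolding eq by (metis degree_mult_le degree_monom_eq zero_neq_one)
    also have "\<dots> \<le> m + ?d" using degree_reflect_poly_le[of q] by simp
    finally show ?thesis by simp
  qed simp
qed

section \<open>Algebras generated by a set of functions\<close>

lemma subalg_pullback:
  assumes "F \<in> subalg X" and "\<And>f. f \<in> X \<Longrightarrow> (\<lambda>z. f (\<phi> z)) \<in> subalg Z"
  shows "(\<lambda>z. F (\<phi> z)) \<in> subalg Z"
  using assms(1) by induction (auto intro: subalg.intros assms(2))

lemma subalg_sum:
  assumes "\<And>i. i \<in> I \<Longrightarrow> f i \<in> subalg X"
  shows "(\<lambda>z. \<Sum>i\<in>I. f i z) \<in> subalg X"
  using assms by (induction I rule: infinite_finite_induct) (auto intro: subalg.intros)

lemma subalg_power: "f \<in> subalg X \<Longrightarrow> (\<lambda>z. f z ^ n) \<in> subalg X"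
  by (induction n) (auto intro: subalg.intros)

lemma subalg_uminus: "f \<in> subalg X \<Longrightarrow> (\<lambda>z. - f z) \<in> subalg X"
  using subalg.mult[OF subalg.const[of "- 1"], of f X] by simp

lemma subalg_diff: "f \<in> subalg X \<Longrightarrow> g \<in> subalg X \<Longrightarrow> (\<lambda>z. f z - g z) \<in> subalg X"
  using subalg.add[OF _ subalg_uminus, of f X g] by simp

lemma subalg_poly_along_curve:
  fixes X :: "('a \<Rightarrow> 'k::comm_ring_1) set"
  assumes "F \<in> subalg X" and "\<And>f. f \<in> X \<Longrightarrow> \<exists>p. \<forall>t. f (\<gamma> t) = poly p t"
  shows "\<exists>p. \<forall>t. F (\<gamma> t) = poly p t"
  using assms(1)
proof induction
  case (const c)
  show ?case by (rule exI[of _ "[:c:]"]) simp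
next
  case (add f g)
  then obtain p q where "\<forall>t. f (\<gamma> t) = poly p t" "\<forall>t. g (\<gamma> t) = poly q t" by blast
  thus ?case by (intro exI[of _ "p + q"]) simp
next
  case (mult f g)
  then obtain p q where "\<forall>t. f (\<gamma> t) = poly p t" "\<forall>t. g (\<gamma> t) = poly q t" by blast
  thus ?case by (intro exI[of _ "p * q"]) simp
qed (use assms(2) in auto)

section \<open>Functions of finitely many scalars and the ideal of the squares\<close>

definition pfun :: "nat \<Rightarrow> ((nat \<Rightarrow> 'k::field) \<Rightarrow> 'k) set" where
  "pfun n = subalg {\<lambda>s. s i | i. i < n}"

definition sqideal :: "nat \<Rightarrow> ((nat \<Rightarrow> 'k::field) \<Rightarrow> 'k) set" where
  "sqideal n = {\<lambda>s. \<Sum>i<n. q i s * (s i)\<^sup>2 | q. \<forall>i. q i \<in> pfun n}"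

lemma pfun_coord: "i < n \<Longrightarrow> (\<lambda>s. s i) \<in> pfun n"
  unfolding pfun_def by (rule subalg.gen) auto

lemma pfun_pullback:
  assumes "F \<in> pfun n" and "\<And>i. i < n \<Longrightarrow> (\<lambda>s. \<phi> s i) \<in> pfun m"
  shows "(\<lambda>s. F (\<phi> s)) \<in> pfun m"
  using assms subalg_pullback[of F "{\<lambda>s. s i | i. i < n}" \<phi>] unfolding pfun_def by blast

lemma pfun_shift: "F \<in> pfun n \<Longrightarrow> (\<lambda>s. F (\<lambda>i. s (Suc i))) \<in> pfun (Suc n)"
  by (erule pfun_pullback) (auto intro: pfun_coord)

lemma pfun_Suc: "F \<in> pfun n \<Longrightarrow> F \<in> pfun (Suc n)"
  by (rule pfun_pullback[of F n "\<lambda>s. s" "Suc n"]) (auto intro: pfun_coord)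

lemma pfun_const: "(\<lambda>_. c) \<in> pfun n"
  unfolding pfun_def by (rule subalg.const)

lemma pfun_add: "f \<in> pfun n \<Longrightarrow> g \<in> pfun n \<Longrightarrow> (\<lambda>s. f s + g s) \<in> pfun n"
  unfolding pfun_def by (rule subalg.add)

lemma pfun_mult: "f \<in> pfun n \<Longrightarrow> g \<in> pfun n \<Longrightarrow> (\<lambda>s. f s * g s) \<in> pfun n"
  unfolding pfun_def by (rule subalg.mult)

lemma pfun_sum: "(\<And>i. i \<in> I \<Longrightarrow> f i \<in> pfun n) \<Longrightarrow> (\<lambda>s. \<Sum>i\<in>I. f i s) \<in> pfun n"
  unfolding pfun_def by (rule subalg_sum)

lemma pfun_power: "f \<in> pfun n \<Longrightarrow> (\<lambda>s. f s ^ m) \<in> pfun n"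
  unfolding pfun_def by (rule subalg_power)

lemma pfun_0: "F \<in> pfun 0 \<Longrightarrow> \<exists>c. F = (\<lambda>_. c)"
  unfolding pfun_def by (erule subalg.induct) auto

lemma sqidealI: "(\<And>i. q i \<in> pfun n) \<Longrightarrow> (\<lambda>s. \<Sum>i<n. q i s * (s i)\<^sup>2) \<in> sqideal n"
  unfolding sqideal_def by blast

lemma sqideal_pfun: "F \<in> sqideal n \<Longrightarrow> F \<in> pfun n"
  unfolding sqideal_def by (auto intro!: pfun_sum pfun_mult pfun_power pfun_coord)

lemma sqideal_zero: "(\<lambda>_. 0) \<in> sqideal n"
  using sqidealI[of "\<lambda>_ _. 0" n] by (simp add: pfun_const)

lemma sqideal_add:
  assumes "F \<in> sqideal n" "G \<in> sqideal n" shows "(\<lambda>s. F s + G s) \<in> sqideal n"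
proof -
  obtain q r where "F = (\<lambda>s. \<Sum>i<n. q i s * (s i)\<^sup>2)" "\<forall>i. q i \<in> pfun n"
      "G = (\<lambda>s. \<Sum>i<n. r i s * (s i)\<^sup>2)" "\<forall>i. r i \<in> pfun n"
    using assms unfolding sqideal_def by blast
  thus ?thesis using sqidealI[of "\<lambda>i s. q i s + r i s" n]
    by (simp add: pfun_add sum.distrib distrib_right)
qed

lemma sqideal_mult:
  assumes "F \<in> sqideal n" "a \<in> pfun n" shows "(\<lambda>s. a s * F s) \<in> sqideal n"
proof -
  obtain q where "F = (\<lambda>s. \<Sum>i<n. q i s * (s i)\<^sup>2)" "\<forall>i. q i \<in> pfun n"
    using assms unfolding sqideal_def by blast
  thus ?thesis using sqidealI[of "\<lambda>i s. a s * q i s" n] assms(2)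
    by (simp add: pfun_mult sum_distrib_left mult.assoc)
qed

lemma sqideal_gen: "i < n \<Longrightarrow> a \<in> pfun n \<Longrightarrow> (\<lambda>s. a s * (s i)\<^sup>2) \<in> sqideal n"
  using sqidealI[of "\<lambda>j. if j = i then a else (\<lambda>_. 0)" n]
  by (simp add: pfun_const if_distrib[of "\<lambda>f. f _"] if_distrib[of "\<lambda>c. c * _"] sum.delta'
      cong: if_cong)

lemma sqideal_shift:
  assumes "F \<in> sqideal n" shows "(\<lambda>s. F (\<lambda>i. s (Suc i))) \<in> sqideal (Suc n)"
proof -
  obtain q where q: "F = (\<lambda>s. \<Sum>i<n. q i s * (s i)\<^sup>2)" "\<forall>i. q i \<in> pfun n"
    using assms unfolding sqideal_def by blast
  show ?thesis
    using sqidealI[of "\<lambda>j. case j of 0 \<Rightarrow> (\<lambda>_. 0) | Suc i \<Rightarrow> (\<lambda>s. q i (\<lambda>i. s (Suc i)))" "Suc n"] q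
    by (simp add: pfun_const pfun_shift sum.lessThan_Suc_shift split: nat.split_asm nat.split del: sum.lessThan_Suc)
qed

lemma sqideal_at_0:
  assumes "F \<in> sqideal (Suc n)" shows "(\<lambda>s. F (case_nat 0 s)) \<in> sqideal n"
proof -
  obtain q where q: "F = (\<lambda>s. \<Sum>i<Suc n. q i s * (s i)\<^sup>2)" "\<forall>i. q i \<in> pfun (Suc n)"
    using assms unfolding sqideal_def by blast
  have "(\<lambda>s. case_nat 0 s j) \<in> pfun n" if "j < Suc n" for j
    using that by (cases j) (auto intro: pfun_const pfun_coord)
  hence "(\<lambda>s. q (Suc i) (case_nat 0 s)) \<in> pfun n" for i
    using pfun_pullback[of "q (Suc i)" "Suc n" "case_nat 0" n] q(2) by blast
  from sqidealI[of "\<lambda>i s. q (Suc i) (case_nat 0 s)", OF this] show ?thesis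
    by (simp add: q sum.lessThan_Suc_shift del: sum.lessThan_Suc)
qed

section \<open>Expansion in the first variable\<close>

text \<open>
  The ideal of the squares is treated by induction on the number of variables, splitting off the first
  variable up to its square: for a function in the ideal the parts of degree zero and one are in the
  ideal for one variable less.
\<close>

lemma pfun_expand:
  assumes "F \<in> pfun (Suc n)"
  shows "\<exists>A\<in>pfun n. \<exists>B\<in>pfun n. \<exists>K\<in>pfun (Suc n). \<forall>s.
    F s = A (\<lambda>i. s (Suc i)) + s 0 * B (\<lambda>i. s (Suc i)) + (s 0)\<^sup>2 * K s"
  using assms unfolding pfun_def[of "Suc n"]
proof induction
  case (const c)
  show ?case
    by (rule bexI[of _ "\<lambda>_. c"], rule bexI[of _ "\<lambda>_. 0"], rule bexI[of _ "\<lambda>_. 0"])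
      (auto simp: pfun_const subalg.const)
next
  case (gen f)
  then obtain i where i: "f = (\<lambda>s. s i)" "i < Suc n" by auto
  show ?case
  proof (cases i)
    case 0
    thus ?thesis using i
      by (intro bexI[of _ "\<lambda>_. 0"] bexI[of _ "\<lambda>_. 1"]) (auto simp: pfun_const subalg.const)
  next
    case (Suc j)
    thus ?thesis using i
      by (intro bexI[of _ "\<lambda>s. s j"] bexI[of _ "\<lambda>_. 0"]) (auto simp: pfun_const subalg.const pfun_coord)
  qed
next
  case (add f g)
  then obtain A B K A' B' K' where
    "A \<in> pfun n" "B \<in> pfun n" "K \<in> pfun (Suc n)" "A' \<in> pfun n" "B' \<in> pfun n" "K' \<in> pfun (Suc n)"
    "\<forall>s. f s = A (\<lambda>i. s (Suc i)) + s 0 * B (\<lambda>i. s (Suc i)) + (s 0)\<^sup>2 * K s"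
    "\<forall>s. g s = A' (\<lambda>i. s (Suc i)) + s 0 * B' (\<lambda>i. s (Suc i)) + (s 0)\<^sup>2 * K' s"
    unfolding pfun_def by blast
  thus ?case unfolding pfun_def[of "Suc n", symmetric]
    by (intro bexI[of _ "\<lambda>s. A s + A' s"] bexI[of _ "\<lambda>s. B s + B' s"] bexI[of _ "\<lambda>s. K s + K' s"])
      (auto simp: algebra_simps intro: pfun_add)
next
  case (mult f g)
  then obtain A B K A' B' K' where
    *: "A \<in> pfun n" "B \<in> pfun n" "K \<in> pfun (Suc n)" "A' \<in> pfun n" "B' \<in> pfun n" "K' \<in> pfun (Suc n)"
    "\<forall>s. f s = A (\<lambda>i. s (Suc i)) + s 0 * B (\<lambda>i. s (Suc i)) + (s 0)\<^sup>2 * K s"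
    "\<forall>s. g s = A' (\<lambda>i. s (Suc i)) + s 0 * B' (\<lambda>i. s (Suc i)) + (s 0)\<^sup>2 * K' s"
    unfolding pfun_def by blast
  let ?K = "\<lambda>s. B (\<lambda>i. s (Suc i)) * B' (\<lambda>i. s (Suc i)) + A (\<lambda>i. s (Suc i)) * K' s
    + K s * A' (\<lambda>i. s (Suc i)) + s 0 * (B (\<lambda>i. s (Suc i)) * K' s + K s * B' (\<lambda>i. s (Suc i)))
    + (s 0)\<^sup>2 * (K s * K' s)"
  have "?K \<in> pfun (Suc n)"
    by (intro pfun_add pfun_mult pfun_power pfun_shift pfun_coord * ) auto
  thus ?case using * unfolding pfun_def[of "Suc n", symmetric]
    by (intro bexI[of _ "\<lambda>s. A s * A' s"] bexI[of _ "\<lambda>s. A s * B' s + B s * A' s"] bexI[of _ ?K])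
      (auto simp: algebra_simps power2_eq_square intro: pfun_add pfun_mult)
qed

lemma sqideal_expand:
  assumes "F \<in> sqideal (Suc n)"
  shows "\<exists>A\<in>sqideal n. \<exists>B\<in>sqideal n. \<exists>K\<in>pfun (Suc n). \<forall>s.
    F s = A (\<lambda>i. s (Suc i)) + s 0 * B (\<lambda>i. s (Suc i)) + (s 0)\<^sup>2 * K s"
proof -
  obtain q where q: "F = (\<lambda>s. \<Sum>i<Suc n. q i s * (s i)\<^sup>2)" "\<forall>i. q i \<in> pfun (Suc n)"
    using assms unfolding sqideal_def by blast
  have "\<exists>A B K. A \<in> pfun n \<and> B \<in> pfun n \<and> K \<in> pfun (Suc n) \<and> (\<forall>s.
    q (Suc j) s = A (\<lambda>i. s (Suc i)) + s 0 * B (\<lambda>i. s (Suc i)) + (s 0)\<^sup>2 * K s)" for j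
    using pfun_expand[of "q (Suc j)" n] q(2) by blast
  then obtain A B K where *: "\<And>j. A j \<in> pfun n" "\<And>j. B j \<in> pfun n" "\<And>j. K j \<in> pfun (Suc n)"
    "\<And>j s. q (Suc j) s = A j (\<lambda>i. s (Suc i)) + s 0 * B j (\<lambda>i. s (Suc i)) + (s 0)\<^sup>2 * K j s"
    by metis
  let ?K = "\<lambda>s. q 0 s + (\<Sum>j<n. K j s * (s (Suc j))\<^sup>2)"
  have "?K \<in> pfun (Suc n)"
    using q(2) * by (intro pfun_add pfun_sum pfun_mult pfun_power pfun_coord) auto
  moreover have "F s = (\<Sum>j<n. A j (\<lambda>i. s (Suc i)) * (s (Suc j))\<^sup>2)
      + s 0 * (\<Sum>j<n. B j (\<lambda>i. s (Suc i)) * (s (Suc j))\<^sup>2) + (s 0)\<^sup>2 * ?K s" for s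
    by (simp add: q(1) sum.lessThan_Suc_shift * algebra_simps sum.distrib sum_distrib_left
        del: sum.lessThan_Suc)
  ultimately show ?thesis
    by (intro bexI[OF _ sqidealI[of A n, OF *(1)]] bexI[OF _ sqidealI[of B n, OF *(2)]] bexI[of _ ?K]) auto
qed

lemma pfun_poly_in_first:
  fixes F :: "(nat \<Rightarrow> 'k::field) \<Rightarrow> 'k"
  assumes "F \<in> pfun n" shows "\<exists>p. \<forall>t. F (case_nat t s) = poly p t"
proof (rule subalg_poly_along_curve[OF assms[unfolded pfun_def]])
  fix f :: "(nat \<Rightarrow> 'k) \<Rightarrow> 'k" assume "f \<in> {\<lambda>s. s i | i. i < n}"
  then obtain i where i: "f = (\<lambda>s. s i)" by auto
  show "\<exists>p. \<forall>t. f (case_nat t s) = poly p t"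
    by (cases i) (auto simp: i intro: exI[of _ "[:0, 1:]"] exI[of _ "[:s j:]" for j])
qed

text \<open>Well defined over an infinite field, where at most one polynomial represents a given function.\<close>

definition lincoeff :: "('k::field \<Rightarrow> 'k) \<Rightarrow> 'k" where
  "lincoeff f = coeff (THE p. \<forall>t. f t = poly p t) 1"

lemma lincoeff_eq:
  fixes p :: "'k::alg_closed_field poly"
  assumes "\<And>t. f t = poly p t" shows "lincoeff f = coeff p 1"
proof -
  have "(THE p. \<forall>t. f t = poly p t) = p"
    using assms by (intro the_equality) (auto intro: poly_eqI_infinite)
  thus ?thesis by (simp add: lincoeff_def)
qed

text \<open>
  The coefficient of \<open>s\<^sub>0 s\<^sub>1 \<dots> s\<^sub>n\<^sub>-\<^sub>1\<close>. On the cochains of the Frobenius kernel of a one-parameter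
  group it is evaluation at \<open>x \<otimes> \<dots> \<otimes> x\<close>, where \<open>x\<close> spans the Lie algebra.
\<close>

primrec topcoeff :: "nat \<Rightarrow> ((nat \<Rightarrow> 'k::field) \<Rightarrow> 'k) \<Rightarrow> 'k" where
  "topcoeff 0 F = F (\<lambda>_. 0)"
| "topcoeff (Suc n) F = topcoeff n (\<lambda>s. lincoeff (\<lambda>t. F (case_nat t s)))"

lemma topcoeff_expand:
  fixes F :: "(nat \<Rightarrow> 'k::alg_closed_field) \<Rightarrow> 'k"
  assumes "\<And>s. F s = A (\<lambda>i. s (Suc i)) + s 0 * B (\<lambda>i. s (Suc i)) + (s 0)\<^sup>2 * K s" and "K \<in> pfun m"
  shows "topcoeff (Suc n) F = topcoeff n B"
proof -
  have "lincoeff (\<lambda>t. F (case_nat t s)) = B s" for s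
  proof -
    obtain p where "\<forall>t. K (case_nat t s) = poly p t"
      using pfun_poly_in_first[OF assms(2)] by blast
    hence "F (case_nat t s) = poly ([:A s, B s:] + monom 1 2 * p) t" for t
      by (simp add: assms(1) poly_monom)
    from lincoeff_eq[of "\<lambda>t. F (case_nat t s)", OF this] show ?thesis
      by (simp add: coeff_monom_mult)
  qed
  thus ?thesis by simp
qed

lemma expand_unique:
  fixes A B :: "(nat \<Rightarrow> 'k::alg_closed_field) \<Rightarrow> 'k"
  assumes "\<And>s. A (\<lambda>i. s (Suc i)) + s 0 * B (\<lambda>i. s (Suc i)) + (s 0)\<^sup>2 * K s
      = A' (\<lambda>i. s (Suc i)) + s 0 * B' (\<lambda>i. s (Suc i)) + (s 0)\<^sup>2 * K' s"
    and "K \<in> pfun m" and "K' \<in> pfun m'"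
  shows "B = B'"
proof
  fix s
  obtain p p' where p: "\<forall>t. K (case_nat t s) = poly p t" "\<forall>t. K' (case_nat t s) = poly p' t"
    using pfun_poly_in_first assms by meson
  have "[:A s, B s:] + monom 1 2 * p = [:A' s, B' s:] + monom 1 2 * p'"
    using assms(1)[of "case_nat t s" for t] p by (intro poly_eqI_infinite) (simp add: poly_monom)
  from arg_cong[OF this, of "\<lambda>p. coeff p 1"] show "B s = B' s"
    by (simp add: coeff_monom_mult)
qed

lemma topcoeff_zero: "topcoeff n (\<lambda>_. 0 :: 'k::alg_closed_field) = 0"
proof (induction n)
  case (Suc n)
  have "topcoeff (Suc n) (\<lambda>_. 0 :: 'k) = topcoeff n (\<lambda>_. 0)"
    by (rule topcoeff_expand[of _ "\<lambda>_. 0" _ "\<lambda>_. 0" 0]) (auto simp: pfun_const)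
  thus ?case using Suc by simp
qed simp

lemma topcoeff_add:
  fixes F :: "(nat \<Rightarrow> 'k::alg_closed_field) \<Rightarrow> 'k"
  assumes "F \<in> pfun n" "G \<in> pfun n"
  shows "topcoeff n (\<lambda>s. F s + G s) = topcoeff n F + topcoeff n G"
  using assms
proof (induction n arbitrary: F G)
  case (Suc n)
  obtain A B K where F: "A \<in> pfun n" "B \<in> pfun n" "K \<in> pfun (Suc n)"
    "\<And>s. F s = A (\<lambda>i. s (Suc i)) + s 0 * B (\<lambda>i. s (Suc i)) + (s 0)\<^sup>2 * K s"
    using pfun_expand[OF Suc.prems(1)] by blast
  obtain A' B' K' where G: "A' \<in> pfun n" "B' \<in> pfun n" "K' \<in> pfun (Suc n)"
    "\<And>s. G s = A' (\<lambda>i. s (Suc i)) + s 0 * B' (\<lambda>i. s (Suc i)) + (s 0)\<^sup>2 * K' s"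
    using pfun_expand[OF Suc.prems(2)] by blast
  have "topcoeff (Suc n) (\<lambda>s. F s + G s) = topcoeff n (\<lambda>s. B s + B' s)"
    by (rule topcoeff_expand[of _ "\<lambda>s. A s + A' s" _ "\<lambda>s. K s + K' s" "Suc n"])
      (auto simp: F G algebra_simps intro: pfun_add F G)
  also have "\<dots> = topcoeff n B + topcoeff n B'" using Suc.IH F G by blast
  also have "topcoeff n B = topcoeff (Suc n) F"
    using topcoeff_expand[OF F(4) F(3)] by simp
  also have "topcoeff n B' = topcoeff (Suc n) G"
    using topcoeff_expand[OF G(4) G(3)] by simp
  finally show ?case .
qed simp

lemma topcoeff_cmult:
  fixes F :: "(nat \<Rightarrow> 'k::alg_closed_field) \<Rightarrow> 'k"
  assumes "F \<in> pfun n"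
  shows "topcoeff n (\<lambda>s. F s * c) = topcoeff n F * c"
  using assms
proof (induction n arbitrary: F)
  case (Suc n)
  obtain A B K where F: "A \<in> pfun n" "B \<in> pfun n" "K \<in> pfun (Suc n)"
    "\<And>s. F s = A (\<lambda>i. s (Suc i)) + s 0 * B (\<lambda>i. s (Suc i)) + (s 0)\<^sup>2 * K s"
    using pfun_expand[OF Suc.prems] by blast
  have "topcoeff (Suc n) (\<lambda>s. F s * c) = topcoeff n (\<lambda>s. B s * c)"
    by (rule topcoeff_expand[of _ "\<lambda>s. A s * c" _ "\<lambda>s. K s * c" "Suc n"])
      (auto simp: F algebra_simps intro: pfun_mult pfun_const F)
  also have "\<dots> = topcoeff n B * c" using Suc.IH F by blast
  also have "topcoeff n B = topcoeff (Suc n) F"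
    using topcoeff_expand[OF F(4) F(3)] by simp
  finally show ?case .
qed simp

lemma topcoeff_sum:
  fixes F :: "'i \<Rightarrow> (nat \<Rightarrow> 'k::alg_closed_field) \<Rightarrow> 'k"
  assumes "\<And>i. i \<in> I \<Longrightarrow> F i \<in> pfun n"
  shows "topcoeff n (\<lambda>s. \<Sum>i\<in>I. F i s) = (\<Sum>i\<in>I. topcoeff n (F i))"
  using assms
proof (induction I rule: infinite_finite_induct)
  case (insert i I)
  thus ?case by (simp add: topcoeff_add pfun_sum)
qed (auto simp: topcoeff_zero)

lemma topcoeff_sqideal:
  fixes F :: "(nat \<Rightarrow> 'k::alg_closed_field) \<Rightarrow> 'k"
  shows "F \<in> sqideal n \<Longrightarrow> topcoeff n F = 0"
proof (induction n arbitrary: F)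
  case 0
  thus ?case by (auto simp: sqideal_def)
next
  case (Suc n)
  then obtain A B K where "A \<in> sqideal n" and B: "B \<in> sqideal n" and K: "K \<in> pfun (Suc n)"
    and F: "\<And>s. F s = A (\<lambda>i. s (Suc i)) + s 0 * B (\<lambda>i. s (Suc i)) + (s 0)\<^sup>2 * K s"
    using sqideal_expand by blast
  show ?case using topcoeff_expand[OF F K] Suc.IH[OF B] by simp
qed

section \<open>The cohomology of the Frobenius kernel of the additive group\<close>

definition face :: "nat \<Rightarrow> (nat \<Rightarrow> 'k::field) \<Rightarrow> nat \<Rightarrow> 'k" where
  "face j s = (\<lambda>i. if i < j then s i else if i = j then s j + s (Suc j) else s (Suc i))"

text \<open>The inhomogeneous bar complex with trivial coefficients; in characteristic two there are no signs.\<close>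

definition bar :: "nat \<Rightarrow> ((nat \<Rightarrow> 'k::field) \<Rightarrow> 'k) \<Rightarrow> (nat \<Rightarrow> 'k) \<Rightarrow> 'k" where
  "bar n e s = e (\<lambda>i. s (Suc i)) + (\<Sum>j<n. e (face j s)) + e s"

lemma face_shift [simp]: "(\<lambda>i. face (Suc j) s (Suc i)) = face j (\<lambda>i. s (Suc i))"
  by (auto simp: face_def)

lemma face_0 [simp]: "face (Suc j) s 0 = s 0" "face 0 s 0 = s 0 + s 1"
    "(\<lambda>i. face 0 s (Suc i)) = (\<lambda>i. s (Suc (Suc i)))"
  by (auto simp: face_def)

lemma pfun_face:
  assumes "e \<in> pfun n" shows "(\<lambda>s. e (face j s)) \<in> pfun (Suc n)"
proof -
  have "(\<lambda>s::nat \<Rightarrow> 'a. face j s i) \<in> pfun (Suc n)" if "i < n" for i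
    using that by (cases "i < j"; cases "i = j") (auto simp: face_def intro!: pfun_coord pfun_add)
  thus ?thesis using pfun_pullback[OF assms, of "face j" "Suc n"] by blast
qed

lemma pfun_bar:
  assumes "e \<in> pfun n" shows "bar n e \<in> pfun (Suc n)"
  using pfun_add[OF pfun_add[OF pfun_shift[OF assms] pfun_sum[of "{..<n}" "\<lambda>j s. e (face j s)"]] pfun_Suc[OF assms]]
    pfun_face[OF assms] by (simp add: bar_def[abs_def])

lemma topcoeff_face:
  fixes e :: "(nat \<Rightarrow> 'k::alg_closed_field) \<Rightarrow> 'k"
  assumes two: "(2::'k) = 0"
  shows "e \<in> pfun n \<Longrightarrow> j < n \<Longrightarrow> topcoeff (Suc n) (\<lambda>s. e (face j s)) = 0"
proof (induction n arbitrary: e j)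
  case (Suc n)
  obtain A B K where e: "A \<in> pfun n" "B \<in> pfun n" "K \<in> pfun (Suc n)"
    "\<And>s. e s = A (\<lambda>i. s (Suc i)) + s 0 * B (\<lambda>i. s (Suc i)) + (s 0)\<^sup>2 * K s"
    using pfun_expand[OF Suc.prems(1)] by blast
  show ?case
  proof (cases j)
    case 0
    \<comment> \<open>As \<open>(s\<^sub>0 + s\<^sub>1)\<^sup>2 = s\<^sub>0\<^sup>2 + s\<^sub>1\<^sup>2\<close>, no monomial of \<open>e\<close> contributes to \<open>s\<^sub>0 s\<^sub>1\<close>.\<close>
    obtain K0 K1 K2 where K: "K0 \<in> pfun (Suc n)" "K1 \<in> pfun (Suc n)" "K2 \<in> pfun (Suc (Suc n))"
      "\<And>s. K (face 0 s) = K0 (\<lambda>i. s (Suc i)) + s 0 * K1 (\<lambda>i. s (Suc i)) + (s 0)\<^sup>2 * K2 s"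
      using pfun_expand[OF pfun_face[OF e(3), of 0]] by blast
    let ?L = "\<lambda>s. (s 1)\<^sup>2 * K2 s + K (face 0 s)"
    let ?A = "\<lambda>s. A (\<lambda>i. s (Suc i)) + s 0 * B (\<lambda>i. s (Suc i)) + (s 0)\<^sup>2 * K0 s"
    let ?B = "\<lambda>s. B (\<lambda>i. s (Suc i)) + (s 0)\<^sup>2 * K1 s"
    have L: "?L \<in> pfun (Suc (Suc n))"
      by (intro pfun_add pfun_mult pfun_power pfun_coord K pfun_face e) auto
    have ex: "e (face 0 s) = ?A (\<lambda>i. s (Suc i)) + s 0 * ?B (\<lambda>i. s (Suc i)) + (s 0)\<^sup>2 * ?L s" for s
    proof -
      have "e (face 0 s) = A (\<lambda>i. s (Suc (Suc i))) + (s 0 + s 1) * B (\<lambda>i. s (Suc (Suc i)))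
          + (s 0)\<^sup>2 * K (face 0 s) + (s 1)\<^sup>2 * K (face 0 s)"
        by (simp add: e(4) char2_square_add[OF two] distrib_right)
      also have "(s 1)\<^sup>2 * K (face 0 s)
          = (s 1)\<^sup>2 * (K0 (\<lambda>i. s (Suc i)) + s 0 * K1 (\<lambda>i. s (Suc i)) + (s 0)\<^sup>2 * K2 s)"
        by (simp only: K(4))
      finally show ?thesis by (simp add: algebra_simps)
    qed
    have "topcoeff (Suc (Suc n)) (\<lambda>s. e (face 0 s)) = topcoeff (Suc n) ?B"
      by (rule topcoeff_expand[where A = ?A and K = ?L, OF ex L])
    also have "\<dots> = topcoeff n (\<lambda>_. 0)"
      by (rule topcoeff_expand[of _ B _ K1 "Suc n"]) (auto simp: K(2))
    finally show ?thesis by (simp add: 0 topcoeff_zero)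
  next
    case (Suc j')
    have "topcoeff (Suc (Suc n)) (\<lambda>s. e (face j s)) = topcoeff (Suc n) (\<lambda>s. B (face j' s))"
      by (rule topcoeff_expand[of _ "\<lambda>s. A (face j' s)" _ "\<lambda>s. K (face j s)" "Suc (Suc n)"])
        (auto simp: e Suc intro: pfun_face)
    thus ?thesis using Suc.IH[of B j'] e Suc Suc.prems by simp
  qed
qed simp

lemma topcoeff_fewer:
  fixes e :: "(nat \<Rightarrow> 'k::alg_closed_field) \<Rightarrow> 'k"
  shows "e \<in> pfun n \<Longrightarrow> topcoeff (Suc n) e = 0"
proof (induction n arbitrary: e)
  case 0
  then obtain c where "e = (\<lambda>_. c)" using pfun_0 by blast
  thus ?case
    using topcoeff_expand[of e e "\<lambda>_. 0" "\<lambda>_. 0" 0 0, OF _ pfun_const] by simp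
next
  case (Suc n)
  then obtain A B K where e: "A \<in> pfun n" "B \<in> pfun n" "K \<in> pfun (Suc n)"
    "\<And>s. e s = A (\<lambda>i. s (Suc i)) + s 0 * B (\<lambda>i. s (Suc i)) + (s 0)\<^sup>2 * K s"
    using pfun_expand by blast
  show ?case using topcoeff_expand[OF e(4) e(3), of "Suc n"] Suc.IH[OF e(2)] by simp
qed

lemma topcoeff_bar:
  fixes e :: "(nat \<Rightarrow> 'k::alg_closed_field) \<Rightarrow> 'k"
  assumes two: "(2::'k) = 0" and e: "e \<in> pfun n"
  shows "topcoeff (Suc n) (bar n e) = 0"
proof -
  have "topcoeff (Suc n) (\<lambda>s. e (\<lambda>i. s (Suc i))) = topcoeff n (\<lambda>_. 0)"
    by (rule topcoeff_expand[of _ e _ "\<lambda>_. 0" 0]) (auto simp: pfun_const)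
  moreover have "topcoeff (Suc n) (\<lambda>s. \<Sum>j<n. e (face j s)) = 0"
    using topcoeff_face[OF two e] by (subst topcoeff_sum) (auto intro: pfun_face e)
  moreover have "topcoeff (Suc n) e = 0" using topcoeff_fewer e by blast
  ultimately show ?thesis unfolding bar_def
    by (subst topcoeff_add topcoeff_add, (intro pfun_add pfun_sum pfun_shift pfun_face pfun_Suc e)+)+
      (simp add: topcoeff_zero)
qed

text \<open>
  Inserting \<open>0\<close> in the first place is a contraction onto the cochains \<open>s\<^sub>0 B(s\<^sub>1, \<dots>)\<close>: it shows that
  \<open>f\<close> is cohomologous to such a cochain, and \<open>B\<close> is then a cocycle of one degree less with the same
  top coefficient. By induction on the degree, a cocycle is a coboundary if its top coefficient is
  zero.
\<close>

lemma bar_contraction: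
  fixes f :: "(nat \<Rightarrow> 'k::field) \<Rightarrow> 'k"
  assumes two: "(2::'k) = 0"
  shows "bar (Suc n) f (case_nat 0 s)
    = bar n (\<lambda>s. f (case_nat 0 s)) s + f (case_nat 0 (\<lambda>i. s (Suc i)))"
proof -
  have 0: "face 0 (case_nat 0 s) = s" by (auto simp: face_def split: nat.split)
  have S: "face (Suc j) (case_nat 0 s) = case_nat 0 (face j s)" for j
    by (auto simp: face_def fun_eq_iff split: nat.split)
  let ?a = "f (case_nat 0 (\<lambda>i. s (Suc i)))"
  have "bar (Suc n) f (case_nat 0 s)
      = (f s + f s) + (\<Sum>j<n. f (case_nat 0 (face j s))) + f (case_nat 0 s)"
    by (simp add: bar_def sum.lessThan_Suc_shift 0 S algebra_simps del: sum.lessThan_Suc)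
  also have "\<dots> = (?a + ?a) + (\<Sum>j<n. f (case_nat 0 (face j s))) + f (case_nat 0 s)"
    by (simp only: char2_add_self[OF two])
  also have "\<dots> = bar n (\<lambda>s. f (case_nat 0 s)) s + ?a"
    by (simp add: bar_def algebra_simps)
  finally show ?thesis .
qed

text \<open>
  Only the face with first entry \<open>s\<^sub>0 + s\<^sub>1\<close> mixes the first two variables. Since
  \<open>(s\<^sub>0 + s\<^sub>1)\<^sup>2 = s\<^sub>0\<^sup>2 + s\<^sub>1\<^sup>2\<close>, the part \<open>K\<close> contributes to the coefficient of \<open>s\<^sub>0\<close> only a multiple of \<open>s\<^sub>1\<^sup>2\<close>,
  so that this coefficient is the coboundary of \<open>B\<close> modulo the ideal.
\<close>

lemma bar_linear_part:
  fixes f :: "(nat \<Rightarrow> 'k::alg_closed_field) \<Rightarrow> 'k"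
  assumes two: "(2::'k) = 0" and f: "f \<in> pfun (Suc n)" "bar (Suc n) f \<in> sqideal (Suc (Suc n))"
    and AB: "A \<in> pfun n" "B \<in> pfun n" "K \<in> pfun (Suc n)"
      "\<And>s. f s = A (\<lambda>i. s (Suc i)) + s 0 * B (\<lambda>i. s (Suc i)) + (s 0)\<^sup>2 * K s"
  shows "bar n B \<in> sqideal (Suc n)"
proof -
  obtain K0 K1 K2 where K: "K0 \<in> pfun (Suc n)" "K1 \<in> pfun (Suc n)" "K2 \<in> pfun (Suc (Suc n))"
    "\<And>s. K (face 0 s) = K0 (\<lambda>i. s (Suc i)) + s 0 * K1 (\<lambda>i. s (Suc i)) + (s 0)\<^sup>2 * K2 s"
    using pfun_expand[OF pfun_face[OF AB(3), of 0]] by blast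
  define L where "L s = (s 1)\<^sup>2 * K2 s + K (face 0 s) + (\<Sum>j<n. K (face (Suc j) s)) + K s" for s
  define A0 where "A0 s = f s + A (\<lambda>i. s (Suc i)) + s 0 * B (\<lambda>i. s (Suc i)) + (s 0)\<^sup>2 * K0 s
      + (\<Sum>j<n. A (face j s)) + A s" for s
  have face0: "f (face 0 s) =
      A (\<lambda>i. s (Suc (Suc i))) + s 1 * B (\<lambda>i. s (Suc (Suc i))) + (s 1)\<^sup>2 * K0 (\<lambda>i. s (Suc i))
      + s 0 * (B (\<lambda>i. s (Suc (Suc i))) + (s 1)\<^sup>2 * K1 (\<lambda>i. s (Suc i)))
      + (s 0)\<^sup>2 * ((s 1)\<^sup>2 * K2 s + K (face 0 s))" for s
  proof -
    have "f (face 0 s) = A (\<lambda>i. s (Suc (Suc i))) + (s 0 + s 1) * B (\<lambda>i. s (Suc (Suc i)))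
        + (s 0)\<^sup>2 * K (face 0 s) + (s 1)\<^sup>2 * K (face 0 s)"
      by (simp add: AB(4) char2_square_add[OF two] distrib_right)
    also have "(s 1)\<^sup>2 * K (face 0 s) = (s 1)\<^sup>2 * (K0 (\<lambda>i. s (Suc i)) + s 0 * K1 (\<lambda>i. s (Suc i)) + (s 0)\<^sup>2 * K2 s)"
      by (simp only: K(4))
    finally show ?thesis by (simp add: algebra_simps)
  qed
  have L: "L \<in> pfun (Suc (Suc n))"
    unfolding L_def
    by (intro pfun_add pfun_mult pfun_sum pfun_power pfun_coord K pfun_face pfun_Suc[OF AB(3)] AB) auto
  let ?B = "\<lambda>s. bar n B s + (s 0)\<^sup>2 * K1 s"
  have ex: "bar (Suc n) f s = A0 (\<lambda>i. s (Suc i)) + s 0 * ?B (\<lambda>i. s (Suc i)) + (s 0)\<^sup>2 * L s" for s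
    unfolding bar_def[of "Suc n"] sum.lessThan_Suc_shift face0
    by (simp add: AB(4)[of s] AB(4)[of "face (Suc j) s" for j] A0_def L_def bar_def sum.distrib
        sum_distrib_left algebra_simps)
  obtain A' B' K' where e: "A' \<in> sqideal (Suc n)" "B' \<in> sqideal (Suc n)" "K' \<in> pfun (Suc (Suc n))"
    "\<And>s. bar (Suc n) f s = A' (\<lambda>i. s (Suc i)) + s 0 * B' (\<lambda>i. s (Suc i)) + (s 0)\<^sup>2 * K' s"
    using sqideal_expand[OF f(2)] by blast
  have B': "?B = B'"
    by (rule expand_unique[OF _ L e(3)]) (rule trans[OF ex[symmetric] e(4)])
  have "(\<lambda>s. ?B s + K1 s * (s 0)\<^sup>2) \<in> sqideal (Suc n)"
    using sqideal_add[OF e(2)[folded B'] sqideal_gen[of 0 "Suc n", OF _ K(2)]] by simp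
  moreover have "?B s + K1 s * (s 0)\<^sup>2 = bar n B s" for s
    using char2_add_self[OF two, of "K1 s * (s 0)\<^sup>2"] by (simp add: add.assoc mult.commute)
  ultimately show ?thesis by simp
qed

theorem cocycle_topcoeff_0_imp_coboundary:
  fixes f :: "(nat \<Rightarrow> 'k::alg_closed_field) \<Rightarrow> 'k"
  assumes two: "(2::'k) = 0"
  shows "f \<in> pfun n \<Longrightarrow> bar n f \<in> sqideal (Suc n) \<Longrightarrow> topcoeff n f = 0 \<Longrightarrow>
    (case n of 0 \<Rightarrow> f \<in> sqideal 0 | Suc m \<Rightarrow> \<exists>e\<in>pfun m. (\<lambda>s. f s + bar m e s) \<in> sqideal (Suc m))"
proof (induction n arbitrary: f)
  case 0
  then obtain c where "f = (\<lambda>_. c)" using pfun_0 by blast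
  thus ?case using 0 sqideal_zero by simp
next
  case (Suc n)
  obtain A B K where AB: "A \<in> pfun n" "B \<in> pfun n" "K \<in> pfun (Suc n)"
    "\<And>s. f s = A (\<lambda>i. s (Suc i)) + s 0 * B (\<lambda>i. s (Suc i)) + (s 0)\<^sup>2 * K s"
    using pfun_expand[OF Suc.prems(1)] by blast
  have A: "f (case_nat 0 s) = A s" for s by (simp add: AB(4))
  have "(\<lambda>s. bar n A s + A (\<lambda>i. s (Suc i))) \<in> sqideal (Suc n)"
    using sqideal_at_0[OF Suc.prems(2)] bar_contraction[OF two, of n f] by (simp add: A)
  hence "(\<lambda>s. (bar n A s + A (\<lambda>i. s (Suc i))) + K s * (s 0)\<^sup>2) \<in> sqideal (Suc n)"
    by (rule sqideal_add) (intro sqideal_gen AB, simp)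
  moreover have "(bar n A s + A (\<lambda>i. s (Suc i))) + K s * (s 0)\<^sup>2
      = f s + bar n A s + s 0 * B (\<lambda>i. s (Suc i))" for s
    using char2_add_self[OF two, of "s 0 * B (\<lambda>i. s (Suc i))"] by (simp add: AB(4) algebra_simps)
  ultimately have 1: "(\<lambda>s. f s + bar n A s + s 0 * B (\<lambda>i. s (Suc i))) \<in> sqideal (Suc n)" by simp
  have "topcoeff n B = 0" using topcoeff_expand[OF AB(4,3)] Suc.prems(3) by simp
  with Suc.IH[OF AB(2) bar_linear_part[OF two Suc.prems(1,2) AB]]
  have B: "case n of 0 \<Rightarrow> B \<in> sqideal 0 | Suc m \<Rightarrow> \<exists>e\<in>pfun m. (\<lambda>s. B s + bar m e s) \<in> sqideal (Suc m)"
    by simp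
  \<comment> \<open>\<open>s\<^sub>0 \<partial>e = \<partial>(s\<^sub>0 e)\<close>, where \<open>e\<close> is evaluated at the remaining variables\<close>
  show ?case
  proof (cases n)
    case 0
    with B have "B = (\<lambda>_. 0)" by (auto simp: sqideal_def)
    with 1 AB 0 show ?thesis by auto
  next
    case (Suc m)
    then obtain e where e: "e \<in> pfun m" "(\<lambda>s. B s + bar m e s) \<in> sqideal n" using B by auto
    let ?E = "\<lambda>s. s 0 * e (\<lambda>i. s (Suc i))"
    have E: "?E \<in> pfun n" unfolding Suc by (intro pfun_mult pfun_coord pfun_shift e) simp
    have barE: "bar n ?E s = s 0 * bar m e (\<lambda>i. s (Suc i))" for s
    proof -
      have "bar n ?E s = (s 1 * e (\<lambda>i. s (Suc (Suc i))) + s 1 * e (\<lambda>i. s (Suc (Suc i))))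
          + s 0 * bar m e (\<lambda>i. s (Suc i))"
        by (simp add: Suc bar_def sum.lessThan_Suc_shift sum_distrib_left algebra_simps
            del: sum.lessThan_Suc)
      thus ?thesis by (simp add: char2_add_self[OF two])
    qed
    have "(\<lambda>s. s 0 * (B (\<lambda>i. s (Suc i)) + bar m e (\<lambda>i. s (Suc i)))) \<in> sqideal (Suc n)"
      by (intro sqideal_mult pfun_coord sqideal_shift[OF e(2)]) simp
    from sqideal_add[OF 1 this]
    have "(\<lambda>s. f s + bar n A s + s 0 * B (\<lambda>i. s (Suc i))
        + s 0 * (B (\<lambda>i. s (Suc i)) + bar m e (\<lambda>i. s (Suc i)))) \<in> sqideal (Suc n)" .
    moreover have "f s + bar n A s + s 0 * B (\<lambda>i. s (Suc i))
        + s 0 * (B (\<lambda>i. s (Suc i)) + bar m e (\<lambda>i. s (Suc i)))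
        = f s + bar n (\<lambda>s. A s + ?E s) s" for s
    proof -
      have "bar n (\<lambda>s. A s + ?E s) s = bar n A s + bar n ?E s"
        by (simp add: bar_def sum.distrib)
      thus ?thesis using char2_add_self[OF two, of "s 0 * B (\<lambda>i. s (Suc i))"]
        by (simp add: barE algebra_simps)
    qed
    ultimately show ?thesis using pfun_add[OF AB(1) E] by auto
  qed
qed

section \<open>Regular functions on powers of the group and the Frobenius ideal\<close>

lemma tuple_polys_const: "(\<lambda>_. c) \<in> tuple_polys n"
  unfolding tuple_polys_def by (rule subalg.const)

lemma tuple_polys_coord: "i < n \<Longrightarrow> (\<lambda>g. g i $ r $ s) \<in> tuple_polys n"
  unfolding tuple_polys_def by (rule subalg.gen) auto

lemma tuple_polys_add: "f \<in> tuple_polys n \<Longrightarrow> h \<in> tuple_polys n \<Longrightarrow> (\<lambda>g. f g + h g) \<in> tuple_polys n"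
  unfolding tuple_polys_def by (rule subalg.add)

lemma tuple_polys_mult: "f \<in> tuple_polys n \<Longrightarrow> h \<in> tuple_polys n \<Longrightarrow> (\<lambda>g. f g * h g) \<in> tuple_polys n"
  unfolding tuple_polys_def by (rule subalg.mult)

lemma tuple_polys_sum:
  "(\<And>i. i \<in> I \<Longrightarrow> f i \<in> tuple_polys n) \<Longrightarrow> (\<lambda>g. \<Sum>i\<in>I. f i g) \<in> tuple_polys n"
  unfolding tuple_polys_def by (rule subalg_sum)

lemma tuple_polys_power: "f \<in> tuple_polys n \<Longrightarrow> (\<lambda>g. f g ^ m) \<in> tuple_polys n"
  unfolding tuple_polys_def by (rule subalg_power)

lemma tuple_polys_diff: "f \<in> tuple_polys n \<Longrightarrow> h \<in> tuple_polys n \<Longrightarrow> (\<lambda>g. f g - h g) \<in> tuple_polys n"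
  unfolding tuple_polys_def by (rule subalg_diff)

lemma tuple_polys_uminus: "f \<in> tuple_polys n \<Longrightarrow> (\<lambda>g. - f g) \<in> tuple_polys n"
  unfolding tuple_polys_def by (rule subalg_uminus)

lemmas tuple_polys_intros = tuple_polys_const tuple_polys_coord tuple_polys_add tuple_polys_mult
  tuple_polys_sum tuple_polys_power tuple_polys_diff tuple_polys_uminus

lemma tuple_polys_pullback:
  assumes "F \<in> tuple_polys n" and "\<And>i r s. i < n \<Longrightarrow> (\<lambda>g. \<phi> g i $ r $ s) \<in> tuple_polys m"
  shows "(\<lambda>g. F (\<phi> g)) \<in> tuple_polys m"
  using assms(1) unfolding tuple_polys_def
proof (rule subalg_pullback)
  fix f :: "(nat \<Rightarrow> 'a mat3) \<Rightarrow> 'a" assume "f \<in> {\<lambda>g. g i $ r $ s | i r s. i < n}"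
  then obtain i r s where "f = (\<lambda>g. g i $ r $ s)" "i < n" by auto
  thus "(\<lambda>g. f (\<phi> g)) \<in> subalg {\<lambda>g. g i $ r $ s | i r s. i < m}"
    using assms(2) by (auto simp: tuple_polys_def)
qed

lemma tuple_polys_shift: "F \<in> tuple_polys n \<Longrightarrow> (\<lambda>g. F (\<lambda>i. g (k + i))) \<in> tuple_polys (k + n)"
  by (rule tuple_polys_pullback) (auto intro: tuple_polys_coord)

lemma tuple_polys_cong:
  assumes "F \<in> tuple_polys n" and "\<And>i. i < n \<Longrightarrow> g i = h i"
  shows "F g = F h"
  using assms(1) unfolding tuple_polys_def by induction (auto simp: assms(2))

lemma frob_idealI:
  fixes q :: "nat \<Rightarrow> 3 \<Rightarrow> 3 \<Rightarrow> (nat \<Rightarrow> 'k::field mat3) \<Rightarrow> 'k"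
  assumes "\<And>i r s. q i r s \<in> tuple_polys n"
  shows "(\<lambda>g. \<Sum>i<n. \<Sum>r\<in>UNIV. \<Sum>s\<in>UNIV. q i r s g * ((g i $ r $ s) ^ CHAR('k) - mat 1 $ r $ s))
    \<in> frob_ideal n"
  using assms unfolding frob_ideal_def by blast

lemma frob_idealD:
  fixes F :: "(nat \<Rightarrow> 'k::field mat3) \<Rightarrow> 'k"
  assumes "F \<in> frob_ideal n"
  shows "\<exists>q. (\<forall>i r s. q i r s \<in> tuple_polys n) \<and>
    F = (\<lambda>g. \<Sum>i<n. \<Sum>r\<in>UNIV. \<Sum>s\<in>UNIV. q i r s g * ((g i $ r $ s) ^ CHAR('k) - mat 1 $ r $ s))"
  using assms unfolding frob_ideal_def by blast

lemma frob_ideal_add: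
  assumes "F \<in> frob_ideal n" "G \<in> frob_ideal n" shows "(\<lambda>g. F g + G g) \<in> frob_ideal n"
proof -
  obtain q where q: "\<And>i r s. q i r s \<in> tuple_polys n"
    "F = (\<lambda>g. \<Sum>i<n. \<Sum>r\<in>UNIV. \<Sum>s\<in>UNIV. q i r s g * ((g i $ r $ s) ^ CHAR('a) - mat 1 $ r $ s))"
    using frob_idealD[OF assms(1)] by blast
  obtain q' where q': "\<And>i r s. q' i r s \<in> tuple_polys n"
    "G = (\<lambda>g. \<Sum>i<n. \<Sum>r\<in>UNIV. \<Sum>s\<in>UNIV. q' i r s g * ((g i $ r $ s) ^ CHAR('a) - mat 1 $ r $ s))"
    using frob_idealD[OF assms(2)] by blast
  have "(\<lambda>g. \<Sum>i<n. \<Sum>r\<in>UNIV. \<Sum>s\<in>UNIV. (q i r s g + q' i r s g) *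
      ((g i $ r $ s) ^ CHAR('a) - mat 1 $ r $ s)) \<in> frob_ideal n"
    by (intro frob_idealI tuple_polys_add q q')
  thus ?thesis by (simp only: q q' distrib_right sum.distrib)
qed

lemma frob_ideal_mult:
  assumes "a \<in> tuple_polys n" "F \<in> frob_ideal n" shows "(\<lambda>g. a g * F g) \<in> frob_ideal n"
proof -
  obtain q where q: "\<And>i r s. q i r s \<in> tuple_polys n"
    "F = (\<lambda>g. \<Sum>i<n. \<Sum>r\<in>UNIV. \<Sum>s\<in>UNIV. q i r s g * ((g i $ r $ s) ^ CHAR('a) - mat 1 $ r $ s))"
    using frob_idealD[OF assms(2)] by blast
  have "(\<lambda>g. \<Sum>i<n. \<Sum>r\<in>UNIV. \<Sum>s\<in>UNIV. (a g * q i r s g) *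
      ((g i $ r $ s) ^ CHAR('a) - mat 1 $ r $ s)) \<in> frob_ideal n"
    by (intro frob_idealI tuple_polys_mult q assms(1))
  thus ?thesis by (simp only: q sum_distrib_left mult.assoc)
qed

lemma frob_ideal_mult_right:
  "F \<in> frob_ideal n \<Longrightarrow> a \<in> tuple_polys n \<Longrightarrow> (\<lambda>g. F g * a g) \<in> frob_ideal n"
  using frob_ideal_mult[of a n F] by (simp add: mult.commute)

lemma frob_ideal_zero: "(\<lambda>_. 0) \<in> frob_ideal n"
  using frob_idealI[of "\<lambda>_ _ _ _. 0" n] by (simp add: tuple_polys_const)

lemma frob_ideal_gen:
  fixes r s :: 3
  assumes "i < n"
  shows "(\<lambda>g. (g i $ r $ s) ^ CHAR('k) - mat 1 $ r $ s) \<in> (frob_ideal n :: ((nat \<Rightarrow> 'k::field mat3) \<Rightarrow> 'k) set)"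
proof -
  let ?q = "\<lambda>j r' s' (g :: nat \<Rightarrow> 'k mat3). if s' = s then if r' = r then if j = i then 1 else 0 else 0 else 0 :: 'k"
  have "?q j r' s' \<in> tuple_polys n" for j r' s' by (simp add: tuple_polys_const)
  from frob_idealI[of ?q, OF this] show ?thesis
    using assms by (simp add: if_distrib[of "\<lambda>c. c * _"] sum.delta cong: if_cong)
qed

lemma frob_ideal_shift:
  assumes "F \<in> frob_ideal n" shows "(\<lambda>g. F (\<lambda>i. g (Suc i))) \<in> frob_ideal (Suc n)"
proof -
  obtain q where q: "\<And>i r s. q i r s \<in> tuple_polys n"
    "F = (\<lambda>g. \<Sum>i<n. \<Sum>r\<in>UNIV. \<Sum>s\<in>UNIV. q i r s g * ((g i $ r $ s) ^ CHAR('a) - mat 1 $ r $ s))"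
    using frob_idealD[OF assms] by blast
  define q' where "q' i r s = (case i of 0 \<Rightarrow> (\<lambda>_. 0) | Suc i' \<Rightarrow> (\<lambda>g. q i' r s (\<lambda>i. g (Suc i))))" for i r s
  have "q' i r s \<in> tuple_polys (Suc n)" for i r s
    using tuple_polys_shift[OF q(1), where k = 1]
    by (cases i) (auto simp: q'_def tuple_polys_const)
  from frob_idealI[of q', OF this] show ?thesis
    by (simp add: q(2) q'_def sum.lessThan_Suc_shift del: sum.lessThan_Suc)
qed

section \<open>Cochains\<close>

lemma tensors_add: "F \<in> tensors A N \<Longrightarrow> G \<in> tensors A N \<Longrightarrow> (\<lambda>g. F g + G g) \<in> tensors A N"
proof (induction F rule: tensors.induct)
  case (add F a v)
  from tensors.add[OF add.IH[OF add.prems] add.hyps(2,3)]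
  show ?case by (simp add: algebra_simps)
qed simp

lemma tensors_sum:
  "(\<And>i. i \<in> I \<Longrightarrow> F i \<in> tensors A N) \<Longrightarrow> (\<lambda>g. \<Sum>i\<in>I. F i g) \<in> tensors A N"
  by (induction I rule: infinite_finite_induct) (auto intro: tensors_add tensors.zero)

lemma tensors_single: "a \<in> A \<Longrightarrow> v \<in> car N \<Longrightarrow> (\<lambda>g. scl N (a g) v) \<in> tensors A N"
  using tensors.add[OF tensors.zero, of a A v N] by simp

lemma tensors_pullback:
  assumes "F \<in> tensors A N" and "\<And>a. a \<in> A \<Longrightarrow> (\<lambda>g. a (\<phi> g)) \<in> A'"
  shows "(\<lambda>g. F (\<phi> g)) \<in> tensors A' N"
  using assms(1) by induction (auto intro: tensors.intros assms(2))

lemma tensors_car: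
  assumes "F \<in> tensors A N" and "0 \<in> car N" "\<And>u v. u \<in> car N \<Longrightarrow> v \<in> car N \<Longrightarrow> u + v \<in> car N"
    "\<And>c v. v \<in> car N \<Longrightarrow> scl N c v \<in> car N"
  shows "F g \<in> car N"
  using assms(1) by induction (auto intro: assms)

text \<open>
  Regular maps are sums of pure tensors. The result is compared with a regular map on \<open>P\<close> only, since
  the action is regular on the points of the group and arbitrary elsewhere.
\<close>

lemma tensors_map:
  assumes "F \<in> tensors A N" and "0 \<in> car N" "\<And>u v. u \<in> car N \<Longrightarrow> v \<in> car N \<Longrightarrow> u + v \<in> car N"
    "\<And>c v. v \<in> car N \<Longrightarrow> scl N c v \<in> car N"
    and additive: "\<And>g u v. g \<in> P \<Longrightarrow> u \<in> car N \<Longrightarrow> v \<in> car N \<Longrightarrow> T g (u + v) = T g u + T g v"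
    and pure: "\<And>a v. a \<in> A \<Longrightarrow> v \<in> car N \<Longrightarrow> \<exists>G\<in>tensors A' N'. \<forall>g\<in>P. T g (scl N (a g) v) = G g"
  shows "\<exists>G\<in>tensors A' N'. \<forall>g\<in>P. T g (F g) = G g"
  using assms(1)
proof induction
  case zero
  have "T g 0 = 0" if "g \<in> P" for g using additive[OF that assms(2,2)] by simp
  thus ?case by (intro bexI[OF _ tensors.zero]) simp
next
  case (add F a v)
  obtain G H where G: "G \<in> tensors A' N'" "\<forall>g\<in>P. T g (F g) = G g"
    and H: "H \<in> tensors A' N'" "\<forall>g\<in>P. T g (scl N (a g) v) = H g"
    using add.IH pure[OF add.hyps(2,3)] by blast
  have "T g (F g + scl N (a g) v) = T g (F g) + T g (scl N (a g) v)" if "g \<in> P" for g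
    using additive[OF that tensors_car[OF add.hyps(1)]] assms(2-4) add.hyps(3) by blast
  thus ?case using G H by (intro bexI[OF _ tensors_add[OF G(1) H(1)]]) simp
qed

lemma tensors_triv:
  assumes "F \<in> tensors A triv_mod" "(\<lambda>_. 0) \<in> A" "\<And>a b. a \<in> A \<Longrightarrow> b \<in> A \<Longrightarrow> (\<lambda>g. a g + b g) \<in> A"
    "\<And>a c. a \<in> A \<Longrightarrow> (\<lambda>g. a g * c) \<in> A"
  shows "F \<in> A"
  using assms(1) by induction (auto simp: triv_mod_def intro: assms)

lemma cochains_triv:
  "f \<in> cochains H n triv_mod \<longleftrightarrow> (\<exists>F\<in>tuple_polys n. \<forall>g\<in>points H n. f g = F g)"
proof
  assume "f \<in> cochains H n triv_mod"
  then obtain F where F: "F \<in> tensors (tuple_polys n) triv_mod" "\<forall>g\<in>points H n. f g = F g"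
    by (auto simp: cochains_def)
  have "F \<in> tuple_polys n"
    using F(1) by (rule tensors_triv) (auto intro: tuple_polys_intros)
  with F show "\<exists>F\<in>tuple_polys n. \<forall>g\<in>points H n. f g = F g" by blast
next
  assume "\<exists>F\<in>tuple_polys n. \<forall>g\<in>points H n. f g = F g"
  then obtain F where F: "F \<in> tuple_polys n" "\<forall>g\<in>points H n. f g = F g" by blast
  from tensors_single[OF F(1), of 1 triv_mod] F(2) show "f \<in> cochains H n triv_mod"
    by (auto simp: cochains_def triv_mod_def)
qed

lemma null_cochains_triv:
  "f \<in> null_cochains H n triv_mod \<longleftrightarrow> (\<exists>F\<in>frob_ideal n. \<forall>g\<in>points H n. f g = F g)"
proof
  assume "f \<in> null_cochains H n triv_mod"
  then obtain F where F: "F \<in> tensors (frob_ideal n) triv_mod" "\<forall>g\<in>points H n. f g = F g"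
    by (auto simp: null_cochains_def)
  have "F \<in> frob_ideal n"
    using F(1) by (rule tensors_triv)
      (auto intro: frob_ideal_zero frob_ideal_add frob_ideal_mult_right tuple_polys_const)
  with F show "\<exists>F\<in>frob_ideal n. \<forall>g\<in>points H n. f g = F g" by blast
next
  assume "\<exists>F\<in>frob_ideal n. \<forall>g\<in>points H n. f g = F g"
  then obtain F where F: "F \<in> frob_ideal n" "\<forall>g\<in>points H n. f g = F g" by blast
  from tensors_single[OF F(1), of 1 triv_mod] F(2) show "f \<in> null_cochains H n triv_mod"
    by (auto simp: null_cochains_def triv_mod_def)
qed

definition gface :: "nat \<Rightarrow> (nat \<Rightarrow> 'k::field mat3) \<Rightarrow> nat \<Rightarrow> 'k mat3" where
  "gface j g = (\<lambda>i. if i < j then g i else if i = j then g j ** g (Suc j) else g (Suc i))"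

lemma cobound_triv:
  assumes two: "(2::'k::field) = 0"
  shows "cobound (triv_mod :: ('k,'k) rmod) n f g
    = f (\<lambda>i. g (Suc i)) + (\<Sum>j<n. f (gface j g)) + f g"
  by (simp add: cobound_def triv_mod_def gface_def char2_minus[OF two])

section \<open>The lower triangular group and its one-parameter subgroups\<close>

lemmas mat3_simps = matrix_matrix_mult_def sum_3 vec_eq_iff forall_3 mat_def

text \<open>The adjugate, which makes the inverse of an element of \<open>B\<close> polynomial in its entries.\<close>

definition binv :: "'k::field mat3 \<Rightarrow> 'k mat3" where
  "binv b = vector [vector [b$2$2 * b$3$3, 0, 0],
    vector [- b$2$1 * b$3$3, b$1$1 * b$3$3, 0],
    vector [b$2$1 * b$3$2 - b$2$2 * b$3$1, - b$1$1 * b$3$2, b$1$1 * b$2$2]]"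

lemma borel3_iff:
  "b \<in> borel3 \<longleftrightarrow> b$1$2 = 0 \<and> b$1$3 = 0 \<and> b$2$3 = 0 \<and> b$1$1 * b$2$2 * b$3$3 = 1"
  by (auto simp: borel3_def SL3_def det_3)

lemma borel3_binv:
  assumes "b \<in> borel3" shows "b ** binv b = mat 1" "binv b ** b = mat 1"
proof -
  have *: "b$1$2 = 0" "b$1$3 = 0" "b$2$3 = 0" "b$1$1 * b$2$2 * b$3$3 = 1"
    using assms by (auto simp: borel3_iff)
  show "b ** binv b = mat 1" "binv b ** b = mat 1"
    using * by (simp_all add: mat3_simps binv_def vector_3 algebra_simps)
qed

lemma matrix_inverse_unique:
  fixes A B C :: "'k::field mat3"
  assumes "C ** A = mat 1" "A ** B = mat 1" shows "C = B"
proof -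
  have "C = C ** (A ** B)" by (simp add: assms(2))
  also have "\<dots> = B" by (simp add: matrix_mul_assoc assms(1))
  finally show ?thesis .
qed

lemma matrix_inv_borel3:
  assumes "b \<in> borel3" shows "matrix_inv b = binv b"
proof -
  have "\<exists>A'. b ** A' = mat 1 \<and> A' ** b = mat 1" using borel3_binv[OF assms] by blast
  hence *: "matrix_inv b ** b = mat 1" unfolding matrix_inv_def by (metis (mono_tags, lifting) someI_ex)
  thus ?thesis by (rule matrix_inverse_unique) (rule borel3_binv[OF assms])
qed

lemma binv_borel3: "b \<in> borel3 \<Longrightarrow> binv b \<in> borel3"
  unfolding borel3_iff by (simp add: binv_def vector_3) algebra

lemma borel3_mult: "b \<in> borel3 \<Longrightarrow> b' \<in> borel3 \<Longrightarrow> b ** b' \<in> borel3"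
  unfolding borel3_iff by (simp add: mat3_simps) algebra

lemma binv_binv:
  assumes "b \<in> borel3" shows "binv (binv b) = b"
  by (rule matrix_inverse_unique[of _ "binv b"]) (intro borel3_binv binv_borel3 assms)+

lemma binv_mult:
  assumes "b \<in> borel3" "b' \<in> borel3" shows "binv (b ** b') = binv b' ** binv b"
proof -
  have "(binv b' ** binv b) ** (b ** b') = binv b' ** (binv b ** b) ** b'"
    by (simp only: matrix_mul_assoc)
  also have "\<dots> = mat 1"
    by (simp only: borel3_binv[OF assms(1)] borel3_binv[OF assms(2)] matrix_mul_rid)
  finally have "(binv b' ** binv b) ** (b ** b') = mat 1" .
  hence "binv b' ** binv b = binv (b ** b')"
    by (rule matrix_inverse_unique) (intro borel3_binv borel3_mult assms)
  thus ?thesis by simp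
qed

lemma SL3_mult: "g \<in> SL3 \<Longrightarrow> h \<in> SL3 \<Longrightarrow> g ** h \<in> SL3"
  by (simp add: SL3_def det_mul)

lemma borel3_SL3: "b \<in> borel3 \<Longrightarrow> b \<in> SL3"
  by (simp add: borel3_def)

definition expmat :: "'k::field mat3 \<Rightarrow> 'k \<Rightarrow> 'k mat3" where
  "expmat x t = mat 1 + (\<chi> r s. t * x $ r $ s)"

lemma expmat_entry: "expmat x t $ r $ s = mat 1 $ r $ s + t * x $ r $ s"
  by (simp add: expmat_def)

lemma one_param_expmat: "one_param x = range (expmat x)"
  by (auto simp: one_param_def expmat_def)

lemma N1_u_iff:
  "x \<in> N1_u \<longleftrightarrow> x$1$1 = 0 \<and> x$2$2 = 0 \<and> x$3$3 = 0 \<and> x$1$2 = 0 \<and> x$1$3 = 0 \<and> x$2$3 = 0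
    \<and> x$3$2 * x$2$1 = 0"
  by (auto simp: N1_u_def lie_u_def mat3_simps)

lemma expmat_mult:
  assumes "x \<in> N1_u" shows "expmat x t ** expmat x u = expmat x (t + u)"
  using assms unfolding N1_u_iff by (auto simp: mat3_simps expmat_def distrib_right)

lemma expmat_0 [simp]: "expmat x 0 = mat 1"
  by (simp add: expmat_def vec_eq_iff)

lemma expmat_borel3:
  assumes "x \<in> N1_u" shows "expmat x t \<in> borel3"
  using assms unfolding N1_u_iff by (auto simp: borel3_iff expmat_entry mat_def)

lemma binv_expmat:
  assumes two: "(2::'k::field) = 0" and x: "(x::'k mat3) \<in> N1_u"
  shows "binv (expmat x t) = expmat x t"
proof -
  have "expmat x t ** expmat x t = mat 1"
    by (simp add: expmat_mult[OF x] char2_add_self[OF two])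
  thus ?thesis
    using matrix_inverse_unique[OF borel3_binv(2)[OF expmat_borel3[OF x]]] by blast
qed

section \<open>Restriction of cochains to a one-parameter subgroup\<close>

lemma points_expmat:
  "x \<in> N1_u \<Longrightarrow> (\<lambda>i. expmat x (s i)) \<in> points borel3 n"
  by (auto simp: points_def intro: expmat_borel3)

lemma tuple_polys_expmat:
  assumes "a \<in> tuple_polys n" shows "(\<lambda>s. a (\<lambda>i. expmat x (s i))) \<in> pfun n"
  using assms unfolding tuple_polys_def pfun_def
proof (rule subalg_pullback)
  fix f :: "(nat \<Rightarrow> 'a mat3) \<Rightarrow> 'a" assume "f \<in> {\<lambda>g. g i $ r $ s | i r s. i < n}"
  then obtain i r s where "f = (\<lambda>g. g i $ r $ s)" "i < n" by auto
  thus "(\<lambda>s. f (\<lambda>i. expmat x (s i))) \<in> subalg {\<lambda>s. s i | i. i < n}"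
    unfolding pfun_def[symmetric]
    by (auto simp: expmat_entry intro!: pfun_add pfun_mult pfun_const pfun_coord)
qed

lemma frob_ideal_expmat:
  fixes x :: "'k::field mat3"
  assumes char: "CHAR('k) = 2" and two: "(2::'k) = 0" and "a \<in> frob_ideal n"
  shows "(\<lambda>s. a (\<lambda>i. expmat x (s i))) \<in> sqideal n"
proof -
  obtain q where q: "\<And>i r s. q i r s \<in> tuple_polys n"
    "a = (\<lambda>g. \<Sum>i<n. \<Sum>r\<in>UNIV. \<Sum>s\<in>UNIV. q i r s g * ((g i $ r $ s) ^ CHAR('k) - mat 1 $ r $ s))"
    using frob_idealD[OF assms(3)] by blast
  have sq: "(expmat x t $ r $ s)\<^sup>2 - mat 1 $ r $ s = (x $ r $ s)\<^sup>2 * t\<^sup>2" for t r s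
    by (simp add: expmat_entry char2_square_add[OF two] power_mult_distrib mat_def)
  have "(\<lambda>s'. \<Sum>i<n. (\<Sum>r\<in>UNIV. \<Sum>s\<in>UNIV. q i r s (\<lambda>i. expmat x (s' i)) * (x $ r $ s)\<^sup>2) * (s' i)\<^sup>2)
      \<in> sqideal n"
    by (intro sqidealI pfun_sum pfun_mult pfun_const tuple_polys_expmat q)
  thus ?thesis by (simp add: q(2) char sq sum_distrib_right mult.assoc)
qed

lemma gface_expmat:
  assumes "x \<in> N1_u" shows "gface j (\<lambda>i. expmat x (s i)) = (\<lambda>i. expmat x (face j s i))"
  using expmat_mult[OF assms] by (auto simp: gface_def face_def)

lemma cobound_triv_expmat:
  fixes x :: "'k::field mat3"
  assumes "(2::'k) = 0" "x \<in> N1_u"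
  shows "cobound triv_mod n f (\<lambda>i. expmat x (s i)) = bar n (\<lambda>s. f (\<lambda>i. expmat x (s i))) s"
  using assms by (simp add: cobound_triv gface_expmat bar_def)

lemma cocycle_restriction:
  fixes x :: "'k::field mat3"
  assumes char: "CHAR('k) = 2" and two: "(2::'k) = 0" and x: "x \<in> N1_u"
    and c: "c \<in> cocycles borel3 n triv_mod"
  shows "(\<lambda>s. c (\<lambda>i. expmat x (s i))) \<in> pfun n"
    and "bar n (\<lambda>s. c (\<lambda>i. expmat x (s i))) \<in> sqideal (Suc n)"
proof -
  obtain F where F: "F \<in> tuple_polys n" "\<forall>g\<in>points borel3 n. c g = F g"
    using c by (auto simp: cocycles_def cochains_triv)
  show "(\<lambda>s. c (\<lambda>i. expmat x (s i))) \<in> pfun n"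
    using tuple_polys_expmat[OF F(1), of x] F(2) points_expmat[OF x] by simp
  obtain G where G: "G \<in> frob_ideal (Suc n)" "\<forall>g\<in>points borel3 (Suc n). cobound triv_mod n c g = G g"
    using c by (auto simp: cocycles_def null_cochains_triv)
  have "bar n (\<lambda>s. c (\<lambda>i. expmat x (s i))) = (\<lambda>s. G (\<lambda>i. expmat x (s i)))"
    using G(2) points_expmat[OF x] by (simp add: fun_eq_iff flip: cobound_triv_expmat[OF two x])
  thus "bar n (\<lambda>s. c (\<lambda>i. expmat x (s i))) \<in> sqideal (Suc n)"
    using frob_ideal_expmat[OF char two G(1)] by simp
qed

text \<open>
  For \<open>x \<noteq> 0\<close> a nonzero entry of \<open>x\<close> provides a coordinate, by which the cochains become polynomial
  functions and the Frobenius ideal becomes the ideal of the squares. The trivial group \<open>x = 0\<close> is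
  separate: there cochains are constants, and the coboundary of the constant \<open>\<kappa>\<close> in degree \<open>n - 1\<close> is
  \<open>(n + 1) \<kappa>\<close>.
\<close>

lemma coboundary_one_param:
  fixes x :: "'k::alg_closed_field mat3"
  assumes char: "CHAR('k) = 2" and two: "(2::'k) = 0" and x: "x \<in> N1_u"
    and c: "c \<in> cocycles borel3 n triv_mod"
    and top: "topcoeff n (\<lambda>s. c (\<lambda>i. expmat x (s i))) = 0"
  shows "c \<in> coboundaries (one_param x) n triv_mod"
proof -
  let ?C = "\<lambda>s. c (\<lambda>i. expmat x (s i))"
  note C = cocycle_restriction[OF char two x c]
  obtain F where F: "F \<in> tuple_polys n" "\<forall>g\<in>points borel3 n. c g = F g"
    using c by (auto simp: cocycles_def cochains_triv)
  have cC: "c g = ?C s" if "\<And>i. i < n \<Longrightarrow> g i = expmat x (s i)" for g s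
  proof -
    have "g \<in> points borel3 n" using that expmat_borel3[OF x] by (auto simp: points_def)
    hence "c g = F g" using F by blast
    also have "\<dots> = F (\<lambda>i. expmat x (s i))" by (rule tuple_polys_cong[OF F(1)]) (use that in auto)
    also have "\<dots> = ?C s" using F points_expmat[OF x] by simp
    finally show ?thesis .
  qed
  show ?thesis
  proof (cases n)
    case 0
    have "c g = 0" for g
      using cC[of g "\<lambda>_. 0"] top by (simp add: 0)
    thus ?thesis by (auto simp: 0 coboundaries_def null_cochains_triv intro: bexI[OF _ frob_ideal_zero])
  next
    case (Suc m)
    have "\<exists>e. e \<in> cochains (one_param x) m triv_mod
        \<and> (\<lambda>g. c g - cobound triv_mod m e g) \<in> null_cochains (one_param x) n triv_mod"
    proof (cases "x = 0")
      case True
      define \<kappa> where "\<kappa> = ?C (\<lambda>_. 0)"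
      have C\<kappa>: "?C s = \<kappa>" for s by (simp add: \<kappa>_def True expmat_def)
      obtain q where "bar n ?C = (\<lambda>s. \<Sum>i<Suc n. q i s * (s i)\<^sup>2)" using C(2) by (auto simp: sqideal_def)
      hence "bar n ?C (\<lambda>_. 0) = 0" by simp
      hence n\<kappa>: "of_nat n * \<kappa> = 0"
        by (simp add: bar_def C\<kappa> algebra_simps char2_add_self[OF two] flip: add.assoc)
      have "c g - cobound triv_mod m (\<lambda>_. \<kappa>) g = 0" if "g \<in> points (one_param x) n" for g
      proof -
        have "c g = \<kappa>"
          using cC[of g "\<lambda>_. 0"] that C\<kappa> by (auto simp: points_def one_param_expmat True expmat_def)
        hence "c g - cobound triv_mod m (\<lambda>_. \<kappa>) g = of_nat n * \<kappa> - (\<kappa> + \<kappa>) - (of_nat m * \<kappa> + of_nat m * \<kappa>)"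
          by (simp add: cobound_triv[OF two] Suc algebra_simps)
        thus ?thesis by (simp add: n\<kappa> char2_add_self[OF two])
      qed
      hence "(\<lambda>g. c g - cobound triv_mod m (\<lambda>_. \<kappa>) g) \<in> null_cochains (one_param x) n triv_mod"
        by (auto simp: null_cochains_triv intro: bexI[OF _ frob_ideal_zero])
      moreover have "(\<lambda>_. \<kappa>) \<in> cochains (one_param x) m triv_mod"
        by (auto simp: cochains_triv intro: tuple_polys_const)
      ultimately show ?thesis by blast
    next
      case False
      then obtain a b where ab: "x $ a $ b \<noteq> 0" by (auto simp: vec_eq_iff)
      hence "a \<noteq> b" using x exhaust_3[of a] by (auto simp: N1_u_iff)
      define \<sigma> where "\<sigma> g = (\<lambda>i. g i $ a $ b / x $ a $ b)" for g :: "nat \<Rightarrow> 'k mat3"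
      have \<sigma>e: "expmat x t $ a $ b / x $ a $ b = t" for t
        using ab \<open>a \<noteq> b\<close> by (simp add: expmat_entry mat_def)
      have \<sigma>_tuple: "(\<lambda>g. p (\<sigma> g)) \<in> tuple_polys k" if "p \<in> pfun k" for p k
        using that unfolding pfun_def tuple_polys_def
      proof (rule subalg_pullback)
        fix f :: "(nat \<Rightarrow> 'k) \<Rightarrow> 'k" assume "f \<in> {\<lambda>s. s i | i. i < k}"
        then obtain i where "f = (\<lambda>s. s i)" "i < k" by auto
        thus "(\<lambda>g. f (\<sigma> g)) \<in> subalg {\<lambda>g. g i $ r $ s | i r s. i < k}"
          unfolding tuple_polys_def[symmetric] \<sigma>_def divide_inverse
          by (auto intro!: tuple_polys_intros)
      qed
      obtain e where e: "e \<in> pfun m" "(\<lambda>s. ?C s + bar m e s) \<in> sqideal n"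
        using cocycle_topcoeff_0_imp_coboundary[OF two C top] Suc by auto
      then obtain q where q: "\<And>i. q i \<in> pfun n" "\<And>s. ?C s + bar m e s = (\<Sum>i<n. q i s * (s i)\<^sup>2)"
        unfolding sqideal_def by (auto simp: fun_eq_iff)
      let ?e = "\<lambda>g. e (\<sigma> g)"
      let ?G = "\<lambda>g. \<Sum>i<n. (q i (\<sigma> g) * (inverse (x $ a $ b))\<^sup>2) * ((g i $ a $ b) ^ CHAR('k) - mat 1 $ a $ b)"
      have "?e \<in> cochains (one_param x) m triv_mod"
        using \<sigma>_tuple[OF e(1)] by (auto simp: cochains_triv)
      moreover have "?G \<in> frob_ideal n"
      proof -
        have "(\<lambda>g. \<Sum>i\<in>I. (q i (\<sigma> g) * (inverse (x $ a $ b))\<^sup>2) * ((g i $ a $ b) ^ CHAR('k) - mat 1 $ a $ b))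
            \<in> frob_ideal n" if "finite I" "I \<subseteq> {..<n}" for I
          using that
        proof (induction I)
          case (insert i I)
          have "(\<lambda>g. (q i (\<sigma> g) * (inverse (x $ a $ b))\<^sup>2) * ((g i $ a $ b) ^ CHAR('k) - mat 1 $ a $ b)) \<in> frob_ideal n"
            using insert by (intro frob_ideal_mult tuple_polys_mult tuple_polys_const \<sigma>_tuple q frob_ideal_gen) auto
          thus ?case using insert by (simp add: frob_ideal_add)
        qed (simp add: frob_ideal_zero)
        thus ?thesis by simp
      qed
      moreover have "c g - cobound triv_mod m ?e g = ?G g" if g: "g \<in> points (one_param x) n" for g
      proof -
        have gi: "g i = expmat x (\<sigma> g i)" if "i < n" for i
          using g that \<sigma>e by (auto simp: points_def one_param_expmat \<sigma>_def)
        have "\<sigma> (gface j g) = face j (\<sigma> g)" if "j < m" for j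
        proof
          fix i
          have "g j ** g (Suc j) = expmat x (\<sigma> g j + \<sigma> g (Suc j))"
            using gi[of j] gi[of "Suc j"] that expmat_mult[OF x] by (simp add: Suc)
          thus "\<sigma> (gface j g) i = face j (\<sigma> g) i"
            using \<sigma>e by (simp add: \<sigma>_def gface_def face_def)
        qed
        hence "cobound triv_mod m ?e g = bar m e (\<sigma> g)"
          by (simp add: cobound_triv[OF two] bar_def) (simp add: \<sigma>_def)
        hence "c g - cobound triv_mod m ?e g = ?C (\<sigma> g) + bar m e (\<sigma> g)"
          using cC[of g "\<sigma> g"] gi by (simp add: char2_diff[OF two])
        also have "\<dots> = ?G g"
          using \<open>a \<noteq> b\<close> by (simp add: q(2) \<sigma>_def char mat_def power_mult_distrib divide_inverse mult_ac)
        finally show ?thesis .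
      qed
      ultimately show ?thesis
        unfolding null_cochains_triv by (intro exI[of _ ?e] conjI bexI[of _ ?G] ballI) simp_all
    qed
    thus ?thesis using Suc by (auto simp: coboundaries_def)
  qed
qed

lemma topcoeff_coboundary:
  fixes x :: "'k::alg_closed_field mat3"
  assumes char: "CHAR('k) = 2" and two: "(2::'k) = 0" and x: "x \<in> N1_u"
    and c: "c \<in> coboundaries (one_param x) (Suc m) triv_mod"
  shows "topcoeff (Suc m) (\<lambda>s. c (\<lambda>i. expmat x (s i))) = 0"
proof -
  have pts: "(\<lambda>i. expmat x (s i)) \<in> points (one_param x) k" for s k
    by (auto simp: points_def one_param_expmat)
  obtain e where e: "e \<in> cochains (one_param x) m triv_mod"
    "(\<lambda>g. c g - cobound triv_mod m e g) \<in> null_cochains (one_param x) (Suc m) triv_mod"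
    using c by (auto simp: coboundaries_def)
  obtain F where F: "F \<in> tuple_polys m" "\<forall>g\<in>points (one_param x) m. e g = F g"
    using e by (auto simp: cochains_triv)
  obtain G where G: "G \<in> frob_ideal (Suc m)"
    "\<forall>g\<in>points (one_param x) (Suc m). c g - cobound triv_mod m e g = G g"
    using e by (auto simp: null_cochains_triv)
  let ?e = "\<lambda>s. e (\<lambda>i. expmat x (s i))"
  have e': "?e \<in> pfun m" using tuple_polys_expmat[OF F(1), of x] F(2) pts by simp
  have "c (\<lambda>i. expmat x (s i)) = G (\<lambda>i. expmat x (s i)) + bar m ?e s" for s
    using G(2)[rule_format, OF pts[of s "Suc m"]] cobound_triv_expmat[OF two x, of m e s]
    by (simp add: diff_eq_eq)
  hence "topcoeff (Suc m) (\<lambda>s. c (\<lambda>i. expmat x (s i)))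
      = topcoeff (Suc m) (\<lambda>s. G (\<lambda>i. expmat x (s i)) + bar m ?e s)" by simp
  also have "\<dots> = topcoeff (Suc m) (\<lambda>s. G (\<lambda>i. expmat x (s i))) + topcoeff (Suc m) (bar m ?e)"
  proof (rule topcoeff_add)
    show "(\<lambda>s. G (\<lambda>i. expmat x (s i))) \<in> pfun (Suc m)"
      using sqideal_pfun[OF frob_ideal_expmat[OF char two G(1)]] .
    show "bar m ?e \<in> pfun (Suc m)" by (rule pfun_bar[OF e'])
  qed
  also have "\<dots> = 0"
    using topcoeff_bar[OF two e'] topcoeff_sqideal[OF frob_ideal_expmat[OF char two G(1)]] by simp
  finally show ?thesis .
qed

section \<open>Sections over a Schubert variety\<close>

lemma polys_const: "(\<lambda>_. c) \<in> polys"
  unfolding polys_def by (rule subalg.const)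

lemma polys_entry: "(\<lambda>g. g $ r $ s) \<in> polys"
  unfolding polys_def by (rule subalg.gen) auto

lemma polys_add: "f \<in> polys \<Longrightarrow> h \<in> polys \<Longrightarrow> (\<lambda>g. f g + h g) \<in> polys"
  unfolding polys_def by (rule subalg.add)

lemma polys_mult: "f \<in> polys \<Longrightarrow> h \<in> polys \<Longrightarrow> (\<lambda>g. f g * h g) \<in> polys"
  unfolding polys_def by (rule subalg.mult)

lemma polys_diff: "f \<in> polys \<Longrightarrow> h \<in> polys \<Longrightarrow> (\<lambda>g. f g - h g) \<in> polys"
  unfolding polys_def by (rule subalg_diff)

lemma polys_sum: "(\<And>i. i \<in> I \<Longrightarrow> f i \<in> polys) \<Longrightarrow> (\<lambda>g. \<Sum>i\<in>I. f i g) \<in> polys"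
  unfolding polys_def by (rule subalg_sum)

lemma polys_power: "f \<in> polys \<Longrightarrow> (\<lambda>g. f g ^ n) \<in> polys"
  unfolding polys_def by (rule subalg_power)

lemmas polys_intros = polys_const polys_entry polys_add polys_mult polys_diff polys_sum polys_power

lemma polys_pullback:
  assumes "F \<in> polys" and "\<And>r s. (\<lambda>g. \<phi> g $ r $ s) \<in> polys"
  shows "(\<lambda>g. F (\<phi> g)) \<in> polys"
  using assms(1) unfolding polys_def
proof (rule subalg_pullback)
  fix f :: "'a mat3 \<Rightarrow> 'a" assume "f \<in> {\<lambda>g. g $ r $ s | r s. True}"
  thus "(\<lambda>g. f (\<phi> g)) \<in> subalg {\<lambda>g. g $ r $ s | r s. True}"
    using assms(2) by (auto simp: polys_def)
qed

lemma polys_left: "F \<in> polys \<Longrightarrow> (\<lambda>g. F (A ** g)) \<in> polys"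
  by (erule polys_pullback) (simp add: matrix_matrix_mult_def polys_intros)

lemma polys_right: "F \<in> polys \<Longrightarrow> (\<lambda>g. F (g ** A)) \<in> polys"
  by (erule polys_pullback) (simp add: matrix_matrix_mult_def polys_intros)

lemma schubert_SL3: "g \<in> schubert_preimage w \<Longrightarrow> g \<in> SL3"
  by (simp add: schubert_preimage_def zclosure_def)

lemma schubert_poly_eq_0:
  assumes "g \<in> schubert_preimage w" "F \<in> polys"
    "\<And>b b'. b \<in> borel3 \<Longrightarrow> b' \<in> borel3 \<Longrightarrow> F (b ** w ** b') = 0"
  shows "F g = 0"
  using assms unfolding schubert_preimage_def zclosure_def by blast

lemma schubertI:
  assumes "g \<in> SL3"
    "\<And>F. F \<in> polys \<Longrightarrow> (\<And>b b'. b \<in> borel3 \<Longrightarrow> b' \<in> borel3 \<Longrightarrow> F (b ** w ** b') = 0) \<Longrightarrow> F g = 0"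
  shows "g \<in> schubert_preimage w"
  using assms unfolding schubert_preimage_def zclosure_def by blast

lemma schubert_double_coset:
  "w \<in> SL3 \<Longrightarrow> b \<in> borel3 \<Longrightarrow> b' \<in> borel3 \<Longrightarrow> b ** w ** b' \<in> schubert_preimage w"
  by (rule schubertI) (auto intro: SL3_mult borel3_SL3)

lemma schubert_left:
  assumes "g \<in> schubert_preimage w" "b \<in> borel3"
  shows "b ** g \<in> schubert_preimage w"
proof (rule schubertI)
  fix F :: "'a mat3 \<Rightarrow> 'a" assume F: "F \<in> polys" "\<And>b b'. b \<in> borel3 \<Longrightarrow> b' \<in> borel3 \<Longrightarrow> F (b ** w ** b') = 0"
  have "F (b ** (b1 ** w ** b2)) = 0" if "b1 \<in> borel3" "b2 \<in> borel3" for b1 b2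
    using F(2)[OF borel3_mult[OF assms(2) that(1)] that(2)] by (simp add: matrix_mul_assoc)
  with schubert_poly_eq_0[OF assms(1) polys_left[OF F(1)]] show "F (b ** g) = 0" by blast
qed (rule SL3_mult; use assms in \<open>auto intro: borel3_SL3 schubert_SL3\<close>)

lemma schubert_right:
  assumes "g \<in> schubert_preimage w" "b \<in> borel3"
  shows "g ** b \<in> schubert_preimage w"
proof (rule schubertI)
  fix F :: "'a mat3 \<Rightarrow> 'a" assume F: "F \<in> polys" "\<And>b b'. b \<in> borel3 \<Longrightarrow> b' \<in> borel3 \<Longrightarrow> F (b ** w ** b') = 0"
  have "F (b1 ** w ** b2 ** b) = 0" if "b1 \<in> borel3" "b2 \<in> borel3" for b1 b2
    using F(2)[OF that(1) borel3_mult[OF that(2) assms(2)]] by (simp add: matrix_mul_assoc)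
  with schubert_poly_eq_0[OF assms(1) polys_right[OF F(1)]] show "F (g ** b) = 0" by blast
qed (rule SL3_mult; use assms in \<open>auto intro: borel3_SL3 schubert_SL3\<close>)

lemma binv_cancel: "b \<in> borel3 \<Longrightarrow> binv b ** (b ** g) = g" "b \<in> borel3 \<Longrightarrow> b ** (binv b ** g) = g"
  by (simp_all add: matrix_mul_assoc borel3_binv)

lemma schubert_left_iff:
  assumes "b \<in> borel3"
  shows "b ** g \<in> schubert_preimage w \<longleftrightarrow> g \<in> schubert_preimage w"
  using schubert_left[of "b ** g" w "binv b"] schubert_left[of g w b] assms
  by (auto simp: binv_cancel binv_borel3)

lemma H0_car_iff:
  "f \<in> car (H0 w l1 l2) \<longleftrightarrow>
    (\<exists>F\<in>polys. \<forall>g\<in>schubert_preimage w. f g = F g)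
    \<and> (\<forall>g. g \<notin> schubert_preimage w \<longrightarrow> f g = 0)
    \<and> (\<forall>g\<in>schubert_preimage w. \<forall>b\<in>borel3. f (g ** b) = inverse (weight l1 l2 b) * f g)"
  by (simp add: H0_def)

lemma H0_scl [simp]: "scl (H0 w l1 l2) c f = (\<lambda>g. c * f g)"
  by (simp add: H0_def)

lemma H0_act: "act (H0 w l1 l2) b f = (\<lambda>g. f (matrix_inv b ** g))"
  by (simp add: H0_def)

lemma H0_zero: "0 \<in> car (H0 w l1 l2)"
  by (auto simp: H0_car_iff intro: bexI[OF _ polys_const[of 0]])

lemma H0_add:
  assumes "u \<in> car (H0 w l1 l2)" "v \<in> car (H0 w l1 l2)" shows "u + v \<in> car (H0 w l1 l2)"
proof -
  obtain F G where "F \<in> polys" "\<forall>g\<in>schubert_preimage w. u g = F g"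
    "G \<in> polys" "\<forall>g\<in>schubert_preimage w. v g = G g"
    using assms by (auto simp: H0_car_iff)
  hence "\<exists>H\<in>polys. \<forall>g\<in>schubert_preimage w. (u + v) g = H g"
    by (intro bexI[of _ "\<lambda>g. F g + G g"]) (auto intro: polys_add)
  thus ?thesis using assms by (simp add: H0_car_iff distrib_left)
qed

lemma H0_cmult:
  assumes "v \<in> car (H0 w l1 l2)" shows "(\<lambda>g. c * v g) \<in> car (H0 w l1 l2)"
proof -
  obtain F where "F \<in> polys" "\<forall>g\<in>schubert_preimage w. v g = F g"
    using assms by (auto simp: H0_car_iff)
  hence "\<exists>H\<in>polys. \<forall>g\<in>schubert_preimage w. c * v g = H g"
    by (intro bexI[of _ "\<lambda>g. c * F g"]) (auto intro: polys_mult polys_const)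
  thus ?thesis using assms by (simp add: H0_car_iff)
qed

lemma H0_translate:
  assumes "v \<in> car (H0 w l1 l2)" "b \<in> borel3"
  shows "(\<lambda>g. v (b ** g)) \<in> car (H0 w l1 l2)"
proof -
  obtain F where "F \<in> polys" "\<forall>g\<in>schubert_preimage w. v g = F g"
    using assms by (auto simp: H0_car_iff)
  hence "\<exists>H\<in>polys. \<forall>g\<in>schubert_preimage w. v (b ** g) = H g"
    using assms(2) by (intro bexI[of _ "\<lambda>g. F (b ** g)"]) (auto intro: polys_left schubert_left)
  moreover have "v (b ** (g ** b')) = inverse (weight l1 l2 b') * v (b ** g)"
    if "g \<in> schubert_preimage w" "b' \<in> borel3" for g b'
    using assms that schubert_left[OF that(1) assms(2)] by (simp add: H0_car_iff matrix_mul_assoc)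
  ultimately show ?thesis using assms by (simp add: H0_car_iff schubert_left_iff)
qed

lemma H0_act_car:
  "v \<in> car (H0 w l1 l2) \<Longrightarrow> b \<in> borel3 \<Longrightarrow> act (H0 w l1 l2) b v \<in> car (H0 w l1 l2)"
  by (simp add: H0_act matrix_inv_borel3 H0_translate binv_borel3)

lemma H0_act_mult:
  "b \<in> borel3 \<Longrightarrow> b' \<in> borel3 \<Longrightarrow>
    act (H0 w l1 l2) (b ** b') v = act (H0 w l1 l2) b (act (H0 w l1 l2) b' v)"
  by (simp add: H0_act matrix_inv_borel3 borel3_mult binv_mult matrix_mul_assoc)

lemma H0_act_inverse:
  "b \<in> borel3 \<Longrightarrow> act (H0 w l1 l2) b (act (H0 w l1 l2) (binv b) v) = v"
  "b \<in> borel3 \<Longrightarrow> act (H0 w l1 l2) (binv b) (act (H0 w l1 l2) b v) = v"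
  by (simp_all add: H0_act matrix_inv_borel3 binv_borel3 binv_binv binv_cancel)

lemma H0_act_add: "act (H0 w l1 l2) b (u + v) = act (H0 w l1 l2) b u + act (H0 w l1 l2) b v"
  by (auto simp: H0_act)

lemma H0_act_cmult: "act (H0 w l1 l2) b (\<lambda>g. c * v g) = (\<lambda>g. c * act (H0 w l1 l2) b v g)"
  by (simp add: H0_act)

section \<open>Endomorphisms of the module of sections\<close>

text \<open>
  Elements of the endomorphism module vanish off the carrier, and its scalar multiplication and its
  action restore this value; hence the case distinctions below.
\<close>

context
  fixes w :: "'k::field mat3" and l1 l2 :: int and M E
  defines "M \<equiv> H0 w l1 l2" and "E \<equiv> end_mod M"
begin

lemmas M_zero = H0_zero[of w l1 l2, folded M_def]
  and M_add = H0_add[of _ w l1 l2, folded M_def]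
  and M_cmult = H0_cmult[of _ w l1 l2, folded M_def]
  and M_act_car = H0_act_car[of _ w l1 l2, folded M_def]
  and M_act_add = H0_act_add[of w l1 l2, folded M_def]
  and M_act_cmult = H0_act_cmult[of w l1 l2, folded M_def]
  and M_act_inverse = H0_act_inverse[of _ w l1 l2, folded M_def]

lemma M_scl: "scl M c f = (\<lambda>g. c * f g)"
  by (simp add: M_def)

lemma End_car_iff:
  "\<phi> \<in> car E \<longleftrightarrow> (\<forall>v\<in>car M. \<phi> v \<in> car M) \<and> (\<forall>v\<in>car M. \<forall>w\<in>car M. \<phi> (v + w) = \<phi> v + \<phi> w)
    \<and> (\<forall>c. \<forall>v\<in>car M. \<phi> (\<lambda>g. c * v g) = (\<lambda>g. c * \<phi> v g)) \<and> (\<forall>v. v \<notin> car M \<longrightarrow> \<phi> v = 0)"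
  by (simp add: E_def end_mod_def M_scl)

lemma End_scl: "scl E c \<phi> = (\<lambda>v. if v \<in> car M then (\<lambda>g. c * \<phi> v g) else 0)"
  by (simp add: E_def end_mod_def M_scl cong: if_cong)

lemma End_act: "b \<in> borel3 \<Longrightarrow>
    act E b \<phi> = (\<lambda>v. if v \<in> car M then act M b (\<phi> (act M (binv b) v)) else 0)"
  by (simp add: E_def end_mod_def matrix_inv_borel3 cong: if_cong)

lemma End_apply:
  assumes "\<phi> \<in> car E" "v \<in> car M"
  shows "\<phi> v \<in> car M" "u \<in> car M \<Longrightarrow> \<phi> (u + v) = \<phi> u + \<phi> v"
    "\<phi> (\<lambda>g. c * v g) = (\<lambda>g. c * \<phi> v g)"
  using assms by (auto simp: End_car_iff)

lemma End_off: "\<phi> \<in> car E \<Longrightarrow> v \<notin> car M \<Longrightarrow> \<phi> v = 0"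
  by (auto simp: End_car_iff)

lemma End_apply_0: "\<phi> \<in> car E \<Longrightarrow> \<phi> 0 = 0"
  using End_apply(2)[of \<phi> 0 0] M_zero by simp

lemma End_zero: "0 \<in> car E"
  by (auto simp: End_car_iff M_zero)

lemma End_add:
  assumes "\<phi> \<in> car E" "\<psi> \<in> car E" shows "\<phi> + \<psi> \<in> car E"
proof -
  have "\<phi> (u + v) + \<psi> (u + v) = (\<phi> u + \<psi> u) + (\<phi> v + \<psi> v)" if "u \<in> car M" "v \<in> car M" for u v
    by (simp only: End_apply(2)[OF assms(1) that(2,1)] End_apply(2)[OF assms(2) that(2,1)] ac_simps)
  thus ?thesis
    using assms by (simp add: End_car_iff M_add fun_eq_iff distrib_left)
qed

lemma End_scl_car:
  assumes "\<phi> \<in> car E" shows "scl E c \<phi> \<in> car E"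
  unfolding End_car_iff End_scl
  using assms by (auto simp: End_apply M_add M_cmult fun_eq_iff distrib_left mult.left_commute)

lemma End_act_car:
  assumes "\<phi> \<in> car E" "b \<in> borel3" shows "act E b \<phi> \<in> car E"
proof -
  have "act M (binv b) v \<in> car M" if "v \<in> car M" for v
    using that assms(2) by (simp add: M_act_car binv_borel3)
  moreover have "act M b (\<phi> (act M (binv b) (u + v)))
      = act M b (\<phi> (act M (binv b) u)) + act M b (\<phi> (act M (binv b) v))"
    if "u \<in> car M" "v \<in> car M" for u v
    by (simp only: M_act_add End_apply(2)[OF assms(1) calculation[OF that(2)] calculation[OF that(1)]])
  ultimately show ?thesis unfolding End_car_iff End_act[OF assms(2)]
    using assms by (simp add: End_apply M_add M_cmult M_act_cmult M_act_car)
qed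

lemma End_comp:
  assumes "\<phi> \<in> car E" "\<psi> \<in> car E" shows "\<phi> \<circ> \<psi> \<in> car E"
proof -
  have "\<phi> (\<psi> (u + v)) = \<phi> (\<psi> u) + \<phi> (\<psi> v)" if "u \<in> car M" "v \<in> car M" for u v
    by (simp only: End_apply(2)[OF assms(2) that(2,1)]
        End_apply(2)[OF assms(1) End_apply(1)[OF assms(2) that(2)] End_apply(1)[OF assms(2) that(1)]])
  moreover have "\<phi> (\<psi> v) = 0" if "v \<notin> car M" for v
    by (simp only: End_off[OF assms(2) that] End_apply_0[OF assms(1)])
  ultimately show ?thesis
    unfolding End_car_iff comp_apply using assms by (simp add: End_apply)
qed

lemma End_id: "(\<lambda>v. if v \<in> car M then v else 0) \<in> car E"
  by (auto simp: End_car_iff M_add M_cmult)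

lemma End_act_id:
  "b \<in> borel3 \<Longrightarrow> act E b (\<lambda>v. if v \<in> car M then v else 0) = (\<lambda>v. if v \<in> car M then v else 0)"
  by (auto simp: End_act M_act_inverse M_act_car binv_borel3)

lemma End_sum:
  assumes "\<phi> \<in> car E" "\<And>i. i \<in> I \<Longrightarrow> v i \<in> car M"
  shows "(\<lambda>g. \<Sum>i\<in>I. c i * v i g) \<in> car M \<and> \<phi> (\<lambda>g. \<Sum>i\<in>I. c i * v i g) = (\<lambda>g. \<Sum>i\<in>I. c i * \<phi> (v i) g)"
proof -
  show ?thesis using assms(2)
  proof (induction I rule: infinite_finite_induct)
    case (insert i I)
    let ?u = "\<lambda>g. c i * v i g" and ?s = "\<lambda>g. \<Sum>i\<in>I. c i * v i g"
    have u: "?u \<in> car M" "?s \<in> car M" "\<phi> ?s = (\<lambda>g. \<Sum>i\<in>I. c i * \<phi> (v i) g)"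
      "\<phi> ?u = (\<lambda>g. c i * \<phi> (v i) g)"
      using insert assms(1) by (auto simp: M_cmult End_apply)
    have *: "(\<lambda>g. \<Sum>i\<in>insert i I. c i * v i g) = ?u + ?s"
      using insert(1,2) by (auto simp: fun_eq_iff)
    show ?case
      unfolding * using insert(1,2) u by (simp add: M_add End_apply[OF assms(1)] fun_eq_iff)
  qed (use End_apply_0[OF assms(1)] M_zero in \<open>auto simp: zero_fun_def\<close>)
qed

lemma tensors_eval:
  assumes "F \<in> tensors A E" "v \<in> car M" "(\<lambda>_. 0) \<in> A" "\<And>a b. a \<in> A \<Longrightarrow> b \<in> A \<Longrightarrow> (\<lambda>g. a g + b g) \<in> A"
    "\<And>a c. a \<in> A \<Longrightarrow> (\<lambda>g. a g * c) \<in> A"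
  shows "(\<lambda>g. F g v y) \<in> A"
  using assms(1) by induction (auto simp: End_scl assms)

lemma tensors_eval_tuple_polys:
  "F \<in> tensors (tuple_polys n) E \<Longrightarrow> v \<in> car M \<Longrightarrow> (\<lambda>g. F g v y) \<in> tuple_polys n"
  by (erule tensors_eval) (auto intro: tuple_polys_intros)

lemma tensors_eval_frob_ideal:
  "F \<in> tensors (frob_ideal n) E \<Longrightarrow> v \<in> car M \<Longrightarrow> (\<lambda>g. F g v y) \<in> frob_ideal n"
  by (erule tensors_eval)
    (auto intro: frob_ideal_zero frob_ideal_add frob_ideal_mult_right tuple_polys_const)

lemma End_id_cocycle:
  assumes two: "(2::'k) = 0"
  shows "(\<lambda>_ v. if v \<in> car M then v else 0) \<in> cocycles borel3 0 E"
proof -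
  let ?I = "\<lambda>v. if v \<in> car M then v else 0"
  have "scl E 1 ?I = ?I" by (auto simp: End_scl)
  hence "(\<lambda>_. ?I) \<in> tensors (tuple_polys 0) E"
    using tensors_single[OF tuple_polys_const[of 1] End_id, of 0] by simp
  hence "(\<lambda>_. ?I) \<in> cochains borel3 0 E" by (auto simp: cochains_def)
  moreover have "cobound E 0 (\<lambda>_. ?I) g = 0" if "g \<in> points borel3 1" for g
  proof -
    have "g 0 \<in> borel3" using that by (auto simp: points_def)
    thus ?thesis
      by (auto simp: cobound_def End_act_id End_scl fun_eq_iff)
  qed
  hence "cobound E 0 (\<lambda>_. ?I) \<in> null_cochains borel3 (Suc 0) E"
    by (auto simp: null_cochains_def intro!: bexI[OF _ tensors.zero])
  ultimately show ?thesis by (simp add: cocycles_def)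
qed

lemma End_sum_apply: "(\<Sum>i\<in>I. \<phi> i) v y = (\<Sum>i\<in>I. (\<phi> i :: ('k mat3 \<Rightarrow> 'k) \<Rightarrow> ('k mat3 \<Rightarrow> 'k)) v y)"
  by (induction I rule: infinite_finite_induct) auto

lemma cobound_End_apply:
  assumes two: "(2::'k) = 0" and "v \<in> car M" "g 0 \<in> borel3"
  shows "cobound E n e g v y = e (\<lambda>i. g (Suc i)) (act M (binv (g 0)) v) (binv (g 0) ** y)
    + (\<Sum>j<n. e (gface j g) v y) + e g v y"
  using assms by (simp add: cobound_def End_act End_scl End_sum_apply gface_def[abs_def] char2_minus[OF two])
     (simp add: M_def H0_act matrix_inv_borel3)

end

section \<open>A criterion for points of the support variety\<close>

text \<open>
  The coefficients of the powers of \<open>t\<close> are polynomial in the matrix entries. They inherit the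
  transformation law of \<open>v\<close> because a polynomial in \<open>t\<close> determines its coefficients.
\<close>

lemma section_along_one_param:
  fixes x :: "'k::alg_closed_field mat3"
  assumes v: "v \<in> car (H0 w l1 l2)" and x: "x \<in> N1_u"
  obtains P d where "\<And>t z. z \<in> schubert_preimage w \<Longrightarrow> v (expmat x t ** z) = poly (P z) t"
    "\<And>z. degree (P z) < d"
    "\<And>k. (\<lambda>z. if z \<in> schubert_preimage w then coeff (P z) k else 0) \<in> car (H0 w l1 l2)"
proof -
  obtain F where F: "F \<in> polys" "\<forall>g\<in>schubert_preimage w. v g = F g"
    using v by (auto simp: H0_car_iff)
  have "\<exists>P d. (\<forall>t z. F (expmat x t ** z) = poly (P z) t) \<and> (\<forall>z. degree (P z) < d)
      \<and> (\<forall>k. (\<lambda>z. coeff (P z) k) \<in> polys)"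
    using F(1) unfolding polys_def
  proof induction
    case (const c)
    have "(\<lambda>z. coeff [:c:] k) \<in> polys" for k by (rule polys_const)
    thus ?case unfolding polys_def
      by (intro exI[of _ "\<lambda>_. [:c:]"] exI[of _ 1]) simp
  next
    case (gen f)
    then obtain r s where f: "f = (\<lambda>g. g $ r $ s)" by auto
    let ?P = "\<lambda>z. [:z $ r $ s, (x ** z) $ r $ s:]"
    have "(\<lambda>z. coeff (?P z) k) \<in> polys" for k
      using polys_left[OF polys_entry, of x r s]
      by (cases k; cases "k - 1") (auto intro: polys_entry polys_const)
    moreover have "(expmat x t ** z) $ r $ s = poly (?P z) t" for t z
      by (simp add: expmat_def matrix_matrix_mult_def mat_def distrib_right sum.distrib
          if_distrib[of "\<lambda>c. c * _"] sum_distrib_left mult.assoc cong: if_cong)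
    ultimately show ?case unfolding f polys_def
      by (intro exI[of _ ?P] exI[of _ 2]) (auto simp: degree_pCons_eq_if)
  next
    case (add f g)
    then obtain P d P' d' where
      "\<forall>t z. f (expmat x t ** z) = poly (P z) t" "\<forall>z. degree (P z) < d" "\<forall>k. (\<lambda>z. coeff (P z) k) \<in> polys"
      "\<forall>t z. g (expmat x t ** z) = poly (P' z) t" "\<forall>z. degree (P' z) < d'" "\<forall>k. (\<lambda>z. coeff (P' z) k) \<in> polys"
      unfolding polys_def by blast
    note * = this
    have "degree (P z + P' z) < max d d'" for z
      using degree_add_le_max[of "P z" "P' z"] *(2,5) by (meson le_less_trans max.strict_coboundedI1
        max.strict_coboundedI2 max_less_iff_conj less_max_iff_disj)
    thus ?case using * unfolding polys_def[symmetric]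
      by (intro exI[of _ "\<lambda>z. P z + P' z"] exI[of _ "max d d'"]) (simp add: polys_add)
  next
    case (mult f g)
    then obtain P d P' d' where *:
      "\<forall>t z. f (expmat x t ** z) = poly (P z) t" "\<forall>z. degree (P z) < d" "\<forall>k. (\<lambda>z. coeff (P z) k) \<in> polys"
      "\<forall>t z. g (expmat x t ** z) = poly (P' z) t" "\<forall>z. degree (P' z) < d'" "\<forall>k. (\<lambda>z. coeff (P' z) k) \<in> polys"
      unfolding polys_def by blast
    have "degree (P z * P' z) < d + d'" for z
      using degree_mult_le[of "P z" "P' z"] *(2,5) by (meson add_strict_mono le_less_trans)
    moreover have "(\<lambda>z. coeff (P z * P' z) k) \<in> polys" for k
      unfolding coeff_mult using * by (intro polys_sum polys_mult) auto
    ultimately show ?case using * unfolding polys_def[symmetric]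
      by (intro exI[of _ "\<lambda>z. P z * P' z"] exI[of _ "d + d'"]) simp
  qed
  then obtain P d where P: "\<And>t z. F (expmat x t ** z) = poly (P z) t" "\<And>z. degree (P z) < d"
      "\<And>k. (\<lambda>z. coeff (P z) k) \<in> polys" by blast
  have vP: "v (expmat x t ** z) = poly (P z) t" if "z \<in> schubert_preimage w" for t z
    using that F(2) P(1) schubert_left[OF that expmat_borel3[OF x]] by simp
  have "P (z ** b) = smult (inverse (weight l1 l2 b)) (P z)"
    if "z \<in> schubert_preimage w" "b \<in> borel3" for z b
  proof (rule poly_eqI_infinite)
    fix t
    have "poly (P (z ** b)) t = v (expmat x t ** z ** b)"
      using vP[OF schubert_right[OF that]] by (simp add: matrix_mul_assoc)
    also have "\<dots> = inverse (weight l1 l2 b) * v (expmat x t ** z)"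
      using v that schubert_left[OF that(1) expmat_borel3[OF x]] by (auto simp: H0_car_iff)
    finally show "poly (P (z ** b)) t = poly (smult (inverse (weight l1 l2 b)) (P z)) t"
      using vP[OF that(1)] by simp
  qed
  hence "(\<lambda>z. if z \<in> schubert_preimage w then coeff (P z) k else 0) \<in> car (H0 w l1 l2)" for k
    using P(3)[of k] by (auto simp: H0_car_iff schubert_right)
  with vP P(2) show ?thesis by (rule that)
qed

text \<open>
  The criterion by which points are shown to lie in the support variety. The vector \<open>v\<close> is killed by
  \<open>x\<close>, evaluation at \<open>y\<close> vanishes on the image of \<open>x\<close>, and \<open>v y \<noteq> 0\<close>; so the kernel of \<open>x\<close> is
  larger than its image and the module is not projective over \<open>\<langle>x\<rangle>\<close>. If \<open>c\<close> annihilates the identity,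
  then \<open>c \<otimes> id\<close> is the coboundary of some \<open>e\<close>, and the top coefficient of this equation, applied
  to \<open>v\<close> and evaluated at \<open>y\<close>, shows that the top coefficient of \<open>c\<close> vanishes.
\<close>

lemma support_variety_criterion:
  fixes x :: "'k::alg_closed_field mat3"
  assumes char: "CHAR('k) = 2" and two: "(2::'k) = 0" and x: "x \<in> N1_u"
    and v: "v \<in> car (H0 w l1 l2)" and y: "y \<in> schubert_preimage w" and vy: "v y \<noteq> 0"
    and ker: "\<And>z. z \<in> schubert_preimage w \<Longrightarrow> \<exists>p. (\<forall>t. v (expmat x t ** z) = poly p t) \<and> coeff p 1 = 0"
    and im: "\<And>f t. f \<in> car (H0 w l1 l2) \<Longrightarrow> f (expmat x t ** y) = f y"
  shows "x \<in> support_variety_B1 (H0 w l1 l2)"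
proof -
  let ?M = "H0 w l1 l2" and ?Y = "schubert_preimage w"
  let ?E = "end_mod ?M"
  let ?I = "\<lambda>v. if v \<in> car ?M then v else 0"
  have "c \<in> coboundaries (one_param x) n triv_mod" if c: "c \<in> ext_annihilator borel3 n ?M" for n c
  proof (rule coboundary_one_param[OF char two x])
    show cc: "c \<in> cocycles borel3 n triv_mod" using c by (simp add: ext_annihilator_def)
    let ?C = "\<lambda>s. c (\<lambda>i. expmat x (s i))"
    have cup: "cup ?E n c (\<lambda>_. ?I) \<in> coboundaries borel3 (n + 0) ?E"
      using c End_id_cocycle[OF two, of w l1 l2] unfolding ext_annihilator_def by blast
    have sp: "seq_prod k g \<in> borel3" if "g \<in> points borel3 k" for g and k :: nat
      using that
    proof (induction k)
      case (Suc k)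
      thus ?case by (auto simp: points_def intro!: borel3_mult)
    qed (simp add: borel3_iff mat_def)
    have cup_eval: "cup ?E n c (\<lambda>_. ?I) (\<lambda>i. expmat x (s i)) v y = ?C s * v y" for s
      using sp[OF points_expmat[OF x]] v by (simp add: cup_def End_act_id End_scl)
    show "topcoeff n ?C = 0"
    proof (cases n)
      case 0
      obtain K where K: "K \<in> tensors (frob_ideal 0) ?E" "\<forall>g\<in>points borel3 0. cup ?E n c (\<lambda>_. ?I) g = K g"
        using cup by (auto simp: 0 coboundaries_def null_cochains_def)
      have "(\<lambda>g. K g v y) \<in> frob_ideal 0"
        using tensors_eval_frob_ideal[OF K(1) v] .
      hence "(\<lambda>g. K g v y) = (\<lambda>_. 0)" by (auto simp: frob_ideal_def)
      hence "?C (\<lambda>_. 0) * v y = 0"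
        using K(2) cup_eval[of "\<lambda>_. 0"] points_expmat[OF x, of "\<lambda>_. 0" 0] by (simp add: 0 fun_eq_iff)
      thus ?thesis using vy by (simp add: 0)
    next
      case (Suc m)
      obtain e where e: "e \<in> cochains borel3 m ?E"
        "(\<lambda>g. cup ?E n c (\<lambda>_. ?I) g - cobound ?E m e g) \<in> null_cochains borel3 n ?E"
        using cup by (auto simp: Suc coboundaries_def)
      obtain K where K: "K \<in> tensors (frob_ideal n) ?E"
        "\<forall>g\<in>points borel3 n. cup ?E n c (\<lambda>_. ?I) g - cobound ?E m e g = K g"
        using e by (auto simp: null_cochains_def)
      obtain F where F: "F \<in> tensors (tuple_polys m) ?E" "\<forall>g\<in>points borel3 m. e g = F g"
        using e by (auto simp: cochains_def)
      define ee where "ee u s = e (\<lambda>i. expmat x (s i)) u y" for u s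
      have ee: "ee u \<in> pfun m" if "u \<in> car ?M" for u
      proof -
        have "ee u = (\<lambda>s. F (\<lambda>i. expmat x (s i)) u y)"
          using F(2) points_expmat[OF x, of _ m] by (simp add: ee_def fun_eq_iff)
        thus ?thesis
          using tuple_polys_expmat[OF tensors_eval_tuple_polys[OF F(1) that, of y]] by simp
      qed
      have eE: "e (\<lambda>i. expmat x (s i)) \<in> car ?E" for s
      proof -
        have "F (\<lambda>i. expmat x (s i)) \<in> car ?E"
          by (rule tensors_car[OF F(1)]) (auto intro: End_zero End_add End_scl_car)
        thus ?thesis using F(2) points_expmat[OF x, of s m] by simp
      qed
      obtain P d where P: "\<And>t z. z \<in> ?Y \<Longrightarrow> v (expmat x t ** z) = poly (P z) t"
        "\<And>z. degree (P z) < d" "\<And>k. (\<lambda>z. if z \<in> ?Y then coeff (P z) k else 0) \<in> car ?M"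
        by (rule section_along_one_param[OF v x]) blast
      define u where "u k = (\<lambda>z. if z \<in> ?Y then coeff (P z) k else 0)" for k
      have u: "u k \<in> car ?M" for k unfolding u_def by (rule P(3))
      have u1: "u 1 = 0"
      proof
        fix z show "u 1 z = 0 z"
        proof (cases "z \<in> ?Y")
          case True
          then obtain p where p: "\<forall>t. v (expmat x t ** z) = poly p t" "coeff p 1 = 0"
            using ker by blast
          hence "P z = p" using P(1)[OF True] by (intro poly_eqI_infinite) simp
          thus ?thesis using p(2) by (simp add: u_def)
        qed (simp add: u_def)
      qed
      have translate: "(\<lambda>z. v (expmat x t ** z)) = (\<lambda>z. \<Sum>k<d+2. t ^ k * u k z)" for t
      proof
        fix z show "v (expmat x t ** z) = (\<Sum>k<d+2. t ^ k * u k z)"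
        proof (cases "z \<in> ?Y")
          case True
          have "poly (P z) t = (\<Sum>k\<le>degree (P z). coeff (P z) k * t ^ k)" by (rule poly_altdef)
          also have "\<dots> = (\<Sum>k<d+2. coeff (P z) k * t ^ k)"
            using P(2)[of z] by (intro sum.mono_neutral_left) (auto simp: coeff_eq_0)
          finally show ?thesis using P(1)[OF True] True by (simp add: u_def mult.commute)
        next
          case False
          hence "expmat x t ** z \<notin> ?Y" by (simp add: schubert_left_iff expmat_borel3[OF x])
          thus ?thesis using v False by (simp add: H0_car_iff u_def)
        qed
      qed
      define L where "L s = (\<Sum>k<d+2. s 0 ^ k * ee (u k) (\<lambda>i. s (Suc i)))" for s
      have L: "e (\<lambda>i. expmat x (s (Suc i))) (act ?M (binv (expmat x (s 0))) v) (binv (expmat x (s 0)) ** y)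
          = L s" for s
      proof -
        let ?\<phi> = "e (\<lambda>i. expmat x (s (Suc i)))"
        have "act ?M (binv (expmat x (s 0))) v = (\<lambda>z. v (expmat x (s 0) ** z))"
          using expmat_borel3[OF x] by (simp add: H0_act matrix_inv_borel3 binv_expmat[OF two x])
        also have "\<dots> = (\<lambda>z. \<Sum>k<d+2. s 0 ^ k * u k z)" by (rule translate)
        finally have *: "act ?M (binv (expmat x (s 0))) v = (\<lambda>z. \<Sum>k<d+2. s 0 ^ k * u k z)" .
        have sum: "(\<lambda>z. \<Sum>k<d+2. s 0 ^ k * u k z) \<in> car ?M \<and>
            ?\<phi> (\<lambda>z. \<Sum>k<d+2. s 0 ^ k * u k z) = (\<lambda>z. \<Sum>k<d+2. s 0 ^ k * ?\<phi> (u k) z)"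
          by (rule End_sum[OF eE u])
        hence 1: "?\<phi> (act ?M (binv (expmat x (s 0))) v) = (\<lambda>z. \<Sum>k<d+2. s 0 ^ k * ?\<phi> (u k) z)"
          and 2: "act ?M (binv (expmat x (s 0))) v \<in> car ?M"
          unfolding * by blast+
        have "?\<phi> (act ?M (binv (expmat x (s 0))) v) (binv (expmat x (s 0)) ** y)
            = ?\<phi> (act ?M (binv (expmat x (s 0))) v) y"
          unfolding binv_expmat[OF two x] using im[OF End_apply(1)[OF eE 2]] by (simp add: binv_expmat[OF two x])
        thus ?thesis by (simp add: 1 L_def ee_def)
      qed
      have Lp: "L \<in> pfun n"
        unfolding L_def[abs_def] Suc by (intro pfun_sum pfun_mult pfun_power pfun_coord pfun_shift ee u) simp
      have "topcoeff (Suc m) L = topcoeff m (\<lambda>_. 0)"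
      proof (rule topcoeff_expand)
        have "ee 0 s = 0" for s using End_apply_0[OF eE] by (simp add: ee_def)
        thus "L s = ee (u 0) (\<lambda>i. s (Suc i)) + s 0 * 0
            + (s 0)\<^sup>2 * (\<Sum>k<d. s 0 ^ k * ee (u (k + 2)) (\<lambda>i. s (Suc i)))" for s
          using u1 by (simp add: L_def sum.lessThan_Suc_shift sum_distrib_left power2_eq_square mult_ac
              del: sum.lessThan_Suc)
        show "(\<lambda>s. \<Sum>k<d. s 0 ^ k * ee (u (k + 2)) (\<lambda>i. s (Suc i))) \<in> pfun (Suc m)"
          by (intro pfun_sum pfun_mult pfun_power pfun_coord pfun_shift ee u) simp
      qed
      hence topL: "topcoeff n L = 0" by (simp add: Suc topcoeff_zero)
      let ?K = "\<lambda>s. K (\<lambda>i. expmat x (s i)) v y"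
      have K': "?K \<in> sqideal n"
        by (rule frob_ideal_expmat[OF char two tensors_eval_frob_ideal[OF K(1) v]])
      have "?C s * v y = ?K s + (L s + (\<Sum>j<m. ee v (face j s)) + ee v s)" for s
      proof -
        have "cup ?E n c (\<lambda>_. ?I) (\<lambda>i. expmat x (s i)) v y
            = K (\<lambda>i. expmat x (s i)) v y + cobound ?E m e (\<lambda>i. expmat x (s i)) v y"
          using K(2) points_expmat[OF x, of s n] 
          by (simp add: fun_eq_iff algebra_simps)
        thus ?thesis
          using v expmat_borel3[OF x]
          by (simp add: cup_eval cobound_End_apply[OF two] L gface_expmat[OF x] ee_def)
      qed
      hence "topcoeff n ?C * v y = topcoeff n (\<lambda>s. ?K s + (L s + (\<Sum>j<m. ee v (face j s)) + ee v s))"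
        using topcoeff_cmult[OF cocycle_restriction(1)[OF char two x cc], of "v y"] by simp
      also have "\<dots> = topcoeff n ?K + (topcoeff n L + (\<Sum>j<m. topcoeff n (\<lambda>s. ee v (face j s))) + topcoeff n (ee v))"
      proof -
        have p: "(\<lambda>s. ee v (face j s)) \<in> pfun n" "ee v \<in> pfun n" for j
          unfolding Suc by (intro pfun_face pfun_Suc ee v)+
        show ?thesis
          using sqideal_pfun[OF K'] Lp p by (simp add: topcoeff_add topcoeff_sum pfun_add pfun_sum)
      qed
      also have "\<dots> = 0"
        using topcoeff_face[OF two ee[OF v]] topcoeff_fewer[OF ee[OF v]] topcoeff_sqideal[OF K'] topL
        by (simp add: Suc)
      finally show ?thesis using vy by simp
    qed
  qed
  thus ?thesis using x by (simp add: support_variety_B1_def)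
qed

section \<open>The Schubert variety of \<open>s\<^sub>\<alpha> s\<^sub>\<beta>\<close>\<close>

abbreviation (input) w_ab :: "'k::field mat3" where "w_ab \<equiv> s_alpha ** s_beta"

lemma w_ab_eq: "w_ab = vector [vector [0, 0, 1], vector [- 1, 0, 0], vector [0, - 1, 0]]"
  by (simp add: s_alpha_def s_beta_def mat3_simps vector_3)

lemma w_ab_SL3: "w_ab \<in> SL3"
  by (simp add: w_ab_eq SL3_def det_3 vector_3)

text \<open>
  The first row \<open>(q\<^sub>1, q\<^sub>2, q\<^sub>3)\<close> of the inverse of \<open>g\<close>. On the preimage of the Schubert variety
  \<open>q\<^sub>3 = 0\<close>, and \<open>q\<^sub>1\<close>, \<open>q\<^sub>2\<close> and the entries of the third column are its homogeneous coordinates.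
\<close>

definition q1 :: "'k::field mat3 \<Rightarrow> 'k" where "q1 g = g$2$2 * g$3$3 - g$2$3 * g$3$2"
definition q2 :: "'k::field mat3 \<Rightarrow> 'k" where "q2 g = g$1$3 * g$3$2 - g$1$2 * g$3$3"
definition q3 :: "'k::field mat3 \<Rightarrow> 'k" where "q3 g = g$1$2 * g$2$3 - g$1$3 * g$2$2"

lemma q_polys: "q1 \<in> polys" "q2 \<in> polys" "q3 \<in> polys"
  unfolding q1_def[abs_def] q2_def[abs_def] q3_def[abs_def] by (intro polys_intros)+

lemma q_third_column: "q1 g * g$1$3 + q2 g * g$2$3 + q3 g * g$3$3 = 0"
  by (simp add: q1_def q2_def q3_def algebra_simps)

lemma q_right:
  assumes "b \<in> borel3"
  shows "q1 (g ** b) = b$2$2 * b$3$3 * q1 g" "q2 (g ** b) = b$2$2 * b$3$3 * q2 g"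
    "q3 (g ** b) = b$2$2 * b$3$3 * q3 g"
  using assms
  by (simp_all add: borel3_iff q1_def q2_def q3_def matrix_matrix_mult_def sum_3 algebra_simps)

lemma third_column_right: "b \<in> borel3 \<Longrightarrow> (g ** b) $ i $ 3 = b$3$3 * g $ i $ 3"
  by (simp add: borel3_iff matrix_matrix_mult_def sum_3)

lemma q_left:
  assumes "b \<in> borel3"
  shows "q1 (binv b ** g) = b$1$1 * q1 g + b$2$1 * q2 g + b$3$1 * q3 g"
    and "q2 (binv b ** g) = b$2$2 * q2 g + b$3$2 * q3 g"
    and "q3 (binv b ** g) = b$3$3 * q3 g"
proof -
  have *: "b$1$1 * b$2$2 * b$3$3 = 1" using assms by (simp add: borel3_iff)
  show "q1 (binv b ** g) = b$1$1 * q1 g + b$2$1 * q2 g + b$3$1 * q3 g"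
    unfolding q1_def q2_def q3_def binv_def matrix_matrix_mult_def sum_3 using *
    by (simp add: vector_3) algebra
  show "q2 (binv b ** g) = b$2$2 * q2 g + b$3$2 * q3 g"
    unfolding q1_def q2_def q3_def binv_def matrix_matrix_mult_def sum_3 using *
    by (simp add: vector_3) algebra
  show "q3 (binv b ** g) = b$3$3 * q3 g"
    unfolding q1_def q2_def q3_def binv_def matrix_matrix_mult_def sum_3 using *
    by (simp add: vector_3) algebra
qed

lemma q3_schubert:
  assumes "g \<in> schubert_preimage w_ab" shows "q3 g = 0"
proof (rule schubert_poly_eq_0[OF assms q_polys(3)])
  fix b b' :: "'a mat3" assume b: "b \<in> borel3" "b' \<in> borel3"
  have "q3 (binv (binv b) ** w_ab) = 0"
    unfolding q_left(3)[OF binv_borel3[OF b(1)]] by (simp add: q3_def w_ab_eq vector_3)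
  thus "q3 (b ** w_ab ** b') = 0" by (simp add: q_right[OF b(2)] binv_binv[OF b(1)])
qed

lemma expmat_left:
  assumes two: "(2::'k::field) = 0" and x: "(x::'k mat3) \<in> N1_u"
    and g: "g \<in> schubert_preimage w_ab"
  shows "q1 (expmat x t ** g) = q1 g + t * x$2$1 * q2 g" "q2 (expmat x t ** g) = q2 g"
    "(expmat x t ** g)$1$3 = g$1$3" "(expmat x t ** g)$2$3 = g$2$3 + t * x$2$1 * g$1$3"
    "(expmat x t ** g)$3$3 = g$3$3 + t * x$3$1 * g$1$3 + t * x$3$2 * g$2$3"
proof -
  have *: "expmat x t ** g = binv (expmat x t) ** g" by (simp add: binv_expmat[OF two x])
  show "q1 (expmat x t ** g) = q1 g + t * x$2$1 * q2 g" "q2 (expmat x t ** g) = q2 g"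
    unfolding * q_left[OF expmat_borel3[OF x]] using x
    by (simp_all add: q3_schubert[OF g] expmat_entry N1_u_iff mat_def)
  show "(expmat x t ** g)$1$3 = g$1$3" "(expmat x t ** g)$2$3 = g$2$3 + t * x$2$1 * g$1$3"
    "(expmat x t ** g)$3$3 = g$3$3 + t * x$3$1 * g$1$3 + t * x$3$2 * g$2$3"
    using x by (simp_all add: N1_u_iff matrix_matrix_mult_def sum_3 expmat_entry mat_def)
qed

lemma weight_inverse:
  assumes "b \<in> borel3"
  shows "inverse (weight (int a) (int c) b) = (b$2$2 * b$3$3) ^ a * b$3$3 ^ c"
proof -
  have "b$1$1 * b$2$2 * b$3$3 = 1" using assms by (simp add: borel3_iff)
  moreover from this have "b$1$1 \<noteq> 0" "b$2$2 \<noteq> 0" by auto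
  ultimately have "b$2$2 * b$3$3 = inverse (b$1$1)" "b$3$3 = inverse (b$1$1 * b$2$2)"
    and "b$1$1 \<noteq> 0" "b$2$2 \<noteq> 0"
    by (auto simp: field_simps)
  thus ?thesis
    by (simp add: weight_def power_add power_mult_distrib power_inverse flip: of_nat_add)
qed

text \<open>
  As \<open>b\<close> has determinant one, the inverse of the weight is \<open>(b\<^sub>2\<^sub>2 b\<^sub>3\<^sub>3)\<^sup>a b\<^sub>3\<^sub>3\<^sup>c\<close>. The \<open>q\<^sub>i\<close> transform by the first of
  these factors and the entries of the third column by the second.
\<close>

lemma section_of_poly:
  assumes F: "F \<in> polys"
    and "\<And>g b. b \<in> borel3 \<Longrightarrow> F (g ** b) = (b$2$2 * b$3$3) ^ a * b$3$3 ^ c * F g"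
  shows "(\<lambda>g. if g \<in> schubert_preimage w then F g else 0) \<in> car (H0 w (int a) (int c))"
  using assms by (auto simp: H0_car_iff weight_inverse schubert_right)

lemma polys_along_line:
  assumes "F \<in> polys" and "\<And>t r s. \<gamma> t $ r $ s = A $ r $ s + t * B $ r $ s"
  shows "\<exists>p. \<forall>t. F (\<gamma> t) = poly p t"
proof -
  have "\<exists>p. \<forall>t. f (\<gamma> t) = poly p t" if f: "f \<in> {\<lambda>g. g $ r $ s | r s. True}" for f :: "'a mat3 \<Rightarrow> 'a"
  proof -
    obtain r s where "f = (\<lambda>g. g $ r $ s)" using f by auto
    thus ?thesis using assms(2) by (intro exI[of _ "[:A $ r $ s, B $ r $ s:]"]) simp
  qed
  with assms(1) show ?thesis unfolding polys_def by (rule subalg_poly_along_curve)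
qed

text \<open>
  The element \<open>s\<^sub>\<beta>\<close> is the limit at \<open>t = 0\<close> of \<open>(1 + t E\<^sub>1\<^sub>2) s\<^sub>\<beta>\<close>, which for \<open>t \<noteq> 0\<close> lies in the open
  double coset.
\<close>

lemma s_beta_schubert: "(s_beta :: 'k::alg_closed_field mat3) \<in> schubert_preimage w_ab"
proof (rule schubertI)
  show "(s_beta :: 'k mat3) \<in> SL3" by (simp add: s_beta_def SL3_def det_3 vector_3)
  fix F :: "'k mat3 \<Rightarrow> 'k"
  assume F: "F \<in> polys" "\<And>b b'. b \<in> borel3 \<Longrightarrow> b' \<in> borel3 \<Longrightarrow> F (b ** w_ab ** b') = 0"
  define \<gamma> :: "'k \<Rightarrow> 'k mat3"
    where "\<gamma> t = vector [vector [1, 0, t], vector [0, 0, 1], vector [0, - 1, 0]]" for t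
  have "\<exists>p. \<forall>t. F (\<gamma> t) = poly p t"
  proof (rule polys_along_line[OF F(1)])
    show "\<gamma> t $ r $ s = \<gamma> 0 $ r $ s + t * (\<chi> r s. \<gamma> 1 $ r $ s - \<gamma> 0 $ r $ s) $ r $ s" for t r s
      using exhaust_3[of r] exhaust_3[of s] by (auto simp: \<gamma>_def vector_3)
  qed
  then obtain p where p: "\<And>t. F (\<gamma> t) = poly p t" by blast
  have "poly p t = poly 0 t" if "t \<noteq> 0" for t
  proof -
    let ?b = "vector [vector [t, 0, 0], vector [1, 1/t, 0], vector [0, 0, 1]] :: 'k mat3"
    let ?b' = "vector [vector [1, 0, 0], vector [0, 1, 0], vector [1/t, 0, 1]] :: 'k mat3"
    have "\<gamma> t = ?b ** w_ab ** ?b'"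
      unfolding w_ab_eq using that by (simp add: \<gamma>_def mat3_simps vector_3)
    moreover have "?b \<in> borel3" "?b' \<in> borel3" using that by (simp_all add: borel3_iff vector_3)
    ultimately show ?thesis using F(2)[of ?b ?b'] p[of t] by simp
  qed
  hence "p = 0" by (rule poly_eqI_infinite)
  moreover have "\<gamma> 0 = s_beta" by (simp add: \<gamma>_def s_beta_def)
  ultimately show "F s_beta = 0" using p[of 0] by simp
qed

lemma H0_unipotent_right:
  assumes "f \<in> car (H0 w l1 l2)" "g \<in> schubert_preimage w" "b \<in> borel3" "b$1$1 = 1" "b$2$2 = 1"
  shows "f (g ** b) = f g"
  using assms by (simp add: H0_car_iff weight_def)

section \<open>Points of the support variety\<close>

lemma lie_u_alpha_iff: "x \<in> lie_u_alpha \<longleftrightarrow> x \<in> N1_u \<and> x$2$1 = 0"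
  by (auto simp: lie_u_alpha_def lie_u_def N1_u_iff forall_3)

lemma lie_u_beta_iff: "x \<in> lie_u_beta \<longleftrightarrow> x \<in> N1_u \<and> x$3$2 = 0"
  by (auto simp: lie_u_beta_def lie_u_def N1_u_iff forall_3)

lemma N1_u_eq: "N1_u = lie_u_alpha \<union> lie_u_beta"
  by (auto simp: lie_u_alpha_iff lie_u_beta_iff N1_u_iff)

text \<open>
  For \<open>x \<in> \<uu>\<^sub>\<alpha>\<close> the coordinates \<open>q\<^sub>1\<close>, \<open>q\<^sub>2\<close>, \<open>g\<^sub>1\<^sub>3\<close> and \<open>g\<^sub>2\<^sub>3\<close> are invariant. As \<open>y\<close> one takes a point
  whose third column is annihilated by \<open>x\<close>, and as \<open>v\<close> a monomial in the invariant coordinates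
  which does not vanish there.
\<close>

lemma lie_u_alpha_support:
  fixes x :: "'k::alg_closed_field mat3"
  assumes char: "CHAR('k) = 2" and two: "(2::'k) = 0" and xa: "x \<in> lie_u_alpha"
  shows "x \<in> support_variety_B1 (H0 w_ab (int a) (int c))"
proof -
  have x: "x \<in> N1_u" and x21: "x$2$1 = 0" using xa by (auto simp: lie_u_alpha_iff)
  let ?Y = "schubert_preimage w_ab :: 'k mat3 set"
  show ?thesis
  proof (cases "x$3$2 = 0")
    case False
    define u where "u = x$3$1 / x$3$2"
    define y :: "'k mat3" where "y = vector [vector [0, 0, 1], vector [- 1, 0, u], vector [0, - 1, 0]]"
    let ?b = "vector [vector [1, 0, 0], vector [u, 1, 0], vector [0, 0, 1]] :: 'k mat3"
    have "y = ?b ** w_ab ** mat 1"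
      unfolding w_ab_eq by (simp add: y_def mat3_simps vector_3)
    moreover have "?b \<in> borel3" "mat 1 \<in> (borel3 :: 'k mat3 set)"
      by (simp_all add: borel3_iff vector_3 mat_def)
    ultimately have y: "y \<in> ?Y" using schubert_double_coset[OF w_ab_SL3] by metis
    let ?F = "\<lambda>g. q2 g ^ a * g$1$3 ^ c"
    show ?thesis
    proof (rule support_variety_criterion[OF char two x _ y])
      show "(\<lambda>g. if g \<in> ?Y then ?F g else 0) \<in> car (H0 w_ab (int a) (int c))"
        by (rule section_of_poly, intro polys_intros q_polys)
          (simp add: q_right third_column_right power_mult_distrib)
      show "(if y \<in> ?Y then ?F y else 0) \<noteq> 0"
        using y by (simp add: y_def q2_def vector_3)
      fix z assume z: "z \<in> ?Y"
      show "\<exists>p. (\<forall>t. (if expmat x t ** z \<in> ?Y then ?F (expmat x t ** z) else 0) = poly p t) \<and> coeff p 1 = 0"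
        using z by (intro exI[of _ "[:?F z:]"])
          (simp add: schubert_left_iff expmat_borel3[OF x] expmat_left[OF two x z])
    next
      fix f t assume f: "f \<in> car (H0 w_ab (int a) (int c) :: ('k, 'k mat3 \<Rightarrow> 'k) rmod)"
      let ?n = "vector [vector [1, 0, 0], vector [t * x$3$2, 1, 0], vector [0, 0, 1]] :: 'k mat3"
      have "x$3$1 + x$3$2 * u = 0" using False char2_add_self[OF two] by (simp add: u_def)
      hence u: "t * x$3$1 + t * x$3$2 * u = 0" by (metis distrib_left mult.assoc mult_zero_right)
      have "expmat x t ** y = y ** ?n"
        using x x21 u char2_minus[OF two] 
        by (simp add: y_def expmat_entry mat3_simps vector_3 N1_u_iff)
      thus "f (expmat x t ** y) = f y"
        using H0_unipotent_right[OF f y, of ?n] by (simp add: borel3_iff vector_3)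
    qed
  next
    case True
    let ?F = "\<lambda>g. q1 g ^ a * g$2$3 ^ c"
    show ?thesis
    proof (rule support_variety_criterion[OF char two x _ s_beta_schubert])
      show "(\<lambda>g. if g \<in> ?Y then ?F g else 0) \<in> car (H0 w_ab (int a) (int c))"
        by (rule section_of_poly, intro polys_intros q_polys)
          (simp add: q_right third_column_right power_mult_distrib)
      show "(if s_beta \<in> ?Y then ?F s_beta else 0) \<noteq> 0"
        using s_beta_schubert[where 'k = 'k] by (simp add: s_beta_def q1_def vector_3)
      fix z assume z: "z \<in> ?Y"
      show "\<exists>p. (\<forall>t. (if expmat x t ** z \<in> ?Y then ?F (expmat x t ** z) else 0) = poly p t) \<and> coeff p 1 = 0"
        using z by (intro exI[of _ "[:?F z:]"])
          (simp add: schubert_left_iff expmat_borel3[OF x] expmat_left[OF two x z] x21)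
    next
      fix f t assume f: "f \<in> car (H0 w_ab (int a) (int c) :: ('k, 'k mat3 \<Rightarrow> 'k) rmod)"
      let ?n = "vector [vector [1, 0, 0], vector [- t * x$3$1, 1, 0], vector [0, 0, 1]] :: 'k mat3"
      have "expmat x t ** s_beta = s_beta ** ?n"
        using x x21 True by (simp add: s_beta_def expmat_entry mat3_simps vector_3 N1_u_iff)
      thus "f (expmat x t ** s_beta) = f s_beta"
        using H0_unipotent_right[OF f s_beta_schubert, of ?n] by (simp add: borel3_iff vector_3)
    qed
  qed
qed

lemma coeff_1_mult: "coeff (p * q) 1 = coeff p 0 * coeff q 1 + coeff p 1 * coeff q 0"
  by (simp add: coeff_mult)

lemma coeff_linear_power:
  "coeff ([:A, B:] ^ n) 0 = A ^ n" "coeff ([:A, B:] ^ n) 1 = of_nat n * A ^ (n - 1) * B"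
proof -
  show 0: "coeff ([:A, B:] ^ n) 0 = A ^ n" for n
    by (induction n) (simp_all add: mult_poly_0_left coeff_mult)
  show "coeff ([:A, B:] ^ n) 1 = of_nat n * A ^ (n - 1) * B"
  proof (induction n)
    case (Suc n)
    thus ?case by (cases n) (simp_all add: coeff_1_mult 0 algebra_simps)
  qed simp
qed

text \<open>
  For \<open>x \<in> \<uu>\<^sub>\<beta>\<close> with \<open>x\<^sub>2\<^sub>1 \<noteq> 0\<close> the coordinates \<open>r = g\<^sub>3\<^sub>3 + (x\<^sub>3\<^sub>1 / x\<^sub>2\<^sub>1) g\<^sub>2\<^sub>3\<close> and \<open>\<rho> = g\<^sub>1\<^sub>3 / q\<^sub>2 = g\<^sub>2\<^sub>3 / q\<^sub>1\<close> are
  invariant, and \<open>x\<close> acts on polynomials in \<open>q\<^sub>1\<close>, \<open>q\<^sub>2\<close> as a multiple of \<open>q\<^sub>2 \<partial>/\<partial>q\<^sub>1\<close>. An even power of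
  \<open>q\<^sub>1\<close> is killed without lying in the image. The exponent of \<open>q\<^sub>1\<close> in \<open>r\<^sup>i \<rho>\<^sup>j q\<^sub>1\<^sup>a\<^sup>+\<^sup>j\<close>, where
  \<open>i + j = c\<close>, can be chosen to be even unless \<open>c = 0\<close> and \<open>a\<close> is odd. This section is written as
  \<open>r\<^sup>i g\<^sub>2\<^sub>3\<^sup>j q\<^sub>1\<^sup>a\<close> below, with \<open>j \<le> 1\<close>.
\<close>

lemma lie_u_beta_support:
  fixes x :: "'k::alg_closed_field mat3"
  assumes char: "CHAR('k) = 2" and two: "(2::'k) = 0" and xb: "x \<in> lie_u_beta"
    and parity: "even a \<or> c \<noteq> 0"
  shows "x \<in> support_variety_B1 (H0 w_ab (int a) (int c))"
proof (cases "x$2$1 = 0")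
  case True
  hence "x \<in> lie_u_alpha" using xb by (simp add: lie_u_alpha_iff lie_u_beta_iff)
  thus ?thesis by (rule lie_u_alpha_support[OF char two])
next
  case False
  have x: "x \<in> N1_u" and x32: "x$3$2 = 0" using xb by (auto simp: lie_u_beta_iff)
  let ?Y = "schubert_preimage w_ab :: 'k mat3 set"
  define u where "u = x$3$1 / x$2$1"
  have ux: "u * x$2$1 = x$3$1" using False by (simp add: u_def)
  define j :: nat where "j = (if even a then 0 else 1)"
  define i where "i = c - j"
  have ij: "i + j = c" using parity by (auto simp: i_def j_def)
  \<comment> \<open>At this point \<open>q\<^sub>1 = 1\<close>, \<open>q\<^sub>2 = 0\<close>, \<open>g\<^sub>2\<^sub>3 = 1\<close> and \<open>r = 1 + u + u = 1\<close>.\<close>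
  define y :: "'k mat3" where "y = vector [vector [1, 0, 0], vector [0, 0, 1], vector [0, - 1, 1 + u]]"
  let ?l = "vector [vector [1, 0, 0], vector [0, 1, 0], vector [0, 1 + u, 1]] :: 'k mat3"
  have "y = ?l ** s_beta" by (simp add: y_def s_beta_def mat3_simps vector_3)
  hence y: "y \<in> ?Y" using schubert_left[OF s_beta_schubert, of ?l] by (simp add: borel3_iff vector_3)
  let ?F = "\<lambda>g. (g$3$3 + u * g$2$3) ^ i * g$2$3 ^ j * q1 g ^ a"
  show ?thesis
  proof (rule support_variety_criterion[OF char two x _ y])
    show "(\<lambda>g. if g \<in> ?Y then ?F g else 0) \<in> car (H0 w_ab (int a) (int c))"
    proof (rule section_of_poly)
      show "?F \<in> polys" by (intro polys_intros q_polys)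
      fix g b :: "'k mat3" assume b: "b \<in> borel3"
      have "(g ** b)$3$3 + u * (g ** b)$2$3 = b$3$3 * (g$3$3 + u * g$2$3)"
        by (simp add: third_column_right[OF b] algebra_simps)
      thus "?F (g ** b) = (b$2$2 * b$3$3) ^ a * b$3$3 ^ c * ?F g"
        by (simp add: q_right[OF b] third_column_right[OF b] power_mult_distrib power_add flip: ij)
    qed
    have "1 + u + u = 1" using char2_add_self[OF two, of u] by (simp add: add.assoc)
    moreover have "?F y = (1 + u + u) ^ i" by (simp add: y_def q1_def vector_3)
    ultimately have "?F y = 1" by (simp only: power_one)
    thus "(if y \<in> ?Y then ?F y else 0) \<noteq> 0" by (simp only: y if_True one_neq_zero not_False_eq_True)
    fix z assume z: "z \<in> ?Y"
    have r: "z$3$3 + t * x$3$1 * z$1$3 + u * (z$2$3 + t * x$2$1 * z$1$3) = z$3$3 + u * z$2$3" for t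
    proof -
      have "z$3$3 + t * x$3$1 * z$1$3 + u * (z$2$3 + t * x$2$1 * z$1$3)
          = z$3$3 + u * z$2$3 + (t * x$3$1 * z$1$3 + t * (u * x$2$1) * z$1$3)"
        by (simp add: algebra_simps)
      thus ?thesis by (simp add: ux char2_add_self[OF two])
    qed
    let ?p = "[:z$3$3 + u * z$2$3:] ^ i * ([:z$2$3, x$2$1 * z$1$3:] ^ j * [:q1 z, x$2$1 * q2 z:] ^ a)"
    show "\<exists>p. (\<forall>t. (if expmat x t ** z \<in> ?Y then ?F (expmat x t ** z) else 0) = poly p t) \<and> coeff p 1 = 0"
    proof (intro exI[of _ ?p] conjI allI)
      fix t
      have "?F (expmat x t ** z) = (z$3$3 + u * z$2$3) ^ i * (z$2$3 + t * x$2$1 * z$1$3) ^ j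
          * (q1 z + t * x$2$1 * q2 z) ^ a"
        by (simp only: expmat_left[OF two x z] x32 mult_zero_left mult_zero_right add_0_right r)
      moreover have "expmat x t ** z \<in> ?Y" using z schubert_left expmat_borel3[OF x] by blast
      ultimately show "(if expmat x t ** z \<in> ?Y then ?F (expmat x t ** z) else 0) = poly ?p t"
        by (simp add: mult_ac)
    next
      have q0: "q1 z * z$1$3 + q2 z * z$2$3 = 0"
        using q_third_column[of z] q3_schubert[OF z] by simp
      have "coeff ([:z$2$3, x$2$1 * z$1$3:] ^ j * [:q1 z, x$2$1 * q2 z:] ^ a) 1 = 0"
      proof (cases "even a")
        case True
        hence "of_nat a = (0::'k)" using two by (auto elim!: evenE)
        thus ?thesis using True by (simp add: j_def coeff_linear_power[unfolded One_nat_def])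
      next
        case False
        then obtain k where k: "a = Suc (2 * k)" by (auto elim!: oddE)
        have a1: "of_nat a = (1::'k)" using two by (simp add: k)
        have "coeff ([:z$2$3, x$2$1 * z$1$3:] ^ j * [:q1 z, x$2$1 * q2 z:] ^ a) 1
            = z$2$3 * (q1 z ^ (2 * k) * (x$2$1 * q2 z)) + x$2$1 * z$1$3 * q1 z ^ Suc (2 * k)"
          unfolding coeff_1_mult coeff_linear_power a1 using False by (simp add: j_def) (simp add: k)
        hence "coeff ([:z$2$3, x$2$1 * z$1$3:] ^ j * [:q1 z, x$2$1 * q2 z:] ^ a) 1
            = x$2$1 * q1 z ^ (2 * k) * (q1 z * z$1$3 + q2 z * z$2$3)"
          by (simp add: algebra_simps)
        thus ?thesis by (simp add: q0)
      qed
      moreover have "coeff ([:z$3$3 + u * z$2$3:] ^ i) 1 = 0"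
        using coeff_linear_power(2)[of "z$3$3 + u * z$2$3" 0 i] by simp
      ultimately show "coeff ?p 1 = 0"
        unfolding coeff_1_mult[of "[:z$3$3 + u * z$2$3:] ^ i"] by (simp only: mult_zero_left mult_zero_right add_0)
    qed
  next
    fix f t assume f: "f \<in> car (H0 w_ab (int a) (int c) :: ('k, 'k mat3 \<Rightarrow> 'k) rmod)"
    let ?n = "vector [vector [1, 0, 0], vector [t * x$2$1 , 1, 0], vector [t * x$2$1, 0, 1]] :: 'k mat3"
    have "expmat x t ** y = y ** ?n"
      using x x32 by (simp add: y_def expmat_entry mat3_simps vector_3 N1_u_iff algebra_simps flip: ux)
    thus "f (expmat x t ** y) = f y"
      using H0_unipotent_right[OF f y, of ?n] by (simp add: borel3_iff vector_3)
  qed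
qed

section \<open>The module of sections for \<open>\<lambda>\<^sub>2 = 0\<close>\<close>

text \<open>
  Sections are determined by their restriction to the curve \<open>u \<mapsto> (1 + u E\<^sub>2\<^sub>1) s\<^sub>\<alpha> s\<^sub>\<beta>\<close>, on which
  \<open>q\<^sub>1 = u\<close> and \<open>q\<^sub>2 = -1\<close>.
\<close>

definition slice :: "'k::field \<Rightarrow> 'k \<Rightarrow> 'k mat3" where
  "slice u y = vector [vector [0, 0, 1], vector [- 1, 0, u], vector [0, - 1, y]]"

lemma slice_schubert: "slice u y \<in> schubert_preimage w_ab"
proof -
  let ?b = "vector [vector [1, 0, 0], vector [u, 1, 0], vector [y, 0, 1]] :: 'a mat3"
  have "?b ** w_ab ** mat 1 \<in> schubert_preimage w_ab"
    by (rule schubert_double_coset[OF w_ab_SL3]) (simp_all add: borel3_iff vector_3 mat_def)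
  moreover have "?b ** w_ab ** mat 1 = slice u y"
    unfolding w_ab_eq by (simp add: slice_def mat3_simps vector_3)
  ultimately show ?thesis by simp
qed

lemma H0_right:
  assumes "f \<in> car (H0 w (int a) (int c))" "g \<in> schubert_preimage w" "b \<in> borel3"
  shows "f (g ** b) = (b$2$2 * b$3$3) ^ a * b$3$3 ^ c * f g"
  using assms by (simp add: H0_car_iff weight_inverse)

text \<open>The open double coset is the product of the slice and \<open>B\<close>.\<close>

lemma section_double_coset:
  assumes f: "f \<in> car (H0 w_ab (int m) 0)" and b: "b \<in> borel3" "b' \<in> borel3"
  shows "f (b ** w_ab ** b')
    = (b'$2$2 * b'$3$3) ^ m * (b$1$1 * b$3$3) ^ m * f (slice (b$2$1 / b$1$1) (b$3$1 / b$1$1))"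
proof -
  have b0: "b$1$2 = 0" "b$1$3 = 0" "b$2$3 = 0" "b$1$1 * b$2$2 * b$3$3 = 1" "b$1$1 \<noteq> 0"
    using b(1) by (auto simp: borel3_iff)
  let ?n = "vector [vector [b$2$2, 0, 0], vector [b$3$2, b$3$3, 0], vector [0, 0, b$1$1]] :: 'a mat3"
  have n: "?n \<in> borel3" using b0 by (simp add: borel3_iff vector_3 mult_ac)
  have *: "b ** w_ab = slice (b$2$1 / b$1$1) (b$3$1 / b$1$1) ** ?n"
    unfolding w_ab_eq using b0 by (simp add: slice_def mat3_simps vector_3)
  have "f (b ** w_ab ** b') = (b'$2$2 * b'$3$3) ^ m * f (b ** w_ab)"
    using H0_right[of f w_ab m 0, OF _ schubert_right[OF slice_schubert n] b(2)] f by (simp add: * )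
  also have "f (b ** w_ab) = (b$3$3 * b$1$1) ^ m * f (slice (b$2$1 / b$1$1) (b$3$1 / b$1$1))"
    using H0_right[of f w_ab m 0, OF _ slice_schubert n] f by (simp add: * vector_3)
  finally show ?thesis by (simp add: mult_ac)
qed

text \<open>In this form the rewrite rule for quantifiers over three indices checks all entries at once.\<close>

lemma line_entries:
  fixes \<gamma> A B :: "'k::field mat3"
  assumes "\<forall>r s. \<gamma> $ r $ s = A $ r $ s + t * B $ r $ s"
  shows "\<gamma> $ r $ s = A $ r $ s + t * B $ r $ s"
  using assms by blast

text \<open>
  The second coordinate of the slice runs through the affine part of a fibre of \<open>G/B \<rightarrow> G/P\<^sub>\<beta>\<close>, a
  projective line on which the line bundle is trivial as \<open>\<lambda>\<^sub>2 = 0\<close>. The first coordinate runs through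
  the affine part of a projective line on which the line bundle has degree \<open>m\<close>.
\<close>

lemma section_slice_fibre:
  fixes f :: "'k::alg_closed_field mat3 \<Rightarrow> 'k"
  assumes f: "f \<in> car (H0 w_ab (int m) 0)"
  shows "f (slice u y) = f (slice u 0)"
proof -
  obtain F where F: "F \<in> polys" "\<forall>g\<in>schubert_preimage w_ab. f g = F g"
    using f by (auto simp: H0_car_iff)
  let ?R = "\<lambda>s. vector [vector [0, 1, s], vector [- 1, u, u * s], vector [0, 0, 1]] :: 'k mat3"
  have "\<exists>p. \<forall>t. F (slice u t) = poly p t"
    by (rule polys_along_line[OF F(1), of _ "slice u 0" "slice 0 1 - slice 0 0"])
      (rule line_entries, simp add: forall_3 slice_def vector_3)
  then obtain p where p: "\<And>t. F (slice u t) = poly p t" by blast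
  have "\<exists>q. \<forall>t. F (?R t) = poly q t"
    by (rule polys_along_line[OF F(1), of _ "?R 0" "?R 1 - ?R 0"])
      (rule line_entries, simp add: forall_3 vector_3)
  then obtain q where q: "\<And>t. F (?R t) = poly q t" by blast
  have "degree p \<le> 0"
  proof (rule degree_le_of_inverse_chart)
    fix t :: 'k assume t: "t \<noteq> 0"
    let ?n = "vector [vector [1, 0, 0], vector [0, t, 0], vector [0, 1, inverse t]] :: 'k mat3"
    have n: "?n \<in> borel3" using t by (simp add: borel3_iff vector_3)
    have R: "?R (inverse t) = slice u t ** ?n"
      using t by (simp add: slice_def mat3_simps vector_3)
    have "poly q (inverse t) = F (slice u t ** ?n)" using q[of "inverse t"] unfolding R by simp
    also have "\<dots> = f (slice u t ** ?n)"
      by (rule F(2)[rule_format, OF schubert_right[OF slice_schubert n], symmetric])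
    also have "\<dots> = f (slice u t)"
      using H0_right[of f w_ab m 0, OF _ slice_schubert n] f t by (simp add: vector_3)
    also have "\<dots> = poly p t" using p F(2) by (simp add: slice_schubert)
    finally show "poly p t = t ^ 0 * poly q (inverse t)" by simp
  qed
  then obtain c where "p = [:c:]" by (metis degree_eq_zeroE le_zero_eq)
  thus ?thesis using p F(2) by (simp add: slice_schubert)
qed

definition slice_poly :: "('k::field mat3 \<Rightarrow> 'k) \<Rightarrow> 'k poly" where
  "slice_poly f = (THE p. \<forall>u. f (slice u 0) = poly p u)"

lemma slice_poly_eq:
  fixes f :: "'k::alg_closed_field mat3 \<Rightarrow> 'k"
  assumes "\<And>u. f (slice u 0) = poly p u" shows "slice_poly f = p"
  unfolding slice_poly_def using assms by (intro the_equality) (auto intro: poly_eqI_infinite)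

lemma slice_poly_section:
  fixes f :: "'k::alg_closed_field mat3 \<Rightarrow> 'k"
  assumes f: "f \<in> car (H0 w_ab (int m) 0)"
  shows "f (slice u 0) = poly (slice_poly f) u" and "degree (slice_poly f) \<le> m"
proof -
  obtain F where F: "F \<in> polys" "\<forall>g\<in>schubert_preimage w_ab. f g = F g"
    using f by (auto simp: H0_car_iff)
  let ?R = "\<lambda>s. vector [vector [1, 0, s], vector [0, 0, 1], vector [0, - 1, 0]] :: 'k mat3"
  have "\<exists>p. \<forall>t. F (slice t 0) = poly p t"
    by (rule polys_along_line[OF F(1), of _ "slice 0 0" "slice 1 0 - slice 0 0"])
      (rule line_entries, simp add: forall_3 slice_def vector_3)
  then obtain p where p: "\<And>t. F (slice t 0) = poly p t" by blast
  have "\<exists>q. \<forall>t. F (?R t) = poly q t"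
    by (rule polys_along_line[OF F(1), of _ "?R 0" "?R 1 - ?R 0"])
      (rule line_entries, simp add: forall_3 vector_3)
  then obtain q where q: "\<And>t. F (?R t) = poly q t" by blast
  have fp: "f (slice u 0) = poly p u" for u using p F(2) by (simp add: slice_schubert)
  hence *: "slice_poly f = p" by (rule slice_poly_eq)
  show "f (slice u 0) = poly (slice_poly f) u" by (simp add: * fp)
  have "degree p \<le> m"
  proof (rule degree_le_of_inverse_chart)
    fix t :: 'k assume t: "t \<noteq> 0"
    let ?n = "vector [vector [t, 0, 0], vector [0, 1, 0], vector [1, 0, inverse t]] :: 'k mat3"
    have n: "?n \<in> borel3" using t by (simp add: borel3_iff vector_3)
    have R: "?R (inverse t) = slice t 0 ** ?n"
      using t by (simp add: slice_def mat3_simps vector_3)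
    have "poly q (inverse t) = F (slice t 0 ** ?n)" using q[of "inverse t"] unfolding R by simp
    also have "\<dots> = f (slice t 0 ** ?n)"
      by (rule F(2)[rule_format, OF schubert_right[OF slice_schubert n], symmetric])
    also have "\<dots> = inverse t ^ m * f (slice t 0)"
      using H0_right[of f w_ab m 0, OF _ slice_schubert n] f t by (simp add: vector_3)
    finally show "poly p t = t ^ m * poly q (inverse t)"
      using t by (simp add: fp power_inverse)
  qed
  thus "degree (slice_poly f) \<le> m" by (simp add: *)
qed

definition monomial_section :: "nat \<Rightarrow> nat \<Rightarrow> 'k::field mat3 \<Rightarrow> 'k" where
  "monomial_section m i g = (if g \<in> schubert_preimage w_ab then q1 g ^ i * q2 g ^ (m - i) else 0)"

lemma monomial_section_car:
  assumes "i \<le> m" shows "monomial_section m i \<in> car (H0 w_ab (int m) 0)"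
proof -
  have "(\<lambda>g. if g \<in> schubert_preimage w_ab then q1 g ^ i * q2 g ^ (m - i) else 0)
      \<in> car (H0 w_ab (int m) (int 0) :: ('a, 'a mat3 \<Rightarrow> 'a) rmod)"
  proof (rule section_of_poly, intro polys_intros q_polys)
    fix g b :: "'a mat3" assume b: "b \<in> borel3"
    have "(b$2$2 * b$3$3) ^ m = (b$2$2 * b$3$3) ^ i * (b$2$2 * b$3$3) ^ (m - i)"
      using assms by (simp flip: power_add)
    thus "q1 (g ** b) ^ i * q2 (g ** b) ^ (m - i)
        = (b$2$2 * b$3$3) ^ m * b$3$3 ^ 0 * (q1 g ^ i * q2 g ^ (m - i))"
      by (simp add: q_right[OF b] power_mult_distrib)
  qed
  thus ?thesis by (simp add: monomial_section_def[abs_def])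
qed

lemma q_slice: "q1 (slice u y) = u" "q2 (slice u y) = - 1" "q3 (slice u y) = 0"
  by (simp_all add: q1_def q2_def q3_def slice_def vector_3)

text \<open>
  Both sides are polynomial, so they are compared on the open double coset, where they are determined
  by their values on the slice. Thus the module is the \<open>m\<close>-th symmetric power of the span of \<open>q\<^sub>1\<close> and \<open>q\<^sub>2\<close>.
\<close>

lemma sections_expand:
  fixes f :: "'k::alg_closed_field mat3 \<Rightarrow> 'k"
  assumes two: "(2::'k) = 0" and f: "f \<in> car (H0 w_ab (int m) 0)"
  shows "f = (\<lambda>g. \<Sum>i\<le>m. coeff (slice_poly f) i * monomial_section m i g)"
proof
  fix g
  let ?c = "coeff (slice_poly f)"
  obtain F where F: "F \<in> polys" "\<forall>g\<in>schubert_preimage w_ab. f g = F g"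
    using f by (auto simp: H0_car_iff)
  show "f g = (\<Sum>i\<le>m. ?c i * monomial_section m i g)"
  proof (cases "g \<in> schubert_preimage w_ab")
    case True
    let ?D = "\<lambda>g. F g - (\<Sum>i\<le>m. ?c i * (q1 g ^ i * q2 g ^ (m - i)))"
    have "?D g = 0"
    proof (rule schubert_poly_eq_0[OF True])
      show "?D \<in> polys" by (intro polys_intros q_polys F)
      fix b b' :: "'k mat3" assume b: "b \<in> borel3" "b' \<in> borel3"
      have b0: "b$1$1 \<noteq> 0" using b(1) by (auto simp: borel3_iff)
      let ?g = "b ** w_ab ** b'" and ?e = "b'$2$2 * b'$3$3 * b$3$3"
      have "q1 (binv (binv b) ** w_ab) = b$3$3 * b$2$1" "q2 (binv (binv b) ** w_ab) = b$3$3 * b$1$1"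
        unfolding q_left[OF binv_borel3[OF b(1)]] w_ab_eq
        by (simp_all add: q1_def q2_def q3_def binv_def vector_3 char2_minus[OF two])
      hence q: "q1 ?g = ?e * b$2$1" "q2 ?g = ?e * b$1$1"
        by (simp_all add: q_right[OF b(2)] binv_binv[OF b(1)])
      have "F ?g = f ?g" using F(2) by (simp add: schubert_double_coset[OF w_ab_SL3 b])
      also have "\<dots> = (b'$2$2 * b'$3$3) ^ m * (b$1$1 * b$3$3) ^ m * poly (slice_poly f) (b$2$1 / b$1$1)"
        by (simp only: section_double_coset[OF f b] section_slice_fibre[OF f, of _ "b$3$1 / b$1$1"]
            slice_poly_section(1)[OF f])
      also have "poly (slice_poly f) (b$2$1 / b$1$1) = (\<Sum>i\<le>m. ?c i * (b$2$1 / b$1$1) ^ i)"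
        unfolding poly_altdef using slice_poly_section(2)[OF f]
        by (intro sum.mono_neutral_left) (auto simp: coeff_eq_0)
      also have "(b'$2$2 * b'$3$3) ^ m * (b$1$1 * b$3$3) ^ m * \<dots>
          = (\<Sum>i\<le>m. ?c i * (q1 ?g ^ i * q2 ?g ^ (m - i)))"
        unfolding sum_distrib_left
      proof (rule sum.cong[OF refl])
        fix i assume "i \<in> {..m}"
        hence im: "m = i + (m - i)" by simp
        have "(b'$2$2 * b'$3$3) ^ m * (b$1$1 * b$3$3) ^ m = ?e ^ m * b$1$1 ^ m"
          by (simp add: power_mult_distrib mult_ac)
        also have "\<dots> = ?e ^ i * ?e ^ (m - i) * (b$1$1 ^ i * b$1$1 ^ (m - i))"
          by (subst (1 2) im) (simp only: power_add)
        finally have "(b'$2$2 * b'$3$3) ^ m * (b$1$1 * b$3$3) ^ m = \<dots>" .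
        thus "(b'$2$2 * b'$3$3) ^ m * (b$1$1 * b$3$3) ^ m * (?c i * (b$2$1 / b$1$1) ^ i)
            = ?c i * (q1 ?g ^ i * q2 ?g ^ (m - i))"
          using b0 unfolding q by (simp add: power_mult_distrib power_divide)
      qed
      finally show "?D ?g = 0" by simp
    qed
    thus ?thesis using F(2) True by (simp add: monomial_section_def)
  next
    case False
    thus ?thesis using f by (simp add: H0_car_iff monomial_section_def)
  qed
qed

lemma section_eqI:
  fixes f :: "'k::alg_closed_field mat3 \<Rightarrow> 'k"
  assumes "(2::'k) = 0" "f \<in> car (H0 w_ab (int m) 0)" "h \<in> car (H0 w_ab (int m) 0)"
    "slice_poly f = slice_poly h"
  shows "f = h"
  using sections_expand[OF assms(1,2)] sections_expand[OF assms(1,3)] assms(4) by simp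

lemma slice_poly_add:
  fixes f :: "'k::alg_closed_field mat3 \<Rightarrow> 'k"
  assumes "f \<in> car (H0 w_ab (int m) 0)" "h \<in> car (H0 w_ab (int m) 0)"
  shows "slice_poly (f + h) = slice_poly f + slice_poly h"
  by (rule slice_poly_eq) (simp add: slice_poly_section(1)[OF assms(1)] slice_poly_section(1)[OF assms(2)])

lemma slice_poly_cmult:
  fixes f :: "'k::alg_closed_field mat3 \<Rightarrow> 'k"
  assumes "f \<in> car (H0 w_ab (int m) 0)"
  shows "slice_poly (\<lambda>g. c * f g) = smult c (slice_poly f)"
  by (rule slice_poly_eq) (simp add: slice_poly_section(1)[OF assms])

text \<open>
  The homogenisation of \<open>p\<close> in \<open>q\<^sub>1\<close> and \<open>q\<^sub>2\<close>, inverse to \<open>slice_poly\<close> on polynomials of degree at most \<open>m\<close>.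
\<close>

definition section_of :: "nat \<Rightarrow> 'k::field poly \<Rightarrow> 'k mat3 \<Rightarrow> 'k" where
  "section_of m p = (\<lambda>g. \<Sum>i\<le>m. coeff p i * monomial_section m i g)"

lemma section_of_car: "section_of m p \<in> car (H0 w_ab (int m) 0)"
proof -
  have "(\<lambda>g. \<Sum>i\<in>I. coeff p i * monomial_section m i g) \<in> car (H0 w_ab (int m) 0)"
    if "finite I" "I \<subseteq> {..m}" for I
    using that
  proof (induction I)
    case (insert i I)
    have "(\<lambda>g. coeff p i * monomial_section m i g) + (\<lambda>g. \<Sum>i\<in>I. coeff p i * monomial_section m i g)
        \<in> car (H0 w_ab (int m) 0)"
      using insert by (intro H0_add H0_cmult monomial_section_car) auto
    thus ?case using insert(1,2) by (simp add: plus_fun_def)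
  qed (use H0_zero in \<open>simp add: zero_fun_def\<close>)
  thus ?thesis by (simp add: section_of_def)
qed

lemma slice_poly_section_of:
  assumes two: "(2::'k::alg_closed_field) = 0" and "degree p \<le> m"
  shows "slice_poly (section_of m p :: 'k mat3 \<Rightarrow> 'k) = p"
proof (rule slice_poly_eq)
  fix u :: 'k
  have "section_of m p (slice u 0) = (\<Sum>i\<le>m. coeff p i * u ^ i)"
    by (simp add: section_of_def monomial_section_def slice_schubert q_slice char2_minus[OF two])
  also have "\<dots> = poly p u"
    unfolding poly_altdef using assms(2) by (intro sum.mono_neutral_right) (auto simp: coeff_eq_0)
  finally show "section_of m p (slice u 0) = poly p u" .
qed

text \<open>
  Left translation with \<open>b\<^sup>-\<^sup>1\<close> maps \<open>q\<^sub>1\<close> to \<open>b\<^sub>1\<^sub>1 q\<^sub>1 + b\<^sub>2\<^sub>1 q\<^sub>2\<close> and \<open>q\<^sub>2\<close> to \<open>b\<^sub>2\<^sub>2 q\<^sub>2\<close>, which is an affine substitution in \<open>u\<close>.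
\<close>

lemma slice_poly_act:
  fixes f :: "'k::alg_closed_field mat3 \<Rightarrow> 'k"
  assumes two: "(2::'k) = 0" and f: "f \<in> car (H0 w_ab (int m) 0)" and b: "b \<in> borel3"
  shows "slice_poly (act (H0 w_ab (int m) 0) b f)
    = (\<Sum>i\<le>m. smult (coeff (slice_poly f) i) (smult (b$2$2 ^ (m - i)) ([:b$2$1, b$1$1:] ^ i)))"
proof (rule slice_poly_eq)
  fix u
  let ?g = "binv b ** slice u 0"
  have "act (H0 w_ab (int m) 0) b f (slice u 0) = f ?g"
    by (simp add: H0_act matrix_inv_borel3[OF b])
  also have "\<dots> = (\<Sum>i\<le>m. coeff (slice_poly f) i * monomial_section m i ?g)"
    by (subst sections_expand[OF two f]) simp
  also have "\<dots> = (\<Sum>i\<le>m. coeff (slice_poly f) i * ((b$1$1 * u + b$2$1) ^ i * b$2$2 ^ (m - i)))"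
    using schubert_left[OF slice_schubert binv_borel3[OF b]]
    by (simp add: monomial_section_def q_left[OF b] q_slice char2_minus[OF two])
  also have "\<dots> = poly (\<Sum>i\<le>m. smult (coeff (slice_poly f) i) (smult (b$2$2 ^ (m - i)) ([:b$2$1, b$1$1:] ^ i))) u"
    by (simp add: poly_sum mult_ac add.commute)
  finally show "act (H0 w_ab (int m) 0) b f (slice u 0) = \<dots>" .
qed

lemma slice_poly_act_pcompose:
  fixes f :: "'k::alg_closed_field mat3 \<Rightarrow> 'k"
  assumes two: "(2::'k) = 0" and f: "f \<in> car (H0 w_ab (int m) 0)" and b: "b \<in> borel3"
  shows "slice_poly (act (H0 w_ab (int m) 0) b f)
    = smult (b$2$2 ^ m) (pcompose (slice_poly f) [:b$2$1 / b$2$2, b$1$1 / b$2$2:])"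
proof (rule poly_eqI_infinite)
  fix u
  have b0: "b$2$2 \<noteq> 0" using b by (auto simp: borel3_iff)
  have *: "poly (slice_poly f) z = (\<Sum>i\<le>m. coeff (slice_poly f) i * z ^ i)" for z
    unfolding poly_altdef using slice_poly_section(2)[OF f]
    by (intro sum.mono_neutral_left) (auto simp: coeff_eq_0)
  have step: "coeff (slice_poly f) i * (b$2$2 ^ (m - i) * (b$2$1 + u * b$1$1) ^ i)
      = b$2$2 ^ m * (coeff (slice_poly f) i * ((b$2$1 + u * b$1$1) / b$2$2) ^ i)" if "i \<le> m" for i
  proof -
    have "b$2$2 ^ m = b$2$2 ^ (m - i) * b$2$2 ^ i" using that by (simp flip: power_add)
    thus ?thesis using b0 by (simp add: power_divide)
  qed
  have "(\<Sum>i\<le>m. coeff (slice_poly f) i * (b$2$2 ^ (m - i) * (b$2$1 + u * b$1$1) ^ i))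
      = b$2$2 ^ m * (\<Sum>i\<le>m. coeff (slice_poly f) i * ((b$2$1 + u * b$1$1) / b$2$2) ^ i)"
    unfolding sum_distrib_left by (rule sum.cong[OF refl], rule step) simp
  moreover have "poly [:b$2$1 / b$2$2, b$1$1 / b$2$2:] u = (b$2$1 + u * b$1$1) / b$2$2"
    by (simp add: add_divide_distrib)
  ultimately show "poly (slice_poly (act (H0 w_ab (int m) 0) b f)) u
      = poly (smult (b$2$2 ^ m) (pcompose (slice_poly f) [:b$2$1 / b$2$2, b$1$1 / b$2$2:])) u"
    by (simp only: slice_poly_act[OF two f b] poly_smult poly_pcompose * ) (simp add: poly_sum mult.assoc)
qed

section \<open>The annihilator of the module for odd \<open>\<lambda>\<^sub>1\<close> and \<open>\<lambda>\<^sub>2 = 0\<close>\<close>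

lemma section_of_add: "section_of m (p + q) = section_of m p + section_of m q"
  by (simp add: section_of_def fun_eq_iff sum.distrib distrib_right)

lemma section_of_smult: "section_of m (smult c p) = (\<lambda>g. c * section_of m p g)"
  by (simp add: section_of_def sum_distrib_left mult.assoc)

text \<open>
  In the next two identities \<open>a\<close>, \<open>d\<close>, \<open>e\<close>, \<open>u\<close> are the entries (1,1), (2,2), (3,3), (2,1) of a lower
  triangular matrix and \<open>A\<close>, \<open>D\<close>, \<open>E\<close>, \<open>U\<close> those of a second one, while \<open>x\<close> and \<open>y\<close> are the entries (1,1) and
  (2,1) of a third one. In characteristic two the differences \<open>A\<^sup>2 - 1\<close>, \<open>d\<^sup>2 - 1\<close>, \<open>E\<^sup>2 - 1\<close> and \<open>x\<^sup>2 - 1\<close> generate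
  elements of the Frobenius ideal.
\<close>

lemma square_cocycle_identity:
  fixes a d e u A D E U x y :: "'k::field"
  assumes "(2::'k) = 0" "a * d * e = 1" "A * D * E = 1"
  shows "A * E * U * (x * y) + a * A * (e * E) * (u * A + d * U) * (x * y)
      + a * e * u * (A * x * (U * x + D * y)) + a * e * u * (A * U)
    = (a * e * u * E * x * y) * (A\<^sup>2 - 1) + (a * e * u * A * U) * (x\<^sup>2 - 1)
      + (a * e * u * x * y * A * D) * (E\<^sup>2 - 1)" (is "?l = ?r")
proof -
  have "?l = ?r + 2 * (A * E * U * x * y + a * e * u * A * D * x * y + a * e * u * A * U)
      + (a * d * e - 1) * (A * E * U * x * y) - (A * D * E - 1) * (a * e * u * E * x * y)"
    by (simp add: algebra_simps power2_eq_square)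
  thus ?thesis using assms by simp
qed

lemma nullhomotopy_identity:
  fixes a d e u A U r w l q :: "'k::field"
  assumes "(2::'k) = 0" "a * d * e = 1"
  shows "(a * u * (A\<^sup>2 - 1) + A * U * a\<^sup>2 * e * (d\<^sup>2 - 1)) * r + A * U * e * u\<^sup>2 * l + a * u * q
    = a * e * u * (A * U) * w - (A * U * (a\<^sup>2 * e * r + a * e * u * w + e * u\<^sup>2 * l)
      + a * A * (u * A + d * U) * r + a * u * (q + r))" (is "?l = ?r")
proof -
  have "?l = ?r + 2 * (a * u * A\<^sup>2 * r + A * U * e * u\<^sup>2 * l + a * u * q + A * U * a * d * r)
      + (a * d * e - 1) * (A * U * a * d * r)"
    by (simp add: algebra_simps power2_eq_square)
  thus ?thesis using assms by simp
qed

context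
  fixes m :: nat
  assumes char: "CHAR('k::alg_closed_field) = 2" and two: "(2::'k) = 0"
begin

abbreviation Sec :: "('k, 'k mat3 \<Rightarrow> 'k) rmod" where "Sec \<equiv> H0 w_ab (int m) 0"
abbreviation EndSec :: "('k, ('k mat3 \<Rightarrow> 'k) \<Rightarrow> 'k mat3 \<Rightarrow> 'k) rmod" where "EndSec \<equiv> end_mod Sec"

text \<open>Instances for the weight \<open>(m, 0)\<close>, which cannot be inferred from the conclusions of the rules.\<close>

lemmas slice_poly_Sec = slice_poly_section[where m = m]
lemmas section_of_Sec = section_of_car[of m]
lemmas Sec_eqI = section_eqI[OF two, of _ m]
lemmas slice_poly_Sec_add = slice_poly_add[of _ m]
lemmas slice_poly_Sec_cmult = slice_poly_cmult[of _ m]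
lemmas act_car = H0_act_car[of _ w_ab "int m" 0]
lemmas m_add = H0_add[of _ w_ab "int m" 0]
lemmas m_cmult = H0_cmult[of _ w_ab "int m" 0]
lemmas m_act_inverse = H0_act_inverse[of _ w_ab "int m" 0]
lemmas m_act_mult = H0_act_mult[of _ _ w_ab "int m" 0]
lemmas m_act_add = H0_act_add[of w_ab "int m" 0]
lemmas m_act_cmult = H0_act_cmult[of w_ab "int m" 0]
lemmas E_car_iff = End_car_iff[of _ w_ab "int m" 0]
lemmas E_apply = End_apply[of _ w_ab "int m" 0]
lemmas E_off = End_off[of _ w_ab "int m" 0]
lemmas E_scl = End_scl[of w_ab "int m" 0]
lemmas E_act = End_act[of _ w_ab "int m" 0]
lemmas E_act_car = End_act_car[of _ w_ab "int m" 0]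
lemmas E_comp = End_comp[of _ w_ab "int m" 0]
lemmas E_closed = End_zero[of w_ab "int m" 0]
  End_add[of _ w_ab "int m" 0]
  End_scl_car[of _ w_ab "int m" 0]
lemmas E_sum = End_sum[of _ w_ab "int m" 0]

text \<open>The value off the carrier is the one required of elements of the endomorphism module.\<close>

definition poly_op :: "('k poly \<Rightarrow> 'k poly) \<Rightarrow> ('k mat3 \<Rightarrow> 'k) \<Rightarrow> ('k mat3 \<Rightarrow> 'k)" where
  "poly_op T f = (if f \<in> car Sec then section_of m (T (slice_poly f)) else 0)"

lemma poly_op_car:
  assumes "\<And>p q. T (p + q) = T p + T q" "\<And>c p. T (smult c p) = smult c (T p)"
  shows "poly_op T \<in> car EndSec"
  unfolding E_car_iff poly_op_def
  by (simp add: section_of_Sec m_add m_cmult slice_poly_Sec_add slice_poly_Sec_cmult assms section_of_add section_of_smult)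

lemma slice_poly_poly_op:
  "f \<in> car Sec \<Longrightarrow> degree (T (slice_poly f)) \<le> m \<Longrightarrow> slice_poly (poly_op T f) = T (slice_poly f)"
  by (simp add: poly_op_def slice_poly_section_of[OF two])

lemma tuple_polys_Suc: "F \<in> tuple_polys 1 \<Longrightarrow> F \<in> tuple_polys (Suc n)"
  by (rule tuple_polys_pullback[of F 1 "\<lambda>g. g"]) (auto intro: tuple_polys_coord)

section \<open>The conjugation action on endomorphisms is regular\<close>

lemma coeff_act:
  assumes "f \<in> car Sec" "b \<in> borel3"
  shows "coeff (slice_poly (act Sec b f)) r
    = (\<Sum>i\<le>m. coeff (slice_poly f) i * (b$2$2 ^ (m - i) * coeff ([:b$2$1, b$1$1:] ^ i) r))"
  using assms by (simp add: slice_poly_act[OF two] coeff_sum mult.assoc)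

lemma sections_expand_M:
  "f \<in> car Sec \<Longrightarrow> f = (\<lambda>g. \<Sum>i\<le>m. coeff (slice_poly f) i * monomial_section m i g)"
  by (rule sections_expand[OF two])

lemma monomial_section_M: "i \<le> m \<Longrightarrow> monomial_section m i \<in> car Sec"
  by (rule monomial_section_car)

lemma coeff_End:
  assumes "\<phi> \<in> car EndSec" "f \<in> car Sec"
  shows "coeff (slice_poly (\<phi> f)) l
    = (\<Sum>i\<le>m. coeff (slice_poly f) i * coeff (slice_poly (\<phi> (monomial_section m i))) l)"
proof -
  have "slice_poly (\<phi> f) = (\<Sum>i\<le>m. smult (coeff (slice_poly f) i) (slice_poly (\<phi> (monomial_section m i))))"
  proof (rule slice_poly_eq)
    fix u
    have "\<phi> f = \<phi> (\<lambda>g. \<Sum>i\<le>m. coeff (slice_poly f) i * monomial_section m i g)"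
      by (rule arg_cong[OF sections_expand_M[OF assms(2)]])
    also have "\<dots> = (\<lambda>g. \<Sum>i\<le>m. coeff (slice_poly f) i * \<phi> (monomial_section m i) g)"
      using E_sum[OF assms(1), of "{..m}" "monomial_section m"] by (simp add: monomial_section_M)
    finally have "\<phi> f (slice u 0) = (\<Sum>i\<le>m. coeff (slice_poly f) i * \<phi> (monomial_section m i) (slice u 0))"
      by simp
    also have "\<dots> = (\<Sum>i\<le>m. coeff (slice_poly f) i * poly (slice_poly (\<phi> (monomial_section m i))) u)"
      by (intro sum.cong refl) (simp add: slice_poly_Sec(1) E_apply(1)[OF assms(1)] monomial_section_M)
    finally show "\<phi> f (slice u 0)
        = poly (\<Sum>i\<le>m. smult (coeff (slice_poly f) i) (slice_poly (\<phi> (monomial_section m i)))) u"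
      by (simp add: poly_sum)
  qed
  thus ?thesis by (simp add: coeff_sum)
qed

lemma coeff_linear_power_tuple_polys:
  assumes "A \<in> tuple_polys n" "B \<in> tuple_polys n"
  shows "(\<lambda>g. coeff ([:A g, B g:] ^ i) r) \<in> tuple_polys n"
proof (induction i arbitrary: r)
  case 0
  show ?case by (cases r) (auto intro: tuple_polys_const)
next
  case (Suc i)
  have "coeff ([:A g, B g:] ^ Suc i) r
      = A g * coeff ([:A g, B g:] ^ i) r + (case r of 0 \<Rightarrow> 0 | Suc r' \<Rightarrow> B g * coeff ([:A g, B g:] ^ i) r')" for g
    by (simp add: mult_pCons_left coeff_pCons split: nat.split)
  moreover have "(\<lambda>g. case r of 0 \<Rightarrow> 0 | Suc r' \<Rightarrow> B g * coeff ([:A g, B g:] ^ i) r') \<in> tuple_polys n"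
    using Suc assms by (cases r) (auto intro: tuple_polys_intros)
  ultimately show ?case
    using Suc assms by (simp only:) (intro tuple_polys_intros)
qed

text \<open>Elementary matrices with respect to the basis of the monomial sections.\<close>

definition matrix_unit :: "nat \<Rightarrow> nat \<Rightarrow> ('k mat3 \<Rightarrow> 'k) \<Rightarrow> ('k mat3 \<Rightarrow> 'k)" where
  "matrix_unit r i = poly_op (\<lambda>p. monom (coeff p i) r)"

lemma matrix_unit_car: "matrix_unit r i \<in> car EndSec"
  unfolding matrix_unit_def by (rule poly_op_car) (simp_all add: add_monom smult_monom)

lemma matrix_unit_apply:
  assumes "r \<le> m" "f \<in> car Sec"
  shows "matrix_unit r i f = (\<lambda>g. coeff (slice_poly f) i * monomial_section m r g)"
  using assms
  by (simp add: matrix_unit_def poly_op_def section_of_def if_distrib[of "\<lambda>c. c * _"] sum.delta' cong: if_cong)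

lemma tensors_scl:
  assumes "F \<in> tensors A EndSec" and "\<And>a. a \<in> A \<Longrightarrow> (\<lambda>g. b g * a g) \<in> A'"
  shows "(\<lambda>g. scl EndSec (b g) (F g)) \<in> tensors A' EndSec"
  using assms(1)
proof induction
  case zero
  have z: "scl EndSec c 0 = 0" for c by (auto simp: E_scl fun_eq_iff)
  show ?case unfolding z by (rule tensors.zero)
next
  case (add F a v)
  have eq: "scl EndSec (b g) (F g + scl EndSec (a g) v) = scl EndSec (b g) (F g) + scl EndSec (b g * a g) v" for g
    by (auto simp: E_scl fun_eq_iff distrib_left mult.assoc)
  show ?case unfolding eq by (rule tensors.add[OF add.IH assms(2)[OF add.hyps(2)] add.hyps(3)])
qed

lemma tensors_comp:
  assumes "F \<in> tensors A EndSec" and \<phi>: "\<phi> \<in> car EndSec"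
  shows "(\<lambda>g. \<phi> \<circ> F g) \<in> tensors A EndSec"
  using assms(1)
proof induction
  case zero
  have z: "\<phi> \<circ> 0 = 0" using End_apply_0[OF \<phi>] by (auto simp: fun_eq_iff)
  show ?case unfolding z by (rule tensors.zero)
next
  case (add F a v)
  have F: "F g \<in> car EndSec" for g by (rule tensors_car[OF add.hyps(1)]) (auto intro: E_closed)
  have eq: "\<phi> \<circ> (F g + scl EndSec (a g) v) = (\<phi> \<circ> F g) + scl EndSec (a g) (\<phi> \<circ> v)" for g
  proof
    fix u
    show "(\<phi> \<circ> (F g + scl EndSec (a g) v)) u = ((\<phi> \<circ> F g) + scl EndSec (a g) (\<phi> \<circ> v)) u"
    proof (cases "u \<in> car Sec")
      case True
      have "scl EndSec (a g) v u = (\<lambda>y. a g * v u y)" using True by (simp add: E_scl)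
      moreover have "(\<lambda>y. a g * v u y) \<in> car Sec" "v u \<in> car Sec" "F g u \<in> car Sec"
        using True E_apply(1) F add.hyps(3) m_cmult by blast+
      ultimately have "\<phi> (F g u + scl EndSec (a g) v u) = \<phi> (F g u) + (\<lambda>y. a g * \<phi> (v u) y)"
        using E_apply(2,3)[OF \<phi>] by simp
      thus ?thesis using True by (simp add: E_scl)
    next
      case False
      thus ?thesis using E_off[OF F] E_off[OF add.hyps(3)] End_apply_0[OF \<phi>]
        by (simp add: E_scl)
    qed
  qed
  show ?case unfolding eq by (rule tensors.add[OF add.IH add.hyps(2) E_comp[OF \<phi> add.hyps(3)]])
qed

text \<open>
  As the module is finite-dimensional, conjugation can be expanded in matrix coefficients. Those of \<open>b\<close>
  are polynomial in its entries, and so are those of its inverse because \<open>b\<close> has determinant one.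
\<close>

lemma act_End_regular:
  assumes \<phi>: "\<phi> \<in> car EndSec"
  shows "\<exists>R\<in>tensors (tuple_polys 1) EndSec. \<forall>g\<in>points borel3 1. act EndSec (g 0) \<phi> = R g"
proof -
  define a where "a b i r = b$2$2 ^ (m - i) * coeff ([:b$2$1, b$1$1:] ^ i) r" for b :: "'k mat3" and i r :: nat
  have a: "(\<lambda>g. a (g 0) i r) \<in> tuple_polys 1" for i r
    unfolding a_def
    by (intro tuple_polys_mult tuple_polys_power tuple_polys_coord coeff_linear_power_tuple_polys) auto
  have a': "(\<lambda>g. a (binv (g 0)) i r) \<in> tuple_polys 1" for i r
    unfolding a_def binv_def vector_3
    by (intro tuple_polys_intros coeff_linear_power_tuple_polys) auto
  define C where "C k l = coeff (slice_poly (\<phi> (monomial_section m k))) l" for k l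
  define R where "R g = (\<Sum>r\<le>m. \<Sum>l\<le>m. \<Sum>k\<le>m. \<Sum>i\<le>m.
      scl EndSec (a (g 0) l r * C k l * a (binv (g 0)) i k) (matrix_unit r i))" for g :: "nat \<Rightarrow> 'k mat3"
  have "R \<in> tensors (tuple_polys 1) EndSec"
    unfolding R_def[abs_def]
    by (intro tensors_sum tensors_single tuple_polys_mult a a' tuple_polys_const matrix_unit_car)
  moreover have "act EndSec b \<phi> = R (\<lambda>_. b)" if b: "b \<in> borel3" for b
  proof
    fix f
    show "act EndSec b \<phi> f = R (\<lambda>_. b) f"
    proof (cases "f \<in> car Sec")
      case True
      let ?f = "act Sec (binv b) f"
      have f: "?f \<in> car Sec" using True b by (simp add: act_car binv_borel3)
      have h: "act Sec b (\<phi> ?f) \<in> car Sec" by (rule act_car[OF E_apply(1)[OF \<phi> f] b])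
      have co: "coeff (slice_poly (act Sec b (\<phi> ?f))) r
          = (\<Sum>l\<le>m. \<Sum>k\<le>m. \<Sum>i\<le>m. a b l r * C k l * a (binv b) i k * coeff (slice_poly f) i)" for r
        by (simp add: coeff_act[OF E_apply(1)[OF \<phi> f] b, folded a_def] coeff_End[OF \<phi> f, folded C_def]
            coeff_act[OF True binv_borel3[OF b], folded a_def] sum_distrib_left sum_distrib_right mult_ac)
      show ?thesis
      proof
        fix y
        have "act EndSec b \<phi> f y = act Sec b (\<phi> ?f) y" using True by (simp add: E_act[OF b])
        also have "\<dots> = (\<Sum>r\<le>m. coeff (slice_poly (act Sec b (\<phi> ?f))) r * monomial_section m r y)"
          by (subst sections_expand_M[OF h]) simp
        also have "\<dots> = (\<Sum>r\<le>m. \<Sum>l\<le>m. \<Sum>k\<le>m. \<Sum>i\<le>m.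
            (a b l r * C k l * a (binv b) i k) * (coeff (slice_poly f) i * monomial_section m r y))"
          by (simp add: co sum_distrib_right mult.assoc)
        also have "\<dots> = R (\<lambda>_. b) f y"
          using True by (simp add: R_def End_sum_apply E_scl matrix_unit_apply)
        finally show "act EndSec b \<phi> f y = R (\<lambda>_. b) f y" .
      qed
    next
      case False
      have "R (\<lambda>_. b) f y = 0" for y using False by (simp add: R_def End_sum_apply E_scl)
      thus ?thesis using False by (auto simp: E_act[OF b])
    qed
  qed
  hence "act EndSec (g 0) \<phi> = R g" if "g \<in> points borel3 1" for g
    using that by (simp add: points_def R_def)
  ultimately show ?thesis by blast
qed

lemma E_act_add:
  assumes "b \<in> borel3" "\<phi> \<in> car EndSec" "\<psi> \<in> car EndSec"
  shows "act EndSec b (\<phi> + \<psi>) = act EndSec b \<phi> + act EndSec b \<psi>"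
  using assms by (auto simp: E_act fun_eq_iff m_act_add)

lemma E_act_comp:
  assumes b: "b \<in> borel3" and "\<phi> \<in> car EndSec" "\<psi> \<in> car EndSec"
  shows "act EndSec b (\<phi> \<circ> \<psi>) = act EndSec b \<phi> \<circ> act EndSec b \<psi>"
proof
  fix v show "act EndSec b (\<phi> \<circ> \<psi>) v = (act EndSec b \<phi> \<circ> act EndSec b \<psi>) v"
  proof (cases "v \<in> car Sec")
    case True
    have "\<psi> (act Sec (binv b) v) \<in> car Sec"
      using True b by (intro E_apply(1)[OF assms(3)] act_car binv_borel3)
    hence "act Sec b (\<psi> (act Sec (binv b) v)) \<in> car Sec" using b by (rule act_car)
    thus ?thesis using True by (simp add: E_act[OF b] m_act_inverse[OF b])
  next
    case False
    have "act EndSec b \<phi> 0 = 0" by (rule End_apply_0[OF E_act_car[OF assms(2) b]])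
    moreover have "act EndSec b (\<phi> \<circ> \<psi>) v = 0" "act EndSec b \<psi> v = 0" using False by (simp_all add: E_act[OF b])
    ultimately show ?thesis by (simp only: comp_apply)
  qed
qed

lemma E_act_mult:
  assumes "b \<in> borel3" "b' \<in> borel3" "\<phi> \<in> car EndSec"
  shows "act EndSec (b ** b') \<phi> = act EndSec b (act EndSec b' \<phi>)"
  using assms
  by (auto simp: E_act borel3_mult binv_mult m_act_mult binv_borel3 act_car fun_eq_iff)

lemma E_act_scl:
  assumes "b \<in> borel3" "\<phi> \<in> car EndSec"
  shows "act EndSec b (scl EndSec c \<phi>) = scl EndSec c (act EndSec b \<phi>)"
  using assms by (auto simp: E_act E_scl m_act_cmult act_car binv_borel3 fun_eq_iff)

lemma tensors_act:
  assumes F: "F \<in> tensors A EndSec"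
    and A: "\<And>a p. a \<in> A \<Longrightarrow> p \<in> tuple_polys 1 \<Longrightarrow> (\<lambda>g. a (\<lambda>i. g (Suc i)) * p g) \<in> A'"
  shows "\<exists>G\<in>tensors A' EndSec. \<forall>g\<in>points borel3 1. act EndSec (g 0) (F (\<lambda>i. g (Suc i))) = G g"
proof (rule tensors_map[where T = "\<lambda>g. act EndSec (g 0)"])
  show "(\<lambda>g. F (\<lambda>i. g (Suc i))) \<in> tensors {\<lambda>g. a (\<lambda>i. g (Suc i)) | a. a \<in> A} EndSec"
    by (rule tensors_pullback[OF F]) auto
  fix a v assume "a \<in> {\<lambda>g :: nat \<Rightarrow> 'k mat3. a (\<lambda>i. g (Suc i)) | a. a \<in> A}" and v: "v \<in> car EndSec"
  then obtain a' where a': "a = (\<lambda>g. a' (\<lambda>i. g (Suc i)))" "a' \<in> A" by auto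
  obtain R where R: "R \<in> tensors (tuple_polys 1) EndSec" "\<forall>g\<in>points borel3 1. act EndSec (g 0) v = R g"
    using act_End_regular[OF v] by blast
  have "(\<lambda>g. scl EndSec (a g) (R g)) \<in> tensors A' EndSec"
    by (rule tensors_scl[OF R(1)]) (simp add: a' A)
  moreover have "act EndSec (g 0) (scl EndSec (a g) v) = scl EndSec (a g) (R g)" if "g \<in> points borel3 1" for g
    using that R(2) v by (simp add: E_act_scl points_def)
  ultimately show "\<exists>G\<in>tensors A' EndSec. \<forall>g\<in>points borel3 1. act EndSec (g 0) (scl EndSec (a g) v) = G g"
    by (intro bexI[of _ "\<lambda>g. scl EndSec (a g) (R g)"] ballI)
qed (auto intro: E_closed E_act_add simp: points_def)

section \<open>A nullhomotopy\<close>

text \<open>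
  In the coordinate \<open>u = q\<^sub>1 / q\<^sub>2\<close> of the slice the derivation \<open>q\<^sub>1 \<partial>/\<partial>q\<^sub>2\<close> of homogeneous polynomials of degree
  \<open>m\<close> is \<open>p \<mapsto> m u p - u\<^sup>2 p'\<close>. This is \<open>raise\<close> for odd \<open>m\<close>, while \<open>lower\<close> is \<open>q\<^sub>2 \<partial>/\<partial>q\<^sub>1\<close>.
\<close>

definition raise :: "('k mat3 \<Rightarrow> 'k) \<Rightarrow> ('k mat3 \<Rightarrow> 'k)" where
  "raise = poly_op (\<lambda>p. monom 1 1 * p + monom 1 2 * pderiv p)"

definition lower :: "('k mat3 \<Rightarrow> 'k) \<Rightarrow> ('k mat3 \<Rightarrow> 'k)" where
  "lower = poly_op pderiv"

lemma raise_car: "raise \<in> car EndSec"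
  unfolding raise_def by (rule poly_op_car) (simp_all add: pderiv_add pderiv_smult algebra_simps smult_add_right)

lemma lower_car: "lower \<in> car EndSec"
  unfolding lower_def by (rule poly_op_car) (simp_all add: pderiv_add pderiv_smult)

lemma slice_poly_raise:
  assumes "odd m" "f \<in> car Sec"
  shows "slice_poly (raise f) = monom 1 1 * slice_poly f + monom 1 2 * pderiv (slice_poly f)"
  unfolding raise_def
proof (rule slice_poly_poly_op[OF assms(2)], rule degree_le, intro allI impI)
  fix k assume k: "m < k"
  let ?p = "slice_poly f"
  have d: "coeff ?p j = 0" if "j > m" for j using slice_poly_Sec(2)[OF assms(2)] that by (simp add: coeff_eq_0)
  have "of_nat m = (1::'k)" using assms(1) two by (auto elim!: oddE)
  hence *: "coeff ?p m + of_nat m * coeff ?p m = 0" by (simp add: char2_add_self[OF two])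
  obtain k' where k': "k = Suc k'" using k by (cases k) auto
  show "coeff (monom 1 1 * ?p + monom 1 2 * pderiv ?p) k = 0"
  proof (cases "k' = m")
    case True
    have "m = Suc (m - 1)" using assms(1) by (cases m) auto
    hence "coeff (monom 1 1 * ?p + monom 1 2 * pderiv ?p) k = coeff ?p m + of_nat m * coeff ?p m"
      using True k' by (cases m) (auto simp: coeff_monom_mult coeff_pderiv)
    thus ?thesis using * by simp
  next
    case False
    thus ?thesis using k k' d by (cases k') (auto simp: coeff_monom_mult coeff_pderiv)
  qed
qed

lemma slice_poly_lower:
  assumes "f \<in> car Sec" shows "slice_poly (lower f) = pderiv (slice_poly f)"
  unfolding lower_def
proof (rule slice_poly_poly_op[OF assms], rule degree_le, intro allI impI)
  fix k assume "m < k"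
  thus "coeff (pderiv (slice_poly f)) k = 0"
    using slice_poly_Sec(2)[OF assms] by (simp add: coeff_pderiv coeff_eq_0)
qed

text \<open>
  The operator \<open>raise\<close> is the action of the root vector \<open>E\<^sub>1\<^sub>2\<close> of \<open>P\<^sub>\<alpha>\<close>. Conjugation with \<open>b\<close> carries
  it into a combination of \<open>E\<^sub>1\<^sub>2\<close>, of the coroot \<open>[E\<^sub>1\<^sub>2, E\<^sub>2\<^sub>1]\<close>, which acts as \<open>m = 1\<close>, of \<open>E\<^sub>2\<^sub>1\<close>, with a
  coefficient that vanishes on the Frobenius kernel, and of \<open>E\<^sub>3\<^sub>1\<close> and \<open>E\<^sub>3\<^sub>2\<close>, which act as zero.
\<close>

lemma act_raise:
  assumes m: "odd m" and b: "b \<in> borel3" and f: "f \<in> car Sec"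
  shows "act EndSec b raise f = (\<lambda>g. (b$1$1)\<^sup>2 * b$3$3 * raise f g + b$1$1 * b$3$3 * b$2$1 * f g
    + b$3$3 * (b$2$1)\<^sup>2 * lower f g)" (is "_ = ?rhs")
proof -
  let ?h = "act Sec (binv b) f"
  have h: "?h \<in> car Sec" using f b by (simp add: act_car binv_borel3)
  have fh: "f = act Sec b ?h" using b by (simp add: m_act_inverse)
  have rh: "raise ?h \<in> car Sec" using E_apply(1)[OF raise_car h] .
  have rl: "raise f \<in> car Sec" "lower f \<in> car Sec" using E_apply(1) raise_car lower_car f by blast+
  have rhs: "?rhs \<in> car Sec"
  proof -
    have "(\<lambda>g. (b$1$1)\<^sup>2 * b$3$3 * raise f g) + (\<lambda>g. b$1$1 * b$3$3 * b$2$1 * f g)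
        + (\<lambda>g. b$3$3 * (b$2$1)\<^sup>2 * lower f g) \<in> car Sec"
      by (intro m_add m_cmult rl f)
    thus ?thesis by (simp add: plus_fun_def)
  qed
  define p where "p = slice_poly ?h"
  define L where "L = [:b$2$1 / b$2$2, b$1$1 / b$2$2:]"
  have sf: "slice_poly f = smult (b$2$2 ^ m) (pcompose p L)"
    by (subst fh) (simp only: slice_poly_act_pcompose[OF two h b] p_def L_def)
  have b0: "b$1$1 * b$2$2 * b$3$3 = 1" using b by (simp add: borel3_iff)
  hence nz: "b$1$1 \<noteq> 0" "b$2$2 \<noteq> 0" by auto
  hence b3: "b$3$3 = 1 / (b$1$1 * b$2$2)" using b0 by (simp add: field_simps)
  have "act Sec b (raise ?h) = ?rhs"
  proof (rule Sec_eqI[OF act_car[OF rh b] rhs])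
    have "slice_poly ?rhs = slice_poly (act Sec b (raise ?h))"
    proof (rule slice_poly_eq)
      fix u
      let ?z = "poly L u"
      let ?P = "poly p ?z" and ?D = "poly (pderiv p) ?z"
      have "poly (pderiv (pcompose p L)) u = ?D * (b$1$1 / b$2$2)"
        by (simp add: pderiv_pcompose poly_pcompose L_def pderiv_pCons)
      hence "?rhs (slice u 0) = b$2$2 ^ m * ((b$1$1)\<^sup>2 * b$3$3 * (u * ?P + u\<^sup>2 * (?D * (b$1$1 / b$2$2)))
          + b$1$1 * b$3$3 * b$2$1 * ?P + b$3$3 * (b$2$1)\<^sup>2 * (?D * (b$1$1 / b$2$2)))"
        by (simp add: slice_poly_Sec(1) f rl slice_poly_raise[OF m f] slice_poly_lower[OF f])
          (simp add: sf pderiv_smult poly_pcompose poly_monom algebra_simps)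
      also have "\<dots> = b$2$2 ^ m * (?z * ?P + ?z\<^sup>2 * ?D)"
      proof -
        have "(b$1$1)\<^sup>2 * b$3$3 * (u * P + u\<^sup>2 * (D * (b$1$1 / b$2$2)))
          + b$1$1 * b$3$3 * b$2$1 * P + b$3$3 * (b$2$1)\<^sup>2 * (D * (b$1$1 / b$2$2)) = z * P + z\<^sup>2 * D"
          if "z = (b$2$1 + u * b$1$1) / b$2$2" for z P D
          unfolding that power_divide char2_square_add[OF two] power_mult_distrib b3
          using nz by (simp add: field_simps power2_eq_square)
        moreover have "?z = (b$2$1 + u * b$1$1) / b$2$2" by (simp add: L_def add_divide_distrib)
        ultimately show ?thesis by (intro arg_cong[where f = "\<lambda>c. b$2$2 ^ m * c"]) blast
      qed
      also have "\<dots> = poly (slice_poly (act Sec b (raise ?h))) u"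
        by (simp add: slice_poly_act_pcompose[OF two rh b] slice_poly_raise[OF m h]
            poly_pcompose poly_monom flip: p_def L_def)
      finally show "?rhs (slice u 0) = poly (slice_poly (act Sec b (raise ?h))) u" .
    qed
    thus "slice_poly (act Sec b (raise ?h)) = slice_poly ?rhs" by simp
  qed
  thus ?thesis using f by (simp add: E_act[OF b])
qed


text \<open>
  On \<open>B\<^sub>1\<close> the function \<open>b\<^sub>1\<^sub>1 b\<^sub>2\<^sub>1\<close> is a cocycle with values in the character \<open>b\<^sub>3\<^sub>3\<close>. Its square is the class
  below, with trivial coefficients as \<open>b\<^sub>3\<^sub>3\<^sup>2 = 1\<close> on \<open>B\<^sub>1\<close>.
\<close>

definition alpha_class :: "(nat \<Rightarrow> 'k mat3) \<Rightarrow> 'k" where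
  "alpha_class g = g 0 $1$1 * g 0 $3$3 * g 0 $2$1 * (g 1 $1$1 * g 1 $2$1)"

lemma alpha_class_cocycle: "alpha_class \<in> cocycles borel3 2 triv_mod"
proof -
  have "alpha_class \<in> tuple_polys 2"
    unfolding alpha_class_def[abs_def] by (intro tuple_polys_intros) auto
  hence "alpha_class \<in> cochains borel3 2 triv_mod" by (auto simp: cochains_triv)
  moreover
  let ?F = "\<lambda>g :: nat \<Rightarrow> 'k mat3.
      (g 0 $1$1 * g 0 $3$3 * g 0 $2$1 * g 1 $3$3 * g 2 $1$1 * g 2 $2$1) * ((g 1 $1$1) ^ CHAR('k) - (mat 1 :: 'k mat3) $ 1 $ 1)
    + (g 0 $1$1 * g 0 $3$3 * g 0 $2$1 * g 1 $1$1 * g 1 $2$1) * ((g 2 $1$1) ^ CHAR('k) - (mat 1 :: 'k mat3) $ 1 $ 1)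
    + (g 0 $1$1 * g 0 $3$3 * g 0 $2$1 * g 2 $1$1 * g 2 $2$1 * g 1 $1$1 * g 1 $2$2) * ((g 1 $3$3) ^ CHAR('k) - (mat 1 :: 'k mat3) $ 3 $ 3)"
  have "?F \<in> frob_ideal 3"
    by (intro frob_ideal_add frob_ideal_mult frob_ideal_gen tuple_polys_intros) auto
  moreover have "cobound triv_mod 2 alpha_class g = ?F g" if "g \<in> points borel3 3" for g
  proof -
    have b: "g i \<in> borel3" if "i < 3" for i using \<open>g \<in> points borel3 3\<close> that by (auto simp: points_def)
    have b0: "g 0 $1$2 = 0" "g 0 $1$3 = 0" "g 0 $2$3 = 0" "g 0 $1$1 * g 0 $2$2 * g 0 $3$3 = 1"
      and b1: "g 1 $1$2 = 0" "g 1 $1$3 = 0" "g 1 $2$3 = 0" "g 1 $1$1 * g 1 $2$2 * g 1 $3$3 = 1"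
      and b2: "g 2 $1$2 = 0" "g 2 $1$3 = 0" "g 2 $2$3 = 0"
      using b[of 0] b[of 1] b[of 2] by (simp_all add: borel3_iff)
    have f: "gface 0 g 0 = g 0 ** g 1" "gface 0 g 1 = g 2" "gface 1 g 0 = g 0" "gface 1 g 1 = g 1 ** g 2"
      by (simp_all add: gface_def numeral_2_eq_2)
    have "cobound triv_mod 2 alpha_class g = alpha_class (\<lambda>i. g (Suc i)) + alpha_class (gface 0 g)
        + alpha_class (gface 1 g) + alpha_class g"
      by (simp add: cobound_triv[OF two] numeral_2_eq_2)
    also have "\<dots> = g 1 $1$1 * g 1 $3$3 * g 1 $2$1 * (g 2 $1$1 * g 2 $2$1)
      + g 0 $1$1 * g 1 $1$1 * (g 0 $3$3 * g 1 $3$3) * (g 0 $2$1 * g 1 $1$1 + g 0 $2$2 * g 1 $2$1) * (g 2 $1$1 * g 2 $2$1)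
      + g 0 $1$1 * g 0 $3$3 * g 0 $2$1 * (g 1 $1$1 * g 2 $1$1 * (g 1 $2$1 * g 2 $1$1 + g 1 $2$2 * g 2 $2$1))
      + g 0 $1$1 * g 0 $3$3 * g 0 $2$1 * (g 1 $1$1 * g 1 $2$1)"
      unfolding alpha_class_def f using b0(1-3) b1(1-3) b2
      by (simp add: matrix_matrix_mult_def sum_3 numeral_2_eq_2)
    also have "\<dots> = ?F g"
      using square_cocycle_identity[OF two b0(4) b1(4)] by (simp add: char mat_def)
    finally show ?thesis .
  qed
  ultimately show ?thesis
    by (auto simp: cocycles_def null_cochains_triv numeral_2_eq_2 numeral_3_eq_3)
qed

lemma topcoeff_alpha_class:
  assumes "x \<in> N1_u"
  shows "topcoeff 2 (\<lambda>s. alpha_class (\<lambda>i. expmat x (s i))) = (x$2$1)\<^sup>2"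
proof -
  have "topcoeff (Suc 1) (\<lambda>s. alpha_class (\<lambda>i. expmat x (s i))) = topcoeff 1 (\<lambda>s. (x$2$1)\<^sup>2 * s 0)"
    by (rule topcoeff_expand[of _ "\<lambda>_. 0" _ "\<lambda>_. 0" 0])
      (use assms in \<open>auto simp: alpha_class_def expmat_entry mat_def N1_u_iff power2_eq_square pfun_const\<close>)
  also have "\<dots> = topcoeff (Suc 0) (\<lambda>s. (x$2$1)\<^sup>2 * s 0)" by simp
  also have "\<dots> = topcoeff 0 (\<lambda>_. (x$2$1)\<^sup>2)"
    by (rule topcoeff_expand[of _ "\<lambda>_. 0" _ "\<lambda>_. 0" 0]) (auto simp: pfun_const)
  finally show ?thesis by (simp add: numeral_2_eq_2)
qed

text \<open>
  By the formula for the conjugates of \<open>raise\<close>, the cochain \<open>b \<mapsto> b\<^sub>1\<^sub>1 b\<^sub>2\<^sub>1 raise\<close> has the coboundary \<open>c \<otimes> id\<close>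
  modulo null cochains, where \<open>c\<close> is the class above. Its product with a cocycle \<open>d\<close> is the cochain \<open>e\<close>
  below, and \<open>c \<union> d\<close> is the coboundary of \<open>e\<close> modulo null cochains.
\<close>

lemma alpha_class_annihilates:
  assumes m: "odd m"
  shows "alpha_class \<in> ext_annihilator borel3 2 Sec"
proof -
  have "cup EndSec 2 alpha_class d \<in> coboundaries borel3 (2 + j) EndSec" if d: "d \<in> cocycles borel3 j EndSec" for j d
  proof -
    obtain D where D: "D \<in> tensors (tuple_polys j) EndSec" "\<forall>g\<in>points borel3 j. d g = D g"
      using d by (auto simp: cocycles_def cochains_def)
    obtain K where K: "K \<in> tensors (frob_ideal (Suc j)) EndSec" "\<forall>g\<in>points borel3 (Suc j). cobound EndSec j d g = K g"
      using d by (auto simp: cocycles_def null_cochains_def)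
    have dE: "d g \<in> car EndSec" if "g \<in> points borel3 j" for g
    proof -
      have "D g \<in> car EndSec" by (rule tensors_car[OF D(1)]) (auto intro: E_closed)
      thus ?thesis using that D by simp
    qed
    have KE: "K g \<in> car EndSec" for g
      by (rule tensors_car[OF K(1)]) (auto intro: E_closed)
    define sh where "sh g = (\<lambda>i. g (Suc i))" for g :: "nat \<Rightarrow> 'k mat3"
    have sh: "sh g \<in> points borel3 k" if "g \<in> points borel3 (Suc k)" for g k
      using that by (auto simp: points_def sh_def)
    have pts1: "g \<in> points borel3 1" if "g \<in> points borel3 (Suc k)" for g k
      using that by (auto simp: points_def)
    \<comment> \<open>The maps \<open>U\<close>, \<open>W\<close> and \<open>V\<close> below represent the action of one group element on \<open>d\<close>, that of a product of
      two group elements on \<open>d\<close>, and that of one group element on the coboundary of \<open>d\<close>.\<close>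
    have tp: "(\<lambda>g. a (sh g) * p g) \<in> tuple_polys (Suc k)" if "a \<in> tuple_polys k" "p \<in> tuple_polys 1" for a p k
      using tuple_polys_mult[OF tuple_polys_shift[where k = 1, OF that(1)]] tuple_polys_Suc[OF that(2), of k]
      by (simp add: sh_def)
    have fp: "(\<lambda>g. a (sh g) * p g) \<in> frob_ideal (Suc k)" if "a \<in> frob_ideal k" "p \<in> tuple_polys 1" for a p k
      using frob_ideal_mult_right[OF frob_ideal_shift[OF that(1)] tuple_polys_Suc[OF that(2)]] by (simp add: sh_def)
    obtain U where U: "U \<in> tensors (tuple_polys (Suc j)) EndSec" "\<forall>g\<in>points borel3 1. act EndSec (g 0) (D (sh g)) = U g"
      using tensors_act[OF D(1), folded sh_def, OF tp] by blast
    obtain W where W: "W \<in> tensors (tuple_polys (Suc (Suc j))) EndSec" "\<forall>g\<in>points borel3 1. act EndSec (g 0) (U (sh g)) = W g"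
      using tensors_act[OF U(1), folded sh_def, OF tp] by blast
    obtain V where V: "V \<in> tensors (frob_ideal (Suc (Suc j))) EndSec" "\<forall>g\<in>points borel3 1. act EndSec (g 0) (K (sh g)) = V g"
      using tensors_act[OF K(1), folded sh_def, OF fp] by blast
    define \<eta> where "\<eta> b = b$1$1 * b$2$1" for b :: "'k mat3"
    define e where "e g = scl EndSec (\<eta> (g 0)) (raise \<circ> act EndSec (g 0) (d (sh g)))" for g
    have "e g = scl EndSec (\<eta> (g 0)) (raise \<circ> U g)" if "g \<in> points borel3 (Suc j)" for g
      using U(2) D(2) pts1[OF that] sh[OF that] by (simp add: e_def)
    moreover have "(\<lambda>g. scl EndSec (\<eta> (g 0)) (raise \<circ> U g)) \<in> tensors (tuple_polys (Suc j)) EndSec"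
      by (rule tensors_scl[OF tensors_comp[OF U(1) raise_car]])
        (auto simp: \<eta>_def intro!: tuple_polys_mult tuple_polys_coord)
    ultimately have e: "e \<in> cochains borel3 (Suc j) EndSec" by (auto simp: cochains_def)
    define n where "n = Suc (Suc j)"
    \<comment> \<open>the coefficients of \<open>raise\<close> and \<open>lower\<close> that remain in \<open>c \<union> d - \<partial>e\<close>\<close>
    define p1 where "p1 g = (g 0 $1$1 * g 0 $2$1) * ((g 1 $1$1) ^ CHAR('k) - (mat 1 :: 'k mat3) $ 1 $ 1)
      + (g 1 $1$1 * g 1 $2$1 * (g 0 $1$1)\<^sup>2 * g 0 $3$3) * ((g 0 $2$2) ^ CHAR('k) - (mat 1 :: 'k mat3) $ 2 $ 2)" for g :: "nat \<Rightarrow> 'k mat3"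
    define p2 where "p2 g = (\<eta> (g 1) * g 0 $3$3) * ((g 0 $2$1) ^ CHAR('k) - (mat 1 :: 'k mat3) $ 2 $ 1)" for g :: "nat \<Rightarrow> 'k mat3"
    have p: "p1 \<in> frob_ideal n" "p2 \<in> frob_ideal n"
      unfolding p1_def[abs_def] p2_def[abs_def] \<eta>_def n_def
      by (intro frob_ideal_add frob_ideal_mult frob_ideal_gen tuple_polys_intros; simp)+
    define G where "G g = scl EndSec (p1 g) (raise \<circ> W g) + scl EndSec (p2 g) (lower \<circ> W g) + scl EndSec (\<eta> (g 0)) (raise \<circ> V g)" for g
    have "(\<lambda>g. scl EndSec (p1 g) (raise \<circ> W g)) \<in> tensors (frob_ideal n) EndSec"
      "(\<lambda>g. scl EndSec (p2 g) (lower \<circ> W g)) \<in> tensors (frob_ideal n) EndSec"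
      using frob_ideal_mult_right[OF p(1)] frob_ideal_mult_right[OF p(2)]
      by (intro tensors_scl[OF tensors_comp[OF W(1) raise_car]] tensors_scl[OF tensors_comp[OF W(1) lower_car]],
          simp add: n_def)+
    moreover have "(\<lambda>g. \<eta> (g 0)) \<in> tuple_polys n"
      unfolding \<eta>_def n_def by (intro tuple_polys_intros) auto
    hence "(\<lambda>g. scl EndSec (\<eta> (g 0)) (raise \<circ> V g)) \<in> tensors (frob_ideal n) EndSec"
      by (intro tensors_scl[OF tensors_comp[OF V(1) raise_car]] frob_ideal_mult) (simp_all add: n_def)
    ultimately have "G \<in> tensors (frob_ideal n) EndSec"
      unfolding G_def[abs_def] by (intro tensors_add)
    moreover have "cup EndSec 2 alpha_class d g - cobound EndSec (Suc j) e g = G g" if g: "g \<in> points borel3 n" for g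
    proof (intro ext)
      fix v y
      have b: "g 0 \<in> borel3" "g 1 \<in> borel3" using g by (auto simp: points_def n_def)
      define h where "h = (\<lambda>i. g (2 + i))"
      have h: "sh (sh g) = h" by (simp add: sh_def h_def)
      have dh: "d h \<in> car EndSec" unfolding h[symmetric] by (rule dE, rule sh, rule sh) (use g in \<open>simp add: n_def\<close>)
      have shg: "sh g \<in> points borel3 (Suc j)" using sh g by (simp add: n_def)
      define U' where "U' = act EndSec (g 1) (d h)"
      define W' where "W' = act EndSec (g 0) U'"
      have U': "U' \<in> car EndSec" and W': "W' \<in> car EndSec"
        unfolding U'_def W'_def by (intro E_act_car b dh)+
      have "U (sh g) = act EndSec (sh g 0) (D (sh (sh g)))" using U(2) pts1[OF shg] by metis
      also have "D (sh (sh g)) = d h" using D(2) sh[OF shg] unfolding h by metis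
      also have "sh g 0 = g 1" by (simp add: sh_def)
      finally have "U (sh g) = U'" by (simp add: U'_def)
      moreover have "W g = act EndSec (g 0) (U (sh g))" using W(2) pts1[OF g[unfolded n_def]] by metis
      ultimately have Wg: "W g = W'" by (simp add: W'_def)
      have W12: "act EndSec (g 0 ** g 1) (d h) = W'"
        unfolding W'_def U'_def by (rule E_act_mult[OF b dh])
      have Vg: "V g = act EndSec (g 0) (K (sh g))" using V(2) pts1[OF g[unfolded n_def]] by simp
      have cob: "cobound EndSec k f p v' y' = act EndSec (p 0) (f (sh p)) v' y' + (\<Sum>i<k. f (gface i p) v' y') + f p v' y'"
        if "v' \<in> car Sec" "p 0 \<in> borel3" for k f p v' y'
        unfolding cobound_End_apply[where g = p, OF two that]
        by (simp add: that E_act sh_def H0_act matrix_inv_borel3)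
      show "(cup EndSec 2 alpha_class d g - cobound EndSec (Suc j) e g) v y = G g v y"
      proof (cases "v \<in> car Sec")
        case False
        have "act EndSec c \<phi> v = 0" if "c \<in> borel3" for c \<phi> using that False by (simp add: E_act)
        thus ?thesis using False b
          by (simp add: cup_def cobound_def G_def E_scl End_sum_apply)
      next
        case v: True
        let ?w = "W' v"
        have w: "?w \<in> car Sec" by (rule E_apply(1)[OF W' v])
        define Q where "Q = (\<Sum>i<j. d (gface i (sh g))) + d (sh g)"
        have fE: "d (gface i (sh g)) \<in> car EndSec" if "i < j" for i
          by (rule dE) (use shg that in \<open>auto simp: points_def gface_def intro!: borel3_mult\<close>)
        have sE: "d (sh g) \<in> car EndSec" by (rule dE) (use shg in \<open>simp add: points_def\<close>)
        define A where "A \<phi> = raise (act EndSec (g 0) \<phi> v) y" for \<phi>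
        have A_add: "A (\<phi> + \<psi>) = A \<phi> + A \<psi>" if "\<phi> \<in> car EndSec" "\<psi> \<in> car EndSec" for \<phi> \<psi>
        proof -
          have "act EndSec (g 0) \<phi> v \<in> car Sec" "act EndSec (g 0) \<psi> v \<in> car Sec"
            using that b v by (auto intro: E_apply(1) E_act_car)
          thus ?thesis
            by (simp add: A_def E_act_add[OF b(1) that] E_apply(2)[OF raise_car])
        qed
        have A_sum: "(\<Sum>i\<in>I. \<phi> i) \<in> car EndSec \<and> A (\<Sum>i\<in>I. \<phi> i) = (\<Sum>i\<in>I. A (\<phi> i))"
          if "finite I" "\<And>i. i \<in> I \<Longrightarrow> \<phi> i \<in> car EndSec" for I :: "nat set" and \<phi>
          using that
        proof (induction I)
          case empty
          have "A 0 = 0" using A_add[OF E_closed(1) E_closed(1)] by (simp add: two)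
          thus ?case using E_closed(1) unfolding sum.empty by blast
        next
          case (insert i I)
          hence IH: "sum \<phi> I \<in> car EndSec" "A (sum \<phi> I) = (\<Sum>i\<in>I. A (\<phi> i))" and i: "\<phi> i \<in> car EndSec" by auto
          show ?case
            unfolding sum.insert[OF insert(1,2)] A_add[OF i IH(1)] IH(2) using E_closed(2)[OF i IH(1)] by blast
        qed
        have QE: "Q \<in> car EndSec" and AQ: "A Q = (\<Sum>i<j. A (d (gface i (sh g)))) + A (d (sh g))"
          using A_sum[of "{..<j}" "\<lambda>i. d (gface i (sh g))"] fE sE unfolding Q_def
          by (auto intro: E_closed(2) simp: A_add)
        \<comment> \<open>All faces of \<open>g\<close> but the first two come from faces of its shift. Their sum \<open>Q\<close> is the
          coboundary of \<open>d\<close> without its first term.\<close>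
        have "K (sh g) + U' = Q"
        proof (intro ext)
          fix v' y'
          show "(K (sh g) + U') v' y' = Q v' y'"
          proof (cases "v' \<in> car Sec")
            case True
            have "K (sh g) v' y' = cobound EndSec j d (sh g) v' y'" using K(2) shg by simp
            also have "\<dots> = U' v' y' + Q v' y'"
              using cob[OF True, of "sh g" j d y'] b
              by (simp add: h U'_def Q_def End_sum_apply) (simp add: sh_def)
            finally have "(K (sh g) + U') v' y' = Q v' y' + (U' v' y' + U' v' y')" by (simp add: ac_simps)
            thus ?thesis by (simp only: char2_add_self[OF two] add_0_right)
          qed (simp add: E_off[OF KE] E_off[OF U'] E_off[OF QE])
        qed
        hence AQ': "A Q = raise (V g v) y + raise ?w y"
          using A_add[OF KE U', of "sh g"] by (simp add: A_def Vg W'_def)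
        have t1: "act EndSec (g 0) (e (sh g)) v y = \<eta> (g 1) * ((g 0$1$1)\<^sup>2 * g 0$3$3 * raise ?w y
            + g 0$1$1 * g 0$3$3 * g 0$2$1 * ?w y + g 0$3$3 * (g 0$2$1)\<^sup>2 * lower ?w y)"
        proof -
          have "e (sh g) = scl EndSec (\<eta> (g 1)) (raise \<circ> U')"
            by (simp add: e_def h U'_def) (simp add: sh_def)
          hence "act EndSec (g 0) (e (sh g)) = scl EndSec (\<eta> (g 1)) (act EndSec (g 0) raise \<circ> W')"
            by (simp add: E_act_scl[OF b(1) E_comp[OF raise_car U']] E_act_comp[OF b(1) raise_car U'] W'_def)
          thus ?thesis using v by (simp add: E_scl act_raise[OF m b(1) w])
        qed
        have t2: "e (gface 0 g) v y = \<eta> (g 0 ** g 1) * raise ?w y"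
        proof -
          have "sh (gface 0 g) = h" by (auto simp: sh_def gface_def h_def)
          moreover have "gface 0 g 0 = g 0 ** g 1" by (simp add: gface_def)
          ultimately show ?thesis using v by (simp add: e_def E_scl W12 del: One_nat_def)
        qed
        have t3: "e (gface (Suc i) g) v y = \<eta> (g 0) * A (d (gface i (sh g)))" for i
        proof -
          have "sh (gface (Suc i) g) = gface i (sh g)" by (auto simp: sh_def gface_def)
          moreover have "gface (Suc i) g 0 = g 0" by (simp add: gface_def)
          ultimately show ?thesis using v by (simp add: e_def E_scl A_def)
        qed
        have t4: "e g v y = \<eta> (g 0) * A (d (sh g))"
          using v by (simp add: e_def E_scl A_def)
        have "cobound EndSec (Suc j) e g v y = act EndSec (g 0) (e (sh g)) v y + e (gface 0 g) v y + \<eta> (g 0) * A Q"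
          by (simp add: cob[OF v, of g, OF b(1)] sum.lessThan_Suc_shift t3 t4 AQ sum_distrib_left distrib_left
              add.assoc del: sum.lessThan_Suc)
        hence co: "cobound EndSec (Suc j) e g v y = \<eta> (g 1) * ((g 0$1$1)\<^sup>2 * g 0$3$3 * raise ?w y
            + g 0$1$1 * g 0$3$3 * g 0$2$1 * ?w y + g 0$3$3 * (g 0$2$1)\<^sup>2 * lower ?w y)
            + \<eta> (g 0 ** g 1) * raise ?w y + \<eta> (g 0) * (raise (V g v) y + raise ?w y)"
          by (simp only: t1 t2 AQ')
        have "seq_prod 2 g = g 0 ** g 1" by (simp add: numeral_2_eq_2)
        hence cup: "cup EndSec 2 alpha_class d g v y = alpha_class g * ?w y"
          using v unfolding cup_def h_def[symmetric] by (simp add: E_scl W12 del: One_nat_def)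
        have "g 0$1$2 = 0" "g 0$1$3 = 0" "g 0$2$3 = 0" "g 1$1$2 = 0" "g 1$1$3 = 0" "g 1$2$3 = 0"
          and det: "g 0$1$1 * g 0$2$2 * g 0$3$3 = 1"
          using b by (auto simp: borel3_iff)
        hence \<eta>01: "\<eta> (g 0 ** g 1) = g 0$1$1 * g 1$1$1 * (g 0$2$1 * g 1$1$1 + g 0$2$2 * g 1$2$1)"
          by (simp add: \<eta>_def matrix_matrix_mult_def sum_3)
        have "G g v y = p1 g * raise ?w y + p2 g * lower ?w y + \<eta> (g 0) * raise (V g v) y"
          using v by (simp add: G_def E_scl Wg)
        also have "\<dots> = alpha_class g * ?w y - cobound EndSec (Suc j) e g v y"
          unfolding co \<eta>01 unfolding p1_def p2_def char \<eta>_def alpha_class_def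
          using nullhomotopy_identity[OF two det] by (simp add: mat_def)
        finally show ?thesis by (simp add: cup)
      qed
    qed
    ultimately show ?thesis
      using e by (auto simp: coboundaries_def null_cochains_def n_def)
  qed
  thus ?thesis using alpha_class_cocycle by (simp add: ext_annihilator_def)
qed

end

theorem theorem6p3p1:
  fixes l1 l2 :: int
    and M :: "('k::alg_closed_field, 'k mat3 \<Rightarrow> 'k) rmod"
  assumes "CHAR('k) = 2"
    and "l1 \<ge> 0" and "l2 \<ge> 0"
    and "M = H0 (s_alpha ** s_beta) l1 l2"
  shows "(\<forall>n\<ge>1. (l1, l2) = (2 * n - 1, 0) \<longrightarrow> support_variety_B1 M = lie_u_alpha)
    \<and> (\<forall>n\<ge>0. (l1, l2) = (2 * n, 0) \<longrightarrow> support_variety_B1 M = lie_u_alpha \<union> lie_u_beta)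
    \<and> (l2 \<noteq> 0 \<longrightarrow> support_variety_B1 M = lie_u_alpha \<union> lie_u_beta)"
proof -
  note char = assms(1)
  have two: "(2::'k) = 0" using of_nat_CHAR[where 'a = 'k] char by simp
  define a c where "a = nat l1" and "c = nat l2"
  have l: "l1 = int a" "l2 = int c" using assms(2,3) by (simp_all add: a_def c_def)
  have M: "M = H0 w_ab (int a) (int c)" using assms(4) l by simp
  have sub: "support_variety_B1 M \<subseteq> lie_u_alpha \<union> lie_u_beta"
    by (auto simp: support_variety_B1_def simp flip: N1_u_eq)
  have alpha: "lie_u_alpha \<subseteq> support_variety_B1 M"
    unfolding M using lie_u_alpha_support[OF char two] by blast
  have beta: "lie_u_beta \<subseteq> support_variety_B1 M" if "even a \<or> c \<noteq> 0"
    unfolding M using lie_u_beta_support[OF char two _ that] by blast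
  have "support_variety_B1 M = lie_u_alpha" if "odd a" "c = 0"
  proof
    show "support_variety_B1 M \<subseteq> lie_u_alpha"
    proof
      fix x assume x: "x \<in> support_variety_B1 M"
      hence xN: "x \<in> N1_u" by (simp add: support_variety_B1_def)
      have "alpha_class \<in> ext_annihilator borel3 2 M"
        using alpha_class_annihilates[OF char two that(1)] that(2) by (simp add: M)
      hence "alpha_class \<in> coboundaries (one_param x) (Suc 1) triv_mod"
        using x by (auto simp: support_variety_B1_def numeral_2_eq_2)
      from topcoeff_coboundary[OF char two xN this] topcoeff_alpha_class[OF char two xN]
      have "x$2$1 = 0" by (simp add: numeral_2_eq_2)
      thus "x \<in> lie_u_alpha" using xN by (simp add: lie_u_alpha_iff)
    qed
  qed (rule alpha)
  moreover have "support_variety_B1 M = lie_u_alpha \<union> lie_u_beta" if "even a \<or> c \<noteq> 0"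
    using sub alpha beta[OF that] by blast
  moreover have "odd a" if "l1 = 2 * n - 1" for n using that l by presburger
  moreover have "even a" if "l1 = 2 * n" for n using that l by presburger
  ultimately show ?thesis by (auto simp: l)
qed

end
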